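(* Let $d\ge 1$, $1\le r\le\infty$, and let $\sigma,s\in\mathbb{R}$ satisfy $\sigma+s>0$. Let $u_0\in \dot B^{-s}_{2,\infty}(\mathbb{R}^d)\cap\dot B^{\sigma}_{2,r}(\mathbb{R}^d)$ and let $u$ be the solution of the linear problem $$u_t-\Delta Pu=0\quad (x\in\mathbb{R}^d,\ t>0),\qquad u(x,0)=u_0(x).$$ Then there exists a constant $C_0$ such that, for all $t\ge 0$, $$\|u(t)\|_{\dot B^{-s}_{2,\infty}}\le C_0 .$$ In addition, there are positive constants $\lambda$ and $C$ (independent of $t$ and $u_0$) such that, for all $t\ge0$, $$\|u(t)\|_{\dot B^{\sigma}_{2,r}}\le C(1+t)^{-\frac{\sigma+s}{2}}\|u_0\|_{\dot B^{-s}_{2,\infty}}+Ce^{-\lambda t}\|u_0\|_{\dot B^{\sigma}_{2,r}} .$$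
   Context: Fourier transform: $\hat f(\xi)=\int_{\mathbb{R}^d}e^{-ix\cdot\xi}f(x)\,dx$. The operator $P$ is the Fourier multiplier $\widehat{Pu}(\xi)=\frac{1}{1+|\xi|^2}\hat u(\xi)$, so $-\Delta P$ has symbol $\frac{|\xi|^2}{1+|\xi|^2}$. Littlewood--Paley decomposition: let $\chi$ be a smooth function with values in $[0,1]$, supported in the ball $B(0,4/3)$ and equal to $1$ on $B(0,3/4)$; set $\varphi(\xi)=\chi(\xi/2)-\chi(\xi)$ and $\dot\Delta_k=\varphi(2^{-k}D)$ for $k\in\mathbb{Z}$ (the Fourier multiplier with symbol $\varphi(2^{-k}\xi)$). $\mathcal{S}_h'$ denotes the space of tempered distributions modulo polynomials, i.e. those for which $u=\sum_{k\in\mathbb{Z}}\dot\Delta_k u$. For $s\in\mathbb{R}$, $1\le p,q\le\infty$, the homogeneous Besov space $\dot B^s_{p,q}$ is the set of $f\in\mathcal{S}_h'$ with finite norm $\|f\|_{\dot B^s_{p,q}}=\big(\sum_{k\in\mathbb{Z}}(2^{ks}\|\dot\Delta_kf\|_{L^p})^q\big)^{1/q}$ if $q<\infty$, and $\|f\|_{\dot B^s_{p,\infty}}=\sup_{k\in\mathbb{Z}}2^{ks}\|\dot\Delta_kf\|_{L^p}$. *)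

theory Defs
  imports "HOL-Probability.Probability"
begin

text \<open>
  The Euclidean space of dimension \<open>d \<ge> 1\<close> is an arbitrary type of class
  \<open>euclidean_space\<close>, with \<open>d = DIM('a)\<close>.
\<close>

section \<open>Schwartz functions\<close>

text \<open>Iterated partial derivatives; multi-indices are lists of coordinate directions.\<close>

fun pderivs :: "'a list \<Rightarrow> ('a::euclidean_space \<Rightarrow> 'b::real_normed_vector) \<Rightarrow> 'a \<Rightarrow> 'b" where
  "pderivs [] f = f"
| "pderivs (b # bs) f = (\<lambda>x. frechet_derivative (pderivs bs f) (at x) b)"

definition smooth :: "('a::euclidean_space \<Rightarrow> 'b::real_normed_vector) \<Rightarrow> bool" where
  "smooth f \<longleftrightarrow> (\<forall>bs. set bs \<subseteq> Basis \<longrightarrow> pderivs bs f differentiable_on UNIV)"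

definition schwartz :: "('a::euclidean_space \<Rightarrow> complex) set" where
  "schwartz = {f. smooth f \<and>
     (\<forall>N bs. set bs \<subseteq> Basis \<longrightarrow>
        bounded (range (\<lambda>x. (1 + norm x) ^ N *\<^sub>R pderivs bs f x)))}"

definition schwartz_seminorm :: "nat \<Rightarrow> ('a::euclidean_space \<Rightarrow> complex) \<Rightarrow> real" where
  "schwartz_seminorm N f =
     (SUP (bs, x) \<in> {bs. set bs \<subseteq> Basis \<and> length bs \<le> N} \<times> UNIV.
        (1 + norm x) ^ N * norm (pderivs bs f x))"

section \<open>Tempered distributions\<close>

text \<open>
  A tempered distribution is a functional of which only the values on Schwartz functions are
  meaningful; its values elsewhere are arbitrary and never used.  In particular two
  distributions are the same when they agree on \<open>schwartz\<close>.
\<close>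

type_synonym 'a functional = "('a \<Rightarrow> complex) \<Rightarrow> complex"

definition tempered :: "'a::euclidean_space functional set" where
  "tempered = {T.
     (\<forall>f\<in>schwartz. \<forall>g\<in>schwartz. T (\<lambda>x. f x + g x) = T f + T g) \<and>
     (\<forall>c. \<forall>f\<in>schwartz. T (\<lambda>x. c * f x) = c * T f) \<and>
     (\<exists>N C. \<forall>f\<in>schwartz. norm (T f) \<le> C * schwartz_seminorm N f)}"

definition fourier :: "('a::euclidean_space \<Rightarrow> complex) \<Rightarrow> 'a \<Rightarrow> complex" where
  "fourier f \<xi> = (LINT x|lborel. exp (- \<i> * complex_of_real (x \<bullet> \<xi>)) * f x)"

definition inv_fourier :: "('a::euclidean_space \<Rightarrow> complex) \<Rightarrow> 'a \<Rightarrow> complex" where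
  "inv_fourier f x =
     complex_of_real (1 / (2 * pi) ^ DIM('a)) *
       (LINT \<xi>|lborel. exp (\<i> * complex_of_real (x \<bullet> \<xi>)) * f \<xi>)"

text \<open>The operations on distributions are the transposes of those on test functions.\<close>

definition fourier_distr :: "'a::euclidean_space functional \<Rightarrow> 'a functional" where
  "fourier_distr T = (\<lambda>\<psi>. T (fourier \<psi>))"

definition inv_fourier_distr :: "'a::euclidean_space functional \<Rightarrow> 'a functional" where
  "inv_fourier_distr T = (\<lambda>\<psi>. T (inv_fourier \<psi>))"

definition mult_distr :: "('a::euclidean_space \<Rightarrow> real) \<Rightarrow> 'a functional \<Rightarrow> 'a functional" where
  "mult_distr m T = (\<lambda>\<psi>. T (\<lambda>\<xi>. complex_of_real (m \<xi>) * \<psi> \<xi>))"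

definition fourier_multiplier :: "('a::euclidean_space \<Rightarrow> real) \<Rightarrow> 'a functional \<Rightarrow> 'a functional" where
  "fourier_multiplier m T = inv_fourier_distr (mult_distr m (fourier_distr T))"

definition laplacian :: "('a::euclidean_space \<Rightarrow> complex) \<Rightarrow> 'a \<Rightarrow> complex" where
  "laplacian f x = (\<Sum>b\<in>Basis. pderivs [b, b] f x)"

definition laplacian_distr :: "'a::euclidean_space functional \<Rightarrow> 'a functional" where
  "laplacian_distr T = (\<lambda>\<psi>. T (laplacian \<psi>))"

section \<open>Littlewood--Paley decomposition and homogeneous Besov spaces\<close>

text \<open>
  Vanishing outside the open ball is all that is required of the support, which covers
  both the reading of \<open>B(0,4/3)\<close> as an open and as a closed ball.
\<close>

definition lp_cutoff :: "('a::euclidean_space \<Rightarrow> real) \<Rightarrow> bool" where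
  "lp_cutoff chi \<longleftrightarrow> smooth chi \<and> range chi \<subseteq> {0..1} \<and>
     (\<forall>\<xi>. \<xi> \<notin> ball 0 (4/3) \<longrightarrow> chi \<xi> = 0) \<and> (\<forall>\<xi>\<in>ball 0 (3/4). chi \<xi> = 1)"

definition lp_phi :: "('a::euclidean_space \<Rightarrow> real) \<Rightarrow> 'a \<Rightarrow> real" where
  "lp_phi chi \<xi> = chi ((1/2) *\<^sub>R \<xi>) - chi \<xi>"

definition lp_block :: "('a::euclidean_space \<Rightarrow> real) \<Rightarrow> int \<Rightarrow> 'a functional \<Rightarrow> 'a functional" where
  "lp_block chi k = fourier_multiplier (\<lambda>\<xi>. lp_phi chi ((2 powi (- k)) *\<^sub>R \<xi>))"

text \<open>
  The two-sided series converges in the weak topology of tempered distributions, the two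
  ends of the partial sums tending to infinity independently.
\<close>

definition S_h :: "('a::euclidean_space \<Rightarrow> real) \<Rightarrow> 'a functional set" where
  "S_h chi = {T \<in> tempered. \<forall>\<psi>\<in>schwartz.
     ((\<lambda>(m, n). \<Sum>k\<in>{- int m..int n}. lp_block chi k T \<psi>) \<longlongrightarrow> T \<psi>)
       (sequentially \<times>\<^sub>F sequentially)}"

text \<open>Power of an extended nonnegative number, used with a positive exponent only.\<close>

definition ennpowr :: "ennreal \<Rightarrow> real \<Rightarrow> ennreal" where
  "ennpowr x a = (if x = \<infinity> then \<infinity> else ennreal (enn2real x powr a))"

definition Lp_norm :: "ennreal \<Rightarrow> ('a::euclidean_space \<Rightarrow> complex) \<Rightarrow> ennreal" where
  "Lp_norm p f =
     (if p = \<infinity> then esssup lborel (\<lambda>x. ennreal (norm (f x)))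
      else ennpowr (\<integral>\<^sup>+x. ennpowr (ennreal (norm (f x))) (enn2real p) \<partial>lborel) (1 / enn2real p))"

definition represents :: "('a::euclidean_space \<Rightarrow> complex) \<Rightarrow> 'a functional \<Rightarrow> bool" where
  "represents f T \<longleftrightarrow> f \<in> borel_measurable lborel \<and>
     (\<forall>\<psi>\<in>schwartz. integrable lborel (\<lambda>x. f x * \<psi> x) \<and>
        T \<psi> = (LINT x|lborel. f x * \<psi> x))"

text \<open>
  All functions representing a distribution agree almost everywhere, so the infimum is the
  common value of their norms; it is \<open>\<infinity>\<close> if there is no such function.
\<close>

definition Lp_norm_distr :: "ennreal \<Rightarrow> 'a::euclidean_space functional \<Rightarrow> ennreal" where
  "Lp_norm_distr p T = (INF f\<in>{f. represents f T}. Lp_norm p f)"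

definition besov_norm ::
    "('a::euclidean_space \<Rightarrow> real) \<Rightarrow> real \<Rightarrow> ennreal \<Rightarrow> ennreal \<Rightarrow> 'a functional \<Rightarrow> ennreal" where
  "besov_norm chi s p q T =
     (if q = \<infinity>
      then (SUP k::int. ennreal (2 powr (of_int k * s)) * Lp_norm_distr p (lp_block chi k T))
      else ennpowr
        (\<Sum>\<^sub>\<infinity>k::int.
           ennpowr (ennreal (2 powr (of_int k * s)) * Lp_norm_distr p (lp_block chi k T)) (enn2real q))
        (1 / enn2real q))"

definition besov_space ::
    "('a::euclidean_space \<Rightarrow> real) \<Rightarrow> real \<Rightarrow> ennreal \<Rightarrow> ennreal \<Rightarrow> 'a functional set" where
  "besov_space chi s p q = {T \<in> S_h chi. besov_norm chi s p q T < \<infinity>}"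

section \<open>The linear problem\<close>

definition P_op :: "'a::euclidean_space functional \<Rightarrow> 'a functional" where
  "P_op = fourier_multiplier (\<lambda>\<xi>. 1 / (1 + (norm \<xi>)\<^sup>2))"

text \<open>
  The equation \<open>u\<^sub>t - \<Delta>Pu = 0\<close> in the sense of tempered distributions: \<open>u\<close> is
  a curve of tempered distributions, continuous up to \<open>t = 0\<close> and differentiable for
  \<open>t > 0\<close> in the weak topology.
\<close>

definition solves_linear ::
    "(real \<Rightarrow> 'a::euclidean_space functional) \<Rightarrow> 'a functional \<Rightarrow> bool" where
  "solves_linear u u0 \<longleftrightarrow>
     (\<forall>t\<ge>0. u t \<in> tempered) \<and>
     (\<forall>\<psi>\<in>schwartz. u 0 \<psi> = u0 \<psi>) \<and>
     (\<forall>\<psi>\<in>schwartz. continuous_on {0..} (\<lambda>t. u t \<psi>)) \<and>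
     (\<forall>\<psi>\<in>schwartz. \<forall>t>0. \<exists>D.
        ((\<lambda>\<tau>. u \<tau> \<psi>) has_vector_derivative D) (at t) \<and>
        D - laplacian_distr (P_op (u t)) \<psi> = 0)"

end

theory Submission
  imports Defs
begin

text \<open>
  On the Fourier side the equation is diagonal: \<open>- \<Delta> P\<close> has the symbol
  \<open>m(\<xi>) = |\<xi>|\<^sup>2 / (1 + |\<xi>|\<^sup>2)\<close>, so the transform of \<open>u(t)\<close> is that of \<open>u\<^sub>0\<close> times
  \<open>exp(- t m)\<close>.  On the annulus \<open>|\<xi>| \<approx> 2^k\<close> the symbol is at least \<open>min(1, 4^k) / 9\<close>, hence the
  dyadic block number \<open>k\<close> loses the factor \<open>exp(- t min(1, 4^k) / 9)\<close> in \<open>L\<^sup>2\<close>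
  (\<open>block_decay\<close>).  The blocks with \<open>k \<ge> 0\<close> decay exponentially.  For \<open>k < 0\<close> the weight
  \<open>2^(k \<sigma>)\<close> is compared with the weight \<open>2^(- k s)\<close> of the norm of index \<open>- s\<close>, which leaves the sum of
  \<open>2^(k (\<sigma> + s)) exp(- t 4^k / 9)\<close>.  Only the indices with \<open>4^k \<approx> 1 / (1 + t)\<close> matter in
  it, so it is of size \<open>(1 + t)^(- (\<sigma> + s) / 2)\<close> (\<open>low_frequency_sum\<close>).

  Two steps are more than a computation.

  First, a solution is only a weakly differentiable curve of tempered distributions, and the order
  and the constant of \<open>u(t)\<close> may vary wildly with \<open>t\<close>.  The formula for the transform of \<open>u(t)\<close> is
  therefore a uniqueness theorem (\<open>evolution_fourier_side\<close>).  Tested against \<open>\<phi>\<close>, the transform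
  is a function of time whose \<open>n\<close>-th derivative is its value on \<open>(- m)^n \<phi>\<close>; at each single time
  these derivatives grow geometrically in \<open>n\<close>, with a ratio depending on the time.  The uniform
  boundedness principle, applied to the superpositions of all \<open>(- m)^n \<phi>\<close> with bounded sequences
  of coefficients divided by \<open>sqrt(n!)\<close>, yields one bound \<open>B sqrt(n!)\<close> on the whole interval
  (\<open>uniform_boundedness_sequences\<close>).  This is enough for the Taylor series in time to converge,
  and that series is \<open>exp(- t m)\<close>.

  Second, the \<open>L\<^sup>2\<close> norm of a distribution is an infimum over representing functions, so a function
  has to be exhibited.  If \<open>f\<close> represents a block of \<open>u\<^sub>0\<close>, then the convolution of \<open>f\<close> with the
  inverse transform of \<open>M\<close> represents the same block of \<open>u(t)\<close>, where \<open>M\<close> is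
  \<open>exp(- t m)\<close> times a window equal to one on the annulus of the block.  Its \<open>L\<^sup>2\<close> norm is at
  most \<open>sup |M|\<close> times that of \<open>f\<close> (\<open>convolve_L2_bound\<close>): it is tested against its own truncated
  conjugate, and the multiplier is moved to that integrable test function, where two applications
  of the Bessel inequality \<open>\<integral>|F p|\<^sup>2 \<le> (2\<pi>)^d \<integral>|p|\<^sup>2\<close> suffice.  The Bessel inequality
  (\<open>fourier_bessel\<close>) and the inversion formula (\<open>fourier_fourier\<close>) both come from inserting a
  Gaussian cutoff in frequency, whose transform is a positive kernel of mass \<open>(2\<pi>)^d\<close>.
\<close>

section \<open>Iterated partial derivatives\<close>

text \<open>
  The directional derivative as a function of the point; with it the recursion of \<open>pderivs\<close> can be
  used as a rewrite rule without unfolding the Frechet derivative.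
\<close>

definition pd :: "'a \<Rightarrow> ('a::euclidean_space \<Rightarrow> 'b::real_normed_vector) \<Rightarrow> 'a \<Rightarrow> 'b" where
  "pd b f = (\<lambda>x. frechet_derivative f (at x) b)"

lemma pderivs_Cons: "pderivs (b # bs) f = pd b (pderivs bs f)"
  by (simp add: pd_def)

lemma pderivs_append: "pderivs (as @ bs) f = pderivs as (pderivs bs f)"
  by (induction as) (simp_all add: pderivs_Cons del: pderivs.simps(2))

lemma pderivs_snoc: "pderivs (bs @ [b]) f = pderivs bs (pd b f)"
  by (simp add: pderivs_append pd_def)

declare pderivs.simps(2) [simp del] pderivs_Cons [simp]

lemma pd_eqI: "(\<And>x. (f has_derivative f' x) (at x)) \<Longrightarrow> pd b f = (\<lambda>x. f' x b)"
  by (rule ext) (metis pd_def frechet_derivative_at)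

lemma has_derivative_frechet:
  "f differentiable_on UNIV \<Longrightarrow> (f has_derivative frechet_derivative f (at x)) (at x)"
  by (metis differentiable_on_def UNIV_I frechet_derivative_works)

lemma differentiable_onI_has: "(\<And>x. (f has_derivative f' x) (at x)) \<Longrightarrow> f differentiable_on UNIV"
  by (auto simp: differentiable_on_def differentiable_def)

text \<open>
  Differentiability to order \<open>n\<close> with all derivatives in a class \<open>G\<close>.  The recursion removes the
  innermost derivative, whereas \<open>pderivs\<close> adds outermost ones; in this form the product rule gives
  an induction on \<open>n\<close>.  With \<open>G\<close> the class of all functions this is smoothness, with
  \<open>G\<close> the bounded functions it describes the symbols used below.
\<close>

fun iter_diff :: "nat \<Rightarrow> ('a \<Rightarrow> 'b) set \<Rightarrow> ('a::euclidean_space \<Rightarrow> 'b::real_normed_vector) \<Rightarrow> bool" where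
  "iter_diff 0 G f \<longleftrightarrow> f \<in> G"
| "iter_diff (Suc n) G f \<longleftrightarrow> f \<in> G \<and> f differentiable_on UNIV \<and> (\<forall>b\<in>Basis. iter_diff n G (pd b f))"

text \<open>
  A list of directions can be split off at either end, so counting derivatives from the inside or
  from the outside gives the same notion.
\<close>

lemma iter_diff_iff_length:
  "iter_diff n G f \<longleftrightarrow> (\<forall>bs. set bs \<subseteq> Basis \<longrightarrow>
     (length bs \<le> n \<longrightarrow> pderivs bs f \<in> G) \<and> (length bs < n \<longrightarrow> pderivs bs f differentiable_on UNIV))"
proof (induction n arbitrary: f)
  case 0
  then show ?case by auto
next
  case (Suc n)
  show ?case (is "?L \<longleftrightarrow> ?R")
  proof
    assume L: ?L
    show ?R
    proof (intro allI impI)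
      fix bs :: "'a list" assume bs: "set bs \<subseteq> Basis"
      show "(length bs \<le> Suc n \<longrightarrow> pderivs bs f \<in> G) \<and>
          (length bs < Suc n \<longrightarrow> pderivs bs f differentiable_on UNIV)"
      proof (cases bs rule: rev_cases)
        case Nil
        then show ?thesis using L by auto
      next
        case (snoc cs b)
        then have "iter_diff n G (pd b f)" "set cs \<subseteq> Basis" using L bs by auto
        then show ?thesis using Suc.IH[of "pd b f"] by (auto simp: snoc pderivs_snoc)
      qed
    qed
  next
    assume R: ?R
    have "iter_diff n G (pd b f)" if b: "b \<in> Basis" for b
      unfolding Suc.IH
    proof (intro allI impI)
      fix cs :: "'a list" assume "set cs \<subseteq> Basis"
      then show "(length cs \<le> n \<longrightarrow> pderivs cs (pd b f) \<in> G) \<and>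
          (length cs < n \<longrightarrow> pderivs cs (pd b f) differentiable_on UNIV)"
        using R[rule_format, of "cs @ [b]"] b by (auto simp: pderivs_snoc)
    qed
    then show ?L using R[rule_format, of "[]"] by auto
  qed
qed

lemma iter_diff_iff:
  "(\<forall>n. iter_diff n G f) \<longleftrightarrow> smooth f \<and> (\<forall>bs. set bs \<subseteq> Basis \<longrightarrow> pderivs bs f \<in> G)"
  unfolding iter_diff_iff_length smooth_def
  by (meson le_less_linear lessI less_imp_le order_refl)

lemma smooth_iff_iter_diff: "smooth f \<longleftrightarrow> (\<forall>n. iter_diff n UNIV f)"
  by (simp add: iter_diff_iff)

lemma iter_diff_Suc_imp: "iter_diff (Suc n) G f \<Longrightarrow> iter_diff n G f"
  by (induction n arbitrary: f) auto

lemma smooth_differentiable: "smooth f \<Longrightarrow> f differentiable_on UNIV"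
  unfolding smooth_def by (metis empty_iff empty_subsetI list.set(1) pderivs.simps(1))

lemma smooth_pd: "smooth f \<Longrightarrow> b \<in> Basis \<Longrightarrow> smooth (pd b f)"
  unfolding smooth_iff_iter_diff by (metis iter_diff.simps(2))

lemma smooth_pderivs: "smooth f \<Longrightarrow> set bs \<subseteq> Basis \<Longrightarrow> smooth (pderivs bs f)"
  by (induction bs) (auto intro: smooth_pd)

lemma smooth_continuous: "smooth f \<Longrightarrow> continuous_on UNIV f"
  by (simp add: smooth_differentiable differentiable_imp_continuous_on)

lemma smooth_measurable: "smooth f \<Longrightarrow> f \<in> borel_measurable borel"
  by (simp add: smooth_continuous borel_measurable_continuous_onI)

lemma pd_add:
  assumes "f differentiable_on UNIV" "g differentiable_on UNIV"
  shows "pd b (\<lambda>x. f x + g x) = (\<lambda>x. pd b f x + pd b g x)"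
  using pd_eqI[OF has_derivative_add[OF assms[THEN has_derivative_frechet]]] by (simp add: pd_def)

lemma pd_mult:
  fixes f g :: "'a::euclidean_space \<Rightarrow> 'b::real_normed_algebra"
  assumes "f differentiable_on UNIV" "g differentiable_on UNIV"
  shows "pd b (\<lambda>x. f x * g x) = (\<lambda>x. f x * pd b g x + pd b f x * g x)"
  using pd_eqI[OF has_derivative_mult[OF assms[THEN has_derivative_frechet]]] by (simp add: pd_def)

lemma pd_linear:
  assumes "bounded_linear L" "f differentiable_on UNIV"
  shows "pd b (\<lambda>x. L (f x)) = (\<lambda>x. L (pd b f x))"
  using pd_eqI[OF bounded_linear.has_derivative[OF assms(1) has_derivative_frechet[OF assms(2)]]]
  by (simp add: pd_def)

lemma has_derivative_scaled:
  assumes "f differentiable_on UNIV"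
  shows "((\<lambda>x. f (c *\<^sub>R x)) has_derivative (\<lambda>h. c *\<^sub>R frechet_derivative f (at (c *\<^sub>R x)) h)) (at x)"
proof -
  have "((\<lambda>x. f (c *\<^sub>R x)) has_derivative (\<lambda>h. frechet_derivative f (at (c *\<^sub>R x)) (c *\<^sub>R h))) (at x)"
    by (rule has_derivative_compose[of "\<lambda>x. c *\<^sub>R x", OF _ has_derivative_frechet[OF assms]])
       (auto intro!: derivative_eq_intros)
  moreover have "linear (frechet_derivative f (at (c *\<^sub>R x)))"
    using assms by (simp add: differentiable_on_def linear_frechet_derivative)
  ultimately show ?thesis by (simp add: linear_cmul)
qed

lemma pd_scaled:
  assumes "f differentiable_on UNIV"
  shows "pd b (\<lambda>x. f (c *\<^sub>R x)) = (\<lambda>x. c *\<^sub>R pd b f (c *\<^sub>R x))"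
  using pd_eqI[OF has_derivative_scaled[OF assms]] by (simp add: pd_def)

lemma iter_diff_add:
  assumes "\<And>f g. f \<in> G \<Longrightarrow> g \<in> G \<Longrightarrow> (\<lambda>x. f x + g x) \<in> G"
  shows "iter_diff n G f \<Longrightarrow> iter_diff n G g \<Longrightarrow> iter_diff n G (\<lambda>x. f x + g x)"
proof (induction n arbitrary: f g)
  case (Suc n)
  then show ?case
    by (auto simp: pd_add assms intro!: derivative_intros)
qed (auto simp: assms)

lemma iter_diff_mult:
  fixes f g :: "'a::euclidean_space \<Rightarrow> 'b::real_normed_algebra"
  assumes "\<And>f g. f \<in> G \<Longrightarrow> g \<in> G \<Longrightarrow> (\<lambda>x. f x + g x) \<in> G"
    and "\<And>f g. f \<in> G \<Longrightarrow> g \<in> G \<Longrightarrow> (\<lambda>x. f x * g x) \<in> G"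
  shows "iter_diff n G f \<Longrightarrow> iter_diff n G g \<Longrightarrow> iter_diff n G (\<lambda>x. f x * g x)"
proof (induction n arbitrary: f g)
  case (Suc n)
  have "iter_diff n G f" "iter_diff n G g" using Suc.prems by (auto intro: iter_diff_Suc_imp)
  then show ?case using Suc
    by (auto simp: pd_mult assms intro!: derivative_intros iter_diff_add)
qed (auto simp: assms)

lemma smooth_add: "smooth f \<Longrightarrow> smooth g \<Longrightarrow> smooth (\<lambda>x. f x + g x)"
  by (simp add: smooth_iff_iter_diff iter_diff_add)

lemma smooth_mult:
  fixes f g :: "'a::euclidean_space \<Rightarrow> 'b::real_normed_algebra"
  shows "smooth f \<Longrightarrow> smooth g \<Longrightarrow> smooth (\<lambda>x. f x * g x)"
  by (simp add: smooth_iff_iter_diff iter_diff_mult)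

lemma pderivs_add:
  assumes "smooth f" "smooth g" "set bs \<subseteq> Basis"
  shows "pderivs bs (\<lambda>x. f x + g x) = (\<lambda>x. pderivs bs f x + pderivs bs g x)"
  using assms(3)
  by (induction bs) (auto simp: pd_add assms smooth_differentiable smooth_pderivs)

lemma pderivs_linear:
  assumes "bounded_linear L" "smooth f" "set bs \<subseteq> Basis"
  shows "pderivs bs (\<lambda>x. L (f x)) = (\<lambda>x. L (pderivs bs f x))"
  using assms(3)
  by (induction bs) (auto simp: pd_linear assms smooth_differentiable smooth_pderivs)

lemma smooth_linear:
  fixes f :: "'a::euclidean_space \<Rightarrow> 'b::real_normed_vector"
  assumes "bounded_linear L" "smooth f"
  shows "smooth (\<lambda>x. L (f x))"
  unfolding smooth_def
proof (intro allI impI)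
  fix bs :: "'a list" assume bs: "set bs \<subseteq> Basis"
  show "pderivs bs (\<lambda>x. L (f x)) differentiable_on UNIV"
    unfolding pderivs_linear[OF assms bs]
    using bounded_linear.has_derivative[OF assms(1) has_derivative_frechet[OF
      smooth_differentiable[OF smooth_pderivs[OF assms(2) bs]]]]
    by (rule differentiable_onI_has)
qed

lemma pderivs_scaled:
  assumes "smooth f" "set bs \<subseteq> Basis"
  shows "pderivs bs (\<lambda>x. f (c *\<^sub>R x)) = (\<lambda>x. c ^ length bs *\<^sub>R pderivs bs f (c *\<^sub>R x))"
  using assms(2)
proof (induction bs)
  case (Cons b bs)
  have d: "pderivs bs f differentiable_on UNIV"
    using Cons assms by (simp add: smooth_differentiable smooth_pderivs)
  have d2: "(\<lambda>x. pderivs bs f (c *\<^sub>R x)) differentiable_on UNIV"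
    by (rule differentiable_onI_has[OF has_derivative_scaled[OF d]])
  show ?case
    using Cons by (simp add: pd_linear[OF bounded_linear_scaleR_right d2] pd_scaled[OF d] ac_simps)
qed simp

lemma smooth_scaled:
  assumes "smooth f"
  shows "smooth (\<lambda>x. f (c *\<^sub>R x))"
  unfolding smooth_def
proof (intro allI impI)
  fix bs :: "'a list" assume bs: "set bs \<subseteq> Basis"
  have d: "pderivs bs f differentiable_on UNIV"
    using bs assms by (simp add: smooth_differentiable smooth_pderivs)
  show "pderivs bs (\<lambda>x. f (c *\<^sub>R x)) differentiable_on UNIV"
    unfolding pderivs_scaled[OF assms bs]
    by (rule differentiable_onI_has
      [OF bounded_linear.has_derivative[OF bounded_linear_scaleR_right has_derivative_scaled[OF d]]])
qed

text \<open>
  Each direction doubles the number of terms in the product rule.  The bounds are required at the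
  single point \<open>x\<close> only, so that they may contain powers of \<open>1 + |x|\<close>.
\<close>

lemma leibniz_bound:
  fixes f g :: "'a::euclidean_space \<Rightarrow> 'b::real_normed_algebra"
  assumes "smooth f" "smooth g" "set bs \<subseteq> Basis"
    and "\<And>cs. set cs \<subseteq> Basis \<Longrightarrow> length cs \<le> length bs \<Longrightarrow> norm (pderivs cs f x) \<le> A"
    and "\<And>cs. set cs \<subseteq> Basis \<Longrightarrow> length cs \<le> length bs \<Longrightarrow> norm (pderivs cs g x) \<le> B"
  shows "norm (pderivs bs (\<lambda>x. f x * g x) x) \<le> 2 ^ length bs * A * B"
  using assms
proof (induction "length bs" arbitrary: bs f g)
  case 0
  have "norm (f x * g x) \<le> norm (f x) * norm (g x)" by (rule norm_mult_ineq)
  also have "\<dots> \<le> A * B"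
    using 0(5)[of "[]"] 0(6)[of "[]"]
    by (intro mult_mono) (auto intro: order_trans[OF norm_ge_zero])
  finally show ?case using 0 by simp
next
  case (Suc n)
  then obtain cs b where bs: "bs = cs @ [b]" by (metis length_0_conv nat.distinct(1) rev_exhaust)
  have b: "b \<in> Basis" and cs: "set cs \<subseteq> Basis" and n: "n = length cs" using bs Suc by auto
  have f: "norm (pderivs ds f x) \<le> A" "norm (pderivs ds (pd b f) x) \<le> A"
    if "set ds \<subseteq> Basis" "length ds \<le> length cs" for ds
    using Suc.prems(4)[of ds] Suc.prems(4)[of "ds @ [b]"] that bs b by (auto simp: pderivs_snoc)
  have g: "norm (pderivs ds g x) \<le> B" "norm (pderivs ds (pd b g) x) \<le> B"
    if "set ds \<subseteq> Basis" "length ds \<le> length cs" for ds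
    using Suc.prems(5)[of ds] Suc.prems(5)[of "ds @ [b]"] that bs b by (auto simp: pderivs_snoc)
  have sm: "smooth f" "smooth g" "smooth (pd b f)" "smooth (pd b g)"
    using Suc.prems b by (auto intro: smooth_pd)
  have 1: "norm (pderivs cs (\<lambda>x. f x * pd b g x) x) \<le> 2 ^ length cs * A * B"
    by (rule Suc.hyps(1)[OF n sm(1) sm(4) cs f(1) g(2)])
  have 2: "norm (pderivs cs (\<lambda>x. pd b f x * g x) x) \<le> 2 ^ length cs * A * B"
    by (rule Suc.hyps(1)[OF n sm(3) sm(2) cs f(2) g(1)])
  have "pderivs bs (\<lambda>x. f x * g x) x
      = pderivs cs (\<lambda>x. f x * pd b g x) x + pderivs cs (\<lambda>x. pd b f x * g x) x"
    using sm cs by (simp add: bs pderivs_snoc pd_mult smooth_differentiable pderivs_add smooth_mult)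
  then have "norm (pderivs bs (\<lambda>x. f x * g x) x) \<le> 2 ^ length cs * A * B + 2 ^ length cs * A * B"
    using norm_triangle_mono[OF 1 2] by simp
  then show ?case by (simp add: bs mult_ac)
qed

lemma pderivs_eq_0_on_open:
  assumes "open U" "\<And>x. x \<in> U \<Longrightarrow> f x = 0" "x \<in> U"
  shows "pderivs bs f x = 0"
  using assms(3)
proof (induction bs arbitrary: x)
  case (Cons b bs)
  have "((\<lambda>_. 0) has_derivative (\<lambda>_. 0)) (at x)" by simp
  then have "(pderivs bs f has_derivative (\<lambda>_. 0)) (at x)"
    by (rule has_derivative_transform_within_open[OF _ assms(1) Cons.prems]) (use Cons in auto)
  from frechet_derivative_at[OF this, symmetric] show ?case by (simp add: pd_def)
qed (use assms in auto)

section \<open>Schwartz functions and tempered distributions\<close>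

abbreviation "dirs bs \<equiv> set bs \<subseteq> Basis"

text \<open>
  There are only finitely many lists of directions of length at most \<open>N\<close>, so the supremum that
  defines a seminorm is finite.
\<close>

lemma bounded_weighted_derivs:
  assumes f: "f \<in> schwartz"
  shows "bdd_above ((\<lambda>(bs, x). (1 + norm x) ^ N * norm (pderivs bs f x)) `
    ({bs. dirs bs \<and> length bs \<le> N} \<times> UNIV))"
proof -
  let ?A = "{bs::'a list. dirs bs \<and> length bs \<le> N}"
  have fin: "finite ?A" by (rule finite_lists_length_le) simp
  have "\<exists>B. \<forall>x. (1 + norm x) ^ N * norm (pderivs bs f x) \<le> B" if "bs \<in> ?A" for bs
  proof -
    have "bounded (range (\<lambda>x. (1 + norm x) ^ N *\<^sub>R pderivs bs f x))"
      using f that by (simp add: schwartz_def)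
    then show ?thesis by (auto simp: bounded_iff)
  qed
  then obtain B where B: "\<And>bs x. bs \<in> ?A \<Longrightarrow> (1 + norm x) ^ N * norm (pderivs bs f x) \<le> B bs"
    by metis
  have pos: "0 \<le> B bs" if "bs \<in> ?A" for bs
    using B[OF that, of 0] by (metis norm_ge_zero norm_zero add_0_right mult_1 order_trans power_one)
  have "(1 + norm x) ^ N * norm (pderivs bs f x) \<le> (\<Sum>bs\<in>?A. B bs)" if "bs \<in> ?A" for bs x
    using B[OF that, of x] member_le_sum[OF that, of B] pos fin by (meson DiffE order_trans)
  then show ?thesis by (intro bdd_aboveI[where M="\<Sum>bs\<in>?A. B bs"]) auto
qed

lemma schwartz_seminorm_bound:
  assumes "f \<in> schwartz" "dirs bs" "length bs \<le> N"
  shows "(1 + norm x) ^ N * norm (pderivs bs f x) \<le> schwartz_seminorm N f"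
  using cSUP_upper[OF _ bounded_weighted_derivs[OF assms(1)], of "(bs, x)" N] assms(2,3)
  by (simp add: schwartz_seminorm_def)

lemma schwartz_seminorm_nonneg:
  assumes "f \<in> schwartz"
  shows "0 \<le> schwartz_seminorm N f"
  using schwartz_seminorm_bound[OF assms, of "[]" N 0] by (auto intro: order_trans[OF norm_ge_zero])

lemma schwartz_seminorm_le:
  assumes "\<And>bs x. dirs bs \<Longrightarrow> length bs \<le> N \<Longrightarrow> (1 + norm x) ^ N * norm (pderivs bs f x) \<le> B"
  shows "schwartz_seminorm N f \<le> B"
  unfolding schwartz_seminorm_def using assms
  by (intro cSUP_least) (auto intro!: exI[of _ "[]"])

lemma schwartz_smooth: "f \<in> schwartz \<Longrightarrow> smooth f"
  by (simp add: schwartz_def)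

lemma schwartz_measurable: "f \<in> schwartz \<Longrightarrow> f \<in> borel_measurable borel"
  by (simp add: schwartz_smooth smooth_measurable)

lemma schwartz_seminorm_bound':
  assumes "f \<in> schwartz" "dirs bs" "length bs \<le> N" "k \<le> N"
  shows "(1 + norm x) ^ k * norm (pderivs bs f x) \<le> schwartz_seminorm N f"
proof -
  have "(1 + norm x) ^ k * norm (pderivs bs f x) \<le> (1 + norm x) ^ N * norm (pderivs bs f x)"
    by (intro mult_right_mono power_increasing assms) auto
  then show ?thesis using schwartz_seminorm_bound[OF assms(1-3)] by (rule order_trans)
qed

lemma schwartzI:
  assumes "smooth f"
    and "\<And>N bs. dirs bs \<Longrightarrow> \<exists>B. \<forall>x. (1 + norm x) ^ N * norm (pderivs bs f x) \<le> B"
  shows "f \<in> schwartz"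
  using assms by (auto simp: schwartz_def bounded_iff)

lemma schwartzI_N:
  assumes "smooth f"
    and "\<And>N. \<exists>B. \<forall>bs x. dirs bs \<longrightarrow> length bs \<le> N \<longrightarrow> (1 + norm x) ^ N * norm (pderivs bs f x) \<le> B"
  shows "f \<in> schwartz"
proof (rule schwartzI[OF assms(1)])
  fix N and bs :: "'a list" assume bs: "dirs bs"
  obtain B where B: "\<And>cs x. dirs cs \<Longrightarrow> length cs \<le> N + length bs \<Longrightarrow>
    (1 + norm x) ^ (N + length bs) * norm (pderivs cs f x) \<le> B" using assms(2) by blast
  have "(1 + norm x) ^ N * norm (pderivs bs f x) \<le> B" for x
  proof -
    have "(1 + norm x) ^ N * norm (pderivs bs f x)
      \<le> (1 + norm x) ^ (N + length bs) * norm (pderivs bs f x)"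
      by (intro mult_right_mono power_increasing) auto
    then show ?thesis using B[OF bs, of x] by simp
  qed
  then show "\<exists>B. \<forall>x. (1 + norm x) ^ N * norm (pderivs bs f x) \<le> B" by blast
qed

lemma schwartz_add: "f \<in> schwartz \<Longrightarrow> g \<in> schwartz \<Longrightarrow> (\<lambda>x. f x + g x) \<in> schwartz"
proof (rule schwartzI)
  fix N and bs :: "'a list"
  assume fg: "f \<in> schwartz" "g \<in> schwartz" and bs: "dirs bs"
  let ?M = "N + length bs"
  have "(1 + norm x) ^ N * norm (pderivs bs (\<lambda>x. f x + g x) x)
      \<le> schwartz_seminorm ?M f + schwartz_seminorm ?M g" for x
  proof -
    have "norm (pderivs bs f x + pderivs bs g x) \<le> norm (pderivs bs f x) + norm (pderivs bs g x)"
      by (rule norm_triangle_ineq)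
    then have "(1 + norm x) ^ N * norm (pderivs bs f x + pderivs bs g x)
      \<le> (1 + norm x) ^ N * (norm (pderivs bs f x) + norm (pderivs bs g x))"
      by (rule mult_left_mono) auto
    also have "\<dots> \<le> schwartz_seminorm ?M f + schwartz_seminorm ?M g"
      using schwartz_seminorm_bound'[OF fg(1) bs, of ?M N x] schwartz_seminorm_bound'[OF fg(2) bs, of ?M N x]
      by (simp add: algebra_simps)
    finally show ?thesis using fg bs by (simp add: pderivs_add schwartz_smooth)
  qed
  then show "\<exists>B. \<forall>x. (1 + norm x) ^ N * norm (pderivs bs (\<lambda>x. f x + g x) x) \<le> B" by blast
qed (simp add: smooth_add schwartz_smooth)

lemma schwartz_cmult: "f \<in> schwartz \<Longrightarrow> (\<lambda>x. c * f x) \<in> schwartz"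
  and schwartz_seminorm_cmult: "f \<in> schwartz \<Longrightarrow>
    schwartz_seminorm N (\<lambda>x. c * f x) \<le> norm c * schwartz_seminorm N f"
proof -
  assume f: "f \<in> schwartz"
  have eq: "pderivs bs (\<lambda>x. c * f x) = (\<lambda>x. c * pderivs bs f x)" if "dirs bs" for bs
    using f that by (simp add: pderivs_linear[OF bounded_linear_mult_right] schwartz_smooth)
  have b: "(1 + norm x) ^ N * norm (pderivs bs (\<lambda>x. c * f x) x) \<le> norm c * schwartz_seminorm N f"
    if "dirs bs" "length bs \<le> N" for N bs x
  proof -
    have "norm c * ((1 + norm x) ^ N * norm (pderivs bs f x)) \<le> norm c * schwartz_seminorm N f"
      by (intro mult_left_mono schwartz_seminorm_bound f that) auto
    then show ?thesis by (simp add: eq[OF that(1)] norm_mult mult_ac)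
  qed
  show "schwartz_seminorm N (\<lambda>x. c * f x) \<le> norm c * schwartz_seminorm N f"
    by (rule schwartz_seminorm_le[OF b])
  show "(\<lambda>x. c * f x) \<in> schwartz"
    using f by (intro schwartzI_N smooth_linear[OF bounded_linear_mult_right])
      (auto simp: schwartz_smooth intro!: exI b)
qed

lemma schwartz_zero: "(\<lambda>_. 0) \<in> schwartz"
proof -
  have p: "pderivs bs (\<lambda>_::'a. 0::complex) = (\<lambda>_. 0)" for bs :: "'a list"
    by (induction bs) (auto simp: pd_def)
  show ?thesis by (auto simp: schwartz_def smooth_def p intro: finite_imp_bounded)
qed

lemma schwartz_sum: "(\<And>i. i \<in> I \<Longrightarrow> f i \<in> schwartz) \<Longrightarrow> (\<lambda>x. \<Sum>i\<in>I. f i x) \<in> schwartz"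
  by (induction I rule: infinite_finite_induct) (auto simp: schwartz_zero schwartz_add)

lemma schwartz_uminus: "f \<in> schwartz \<Longrightarrow> (\<lambda>x. - f x) \<in> schwartz"
  using schwartz_cmult[of f "-1"] by simp

lemma schwartz_diff: "f \<in> schwartz \<Longrightarrow> g \<in> schwartz \<Longrightarrow> (\<lambda>x. f x - g x) \<in> schwartz"
  using schwartz_add[OF _ schwartz_uminus, of f g] by simp

lemma schwartz_pd: "f \<in> schwartz \<Longrightarrow> b \<in> Basis \<Longrightarrow> pd b f \<in> schwartz"
  and schwartz_seminorm_pd: "f \<in> schwartz \<Longrightarrow> b \<in> Basis \<Longrightarrow>
    schwartz_seminorm N (pd b f) \<le> schwartz_seminorm (Suc N) f"
proof -
  assume f: "f \<in> schwartz" and b: "b \<in> Basis"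
  have *: "(1 + norm x) ^ N * norm (pderivs bs (pd b f) x) \<le> schwartz_seminorm (Suc N) f"
    if "dirs bs" "length bs \<le> N" for N bs x
    using schwartz_seminorm_bound'[OF f, of "bs @ [b]" "Suc N" N x] that b by (simp add: pderivs_snoc)
  show "schwartz_seminorm N (pd b f) \<le> schwartz_seminorm (Suc N) f"
    by (rule schwartz_seminorm_le[OF *])
  show "pd b f \<in> schwartz"
    using f b by (intro schwartzI_N smooth_pd) (auto simp: schwartz_smooth intro!: exI *)
qed

text \<open>
  The factors that may multiply Schwartz functions.  The order of growth \<open>k\<close> is the loss in the
  seminorm index.  When \<open>k = 0\<close> the index \<open>N\<close> is preserved, and then powers of the factor cost
  at most geometrically in each seminorm.
\<close>

definition slow_growth :: "nat \<Rightarrow> nat \<Rightarrow> real \<Rightarrow> ('a::euclidean_space \<Rightarrow> complex) \<Rightarrow> bool" where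
  "slow_growth N k A a \<longleftrightarrow> smooth a \<and>
     (\<forall>bs x. dirs bs \<longrightarrow> length bs \<le> N \<longrightarrow> norm (pderivs bs a x) \<le> A * (1 + norm x) ^ k)"

text \<open>
  The Leibniz bound at \<open>x\<close>, with the growth of \<open>a\<close> paid for by \<open>k\<close> extra powers of \<open>1 + |x|\<close> taken
  from the decay of \<open>f\<close>.
\<close>

lemma schwartz_mult_bound:
  assumes a: "slow_growth N k A a" and f: "f \<in> schwartz" and bs: "dirs bs" "length bs \<le> N"
  shows "(1 + norm x) ^ N * norm (pderivs bs (\<lambda>x. a x * f x) x)
    \<le> 2 ^ N * A * schwartz_seminorm (N + k) f"
proof -
  let ?r = "1 + norm x" and ?S = "schwartz_seminorm (N + k) f"
  have r: "?r > 0" by (simp add: add_pos_nonneg)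
  have "norm (pderivs [] a x) \<le> A * ?r ^ k"
    using a unfolding slow_growth_def by (metis empty_subsetI le0 list.set(1) list.size(3))
  then have "0 \<le> A * ?r ^ k" by (rule order_trans[OF norm_ge_zero])
  then have A: "0 \<le> A" using r zero_less_power[OF r, of k] by (simp add: zero_le_mult_iff)
  have S: "0 \<le> ?S" by (rule schwartz_seminorm_nonneg[OF f])
  have "norm (pderivs bs (\<lambda>x. a x * f x) x) \<le> 2 ^ length bs * (A * ?r ^ k) * (?S / ?r ^ (N + k))"
  proof (rule leibniz_bound)
    fix cs :: "'a list" assume cs: "dirs cs" "length cs \<le> length bs"
    show "norm (pderivs cs a x) \<le> A * ?r ^ k" using a cs bs by (simp add: slow_growth_def)
    show "norm (pderivs cs f x) \<le> ?S / ?r ^ (N + k)"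
      using schwartz_seminorm_bound'[OF f cs(1), of "N + k" "N + k" x] cs bs r
      by (simp add: pos_le_divide_eq mult.commute)
  qed (use a f bs in \<open>auto simp: slow_growth_def schwartz_smooth\<close>)
  then have "?r ^ N * norm (pderivs bs (\<lambda>x. a x * f x) x)
      \<le> ?r ^ N * (2 ^ length bs * (A * ?r ^ k) * (?S / ?r ^ (N + k)))"
    using r by (intro mult_left_mono) auto
  also have "\<dots> = 2 ^ length bs * (A * ?S)"
    using r by (simp add: power_add)
  also have "\<dots> \<le> 2 ^ N * (A * ?S)"
    using bs A S by (intro mult_right_mono power_increasing) auto
  finally show ?thesis by (simp add: mult_ac)
qed

lemma schwartz_seminorm_mult:
  assumes "slow_growth N k A a" "f \<in> schwartz"
  shows "schwartz_seminorm N (\<lambda>x. a x * f x) \<le> 2 ^ N * A * schwartz_seminorm (N + k) f"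
  by (intro schwartz_seminorm_le schwartz_mult_bound assms)

lemma schwartz_mult:
  assumes "\<And>N. \<exists>k A. slow_growth N k A a" "f \<in> schwartz"
  shows "(\<lambda>x. a x * f x) \<in> schwartz"
proof (rule schwartzI_N)
  show "smooth (\<lambda>x. a x * f x)"
    using assms by (metis smooth_mult slow_growth_def schwartz_smooth)
  fix N
  from assms(1) obtain k A where "slow_growth N k A a" by blast
  from schwartz_mult_bound[OF this assms(2)]
  show "\<exists>B. \<forall>bs x. dirs bs \<longrightarrow> length bs \<le> N \<longrightarrow> (1 + norm x) ^ N * norm (pderivs bs (\<lambda>x. a x * f x) x) \<le> B"
    by blast
qed

definition bounded_derivs :: "('a::euclidean_space \<Rightarrow> complex) \<Rightarrow> bool" where
  "bounded_derivs a \<longleftrightarrow> (\<forall>n. iter_diff n {f. bounded (range f)} a)"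

lemma bounded_derivs_slow_growth:
  assumes "bounded_derivs a"
  shows "\<exists>A. slow_growth N 0 A a"
proof -
  let ?A = "{bs::'a list. dirs bs \<and> length bs \<le> N}"
  have fin: "finite ?A" by (rule finite_lists_length_le) simp
  have sm: "smooth a" and bd: "\<And>bs. dirs bs \<Longrightarrow> bounded (range (pderivs bs a))"
    using assms by (auto simp: bounded_derivs_def iter_diff_iff)
  from bd have "\<exists>B. \<forall>x. norm (pderivs bs a x) \<le> B" if "dirs bs" for bs
    using that by (force simp: bounded_iff)
  then obtain B where B: "\<And>bs x. dirs bs \<Longrightarrow> norm (pderivs bs a x) \<le> B bs"
    by metis
  have pos: "0 \<le> B bs" if "bs \<in> ?A" for bs
    using B[of bs] that by (auto intro: order_trans[OF norm_ge_zero])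
  have "norm (pderivs bs a x) \<le> (\<Sum>bs\<in>?A. B bs)" if "bs \<in> ?A" for bs x
    using B[of bs x] member_le_sum[OF that, of B] pos fin that by (auto intro: order_trans)
  then show ?thesis using sm by (auto simp: slow_growth_def)
qed

lemma bounded_derivs_mult_schwartz: "bounded_derivs a \<Longrightarrow> f \<in> schwartz \<Longrightarrow> (\<lambda>x. a x * f x) \<in> schwartz"
  using bounded_derivs_slow_growth by (intro schwartz_mult) blast

text \<open>
  The same index \<open>N\<close> stands on both sides, so the estimate can be iterated.
\<close>

lemma bounded_derivs_seminorm:
  assumes "bounded_derivs a"
  shows "\<exists>R\<ge>0. \<forall>f\<in>schwartz. schwartz_seminorm N (\<lambda>x. a x * f x) \<le> R * schwartz_seminorm N f"
proof -
  from bounded_derivs_slow_growth[OF assms] obtain A where A: "slow_growth N 0 A a" by blast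
  have "norm (pderivs [] a 0) \<le> A * (1 + norm (0::'a)) ^ 0"
    using A unfolding slow_growth_def by (metis empty_subsetI le0 list.set(1) list.size(3))
  then have "0 \<le> A" by (auto intro: order_trans[OF norm_ge_zero])
  then show ?thesis using schwartz_seminorm_mult[OF A] by (intro exI[of _ "2 ^ N * A"]) auto
qed

lemma schwartz_bounded_derivs: "f \<in> schwartz \<Longrightarrow> bounded_derivs f"
proof -
  assume f: "f \<in> schwartz"
  have "bounded (range (pderivs bs f))" if "dirs bs" for bs
    using schwartz_seminorm_bound'[OF f that order_refl, of 0] by (auto simp: bounded_iff)
  then show ?thesis using f by (auto simp: bounded_derivs_def iter_diff_iff schwartz_smooth)
qed

text \<open>
  Dilations keep the decay up to a factor, because \<open>1 + |x|\<close> and \<open>1 + |c x|\<close> are comparable.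
\<close>

lemma schwartz_scaled:
  assumes f: "f \<in> schwartz" and c: "c \<noteq> 0"
  shows "(\<lambda>x. f (c *\<^sub>R x)) \<in> schwartz"
proof (rule schwartzI)
  show "smooth (\<lambda>x. f (c *\<^sub>R x))" by (simp add: f smooth_scaled schwartz_smooth)
  fix N and bs :: "'a list" assume bs: "dirs bs"
  define K where "K = max 1 (1 / \<bar>c\<bar>)"
  let ?M = "N + length bs"
  have "(1 + norm x) ^ N * norm (pderivs bs (\<lambda>x. f (c *\<^sub>R x)) x)
     \<le> K ^ N * \<bar>c\<bar> ^ length bs * schwartz_seminorm ?M f" for x
  proof -
    have "norm x = (1 / \<bar>c\<bar>) * norm (c *\<^sub>R x)" using c by simp
    also have "\<dots> \<le> K * norm (c *\<^sub>R x)" by (intro mult_right_mono) (auto simp: K_def)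
    finally have "1 + norm x \<le> K * (1 + norm (c *\<^sub>R x))"
      by (simp add: K_def algebra_simps)
    then have "(1 + norm x) ^ N \<le> (K * (1 + norm (c *\<^sub>R x))) ^ N" by (intro power_mono) auto
    then have "(1 + norm x) ^ N * norm (pderivs bs f (c *\<^sub>R x))
      \<le> K ^ N * ((1 + norm (c *\<^sub>R x)) ^ N * norm (pderivs bs f (c *\<^sub>R x)))"
      by (metis (no_types, lifting) mult.assoc mult_right_mono norm_ge_zero power_mult_distrib)
    also have "\<dots> \<le> K ^ N * schwartz_seminorm ?M f"
      by (intro mult_left_mono schwartz_seminorm_bound' f bs) (auto simp: K_def)
    finally have "\<bar>c\<bar> ^ length bs * ((1 + norm x) ^ N * norm (pderivs bs f (c *\<^sub>R x)))
       \<le> \<bar>c\<bar> ^ length bs * (K ^ N * schwartz_seminorm ?M f)" by (rule mult_left_mono) auto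
    then show ?thesis using bs f by (simp add: pderivs_scaled schwartz_smooth mult_ac power_abs)
  qed
  then show "\<exists>B. \<forall>x. (1 + norm x) ^ N * norm (pderivs bs (\<lambda>x. f (c *\<^sub>R x)) x) \<le> B" by blast
qed

lemma pderivs_const: "pderivs bs (\<lambda>_. c) = (if bs = [] then (\<lambda>_. c) else (\<lambda>_. 0))"
proof (induction bs)
  case (Cons b bs)
  then show ?case by (cases "bs = []") (auto simp: pd_def)
qed simp

lemma coord_slow_growth:
  fixes b :: "'a::euclidean_space"
  assumes b: "b \<in> Basis"
  shows "slow_growth N 1 1 (\<lambda>x::'a. complex_of_real (x \<bullet> b))"
proof -
  let ?a = "\<lambda>x::'a. complex_of_real (x \<bullet> b)"
  have pda: "pd c ?a = (\<lambda>_. complex_of_real (c \<bullet> b))" for c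
    by (rule pd_eqI) (auto intro!: derivative_eq_intros)
  have d: "?a differentiable_on UNIV"
    by (rule differentiable_onI_has[where f'="\<lambda>_ h. complex_of_real (h \<bullet> b)"]) (auto intro!: derivative_eq_intros)
  have p: "pderivs bs ?a = (if bs = [] then ?a else if \<exists>c. bs
    = [c] then (\<lambda>_. complex_of_real (hd bs \<bullet> b)) else (\<lambda>_. 0))" for bs
  proof (cases bs rule: rev_cases)
    case (snoc cs c)
    then show ?thesis by (simp add: pderivs_snoc pda pderivs_const)
  qed simp
  have "smooth ?a" unfolding smooth_def p using d by auto
  moreover have "norm (pderivs bs ?a x) \<le> 1 * (1 + norm x) ^ 1" if "dirs bs" for bs x
  proof -
    have "\<bar>x \<bullet> b\<bar> \<le> norm x" using b by (rule Basis_le_norm)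
    moreover have "\<bar>c \<bullet> b\<bar> \<le> 1 + norm x" if "c \<in> Basis" for c
      using b that by (simp add: inner_Basis)
    ultimately show ?thesis using \<open>dirs bs\<close> by (auto simp: p intro: order_trans)
  qed
  ultimately show ?thesis by (simp add: slow_growth_def)
qed

lemma schwartz_coord: "b \<in> Basis \<Longrightarrow> f \<in> schwartz \<Longrightarrow> (\<lambda>x. complex_of_real (x \<bullet> b) * f x) \<in> schwartz"
  by (rule schwartz_mult) (auto intro: coord_slow_growth)

lemma frechet_expand:
  assumes "f differentiable_on UNIV"
  shows "frechet_derivative f (at x) h = (\<Sum>b\<in>Basis. (h \<bullet> b) *\<^sub>R pd b f x)"
proof -
  have l: "linear (frechet_derivative f (at x))"
    using assms by (simp add: differentiable_on_def linear_frechet_derivative)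
  have "frechet_derivative f (at x) h = frechet_derivative f (at x) (\<Sum>b\<in>Basis. (h \<bullet> b) *\<^sub>R b)"
    by (simp add: euclidean_representation)
  then show ?thesis using l by (simp add: linear_sum linear_cmul pd_def)
qed

text \<open>
  The partial derivatives converge uniformly by the Weierstrass test, and they determine the
  Frechet derivative.
\<close>

lemma pd_series:
  fixes f :: "nat \<Rightarrow> 'a::euclidean_space \<Rightarrow> 'b::banach"
  assumes d: "\<And>n. f n differentiable_on UNIV"
    and M: "summable M" "\<And>n x. norm (f n x) \<le> M n"
    and M': "\<And>b n x. b \<in> Basis \<Longrightarrow> norm (pd b (f n) x) \<le> M' n" "summable M'"
  shows "(\<lambda>x. \<Sum>n. f n x) differentiable_on UNIV"
    and "b \<in> Basis \<Longrightarrow> pd b (\<lambda>x. \<Sum>n. f n x) = (\<lambda>x. \<Sum>n. pd b (f n) x)"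
proof -
  define g' where "g' = (\<lambda>x h. \<Sum>b\<in>Basis. (h \<bullet> b) *\<^sub>R (\<Sum>n. pd b (f n) x))"
  have unif: "uniform_limit UNIV (\<lambda>n x. \<Sum>i<n. pd b (f i) x) (\<lambda>x. \<Sum>i. pd b (f i) x) sequentially"
    if "b \<in> Basis" for b
    by (rule Weierstrass_m_test[OF M'(1)[OF that] M'(2)])
  have "\<exists>g. \<forall>x\<in>UNIV. (\<lambda>n. f n x) sums g x \<and> (g has_derivative g' x) (at x within UNIV)"
  proof (rule has_derivative_series)
    show "(f n has_derivative frechet_derivative (f n) (at x)) (at x within UNIV)" for n x
      using has_derivative_frechet[OF d] by simp
    show "(\<lambda>n. f n 0) sums (\<Sum>n. f n 0)"
      using summable_comparison_test'[OF M(1), of 0 "\<lambda>n. f n 0"] M(2) by (auto intro: summable_sums)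
    fix e :: real assume e: "e > 0"
    define \<epsilon> where "\<epsilon> = e / DIM('a)"
    have \<epsilon>: "\<epsilon> > 0" using e by (simp add: \<epsilon>_def)
    have "\<forall>\<^sub>F n in sequentially. \<forall>b\<in>Basis. \<forall>x\<in>UNIV. dist (\<Sum>i<n. pd b (f i) x) (\<Sum>i. pd b (f i) x) < \<epsilon>"
      using unif \<epsilon> by (intro eventually_ball_finite) (auto simp: uniform_limit_iff)
    then show "\<forall>\<^sub>F n in sequentially. \<forall>x\<in>UNIV. \<forall>h.
      norm ((\<Sum>i<n. frechet_derivative (f i) (at x) h) - g' x h) \<le> e * norm h"
    proof (rule eventually_mono, intro ballI allI)
      fix n x h assume *: "\<forall>b\<in>Basis. \<forall>x\<in>UNIV. dist (\<Sum>i<n. pd b (f i) x) (\<Sum>i. pd b (f i) x) < \<epsilon>"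
      have "(\<Sum>i<n. frechet_derivative (f i) (at x) h) = (\<Sum>b\<in>Basis. (h \<bullet> b) *\<^sub>R (\<Sum>i<n. pd b (f i) x))"
        by (simp add: frechet_expand[OF d] scaleR_sum_right sum.swap[of _ Basis])
      then have "norm ((\<Sum>i<n. frechet_derivative (f i) (at x) h) - g' x h)
        = norm (\<Sum>b\<in>Basis. (h \<bullet> b) *\<^sub>R ((\<Sum>i<n. pd b (f i) x) - (\<Sum>i. pd b (f i) x)))"
        by (simp add: g'_def sum_subtractf scaleR_diff_right)
      also have "\<dots> \<le> (\<Sum>b\<in>(Basis::'a set). norm h * \<epsilon>)"
      proof (rule sum_norm_le)
        fix b :: 'a assume b: "b \<in> Basis"
        have "norm ((\<Sum>i<n. pd b (f i) x) - (\<Sum>i. pd b (f i) x)) \<le> \<epsilon>"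
          using *[rule_format, OF b, of x] by (simp add: dist_norm less_imp_le)
        then show "norm ((h \<bullet> b) *\<^sub>R ((\<Sum>i<n. pd b (f i) x) - (\<Sum>i. pd b (f i) x))) \<le> norm h * \<epsilon>"
          by (simp add: mult_mono Basis_le_norm b)
      qed
      also have "\<dots> = e * norm h" by (simp add: \<epsilon>_def)
      finally show "norm ((\<Sum>i<n. frechet_derivative (f i) (at x) h) - g' x h) \<le> e * norm h" .
    qed
  qed auto
  then obtain g where g: "\<And>x. (\<lambda>n. f n x) sums g x" "\<And>x. (g has_derivative g' x) (at x)" by auto
  from g(1) have eq: "(\<lambda>x. \<Sum>n. f n x) = g" by (auto simp: sums_iff)
  show "(\<lambda>x. \<Sum>n. f n x) differentiable_on UNIV" unfolding eq by (rule differentiable_onI_has[OF g(2)])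
  assume b: "b \<in> Basis"
  have "g' x b = (\<Sum>n. pd b (f n) x)" for x
    using b by (simp add: g'_def inner_Basis if_distrib[of "\<lambda>c. c *\<^sub>R _"] cong: if_cong)
  then show "pd b (\<lambda>x. \<Sum>n. f n x) = (\<lambda>x. \<Sum>n. pd b (f n) x)"
    unfolding eq using pd_eqI[OF g(2)] by simp
qed

lemma pderivs_series:
  fixes f :: "nat \<Rightarrow> 'a::euclidean_space \<Rightarrow> 'b::banach"
  assumes sm: "\<And>n. smooth (f n)"
    and M: "\<And>k. summable (M k)" "\<And>bs n x. dirs bs \<Longrightarrow> norm (pderivs bs (f n) x) \<le> M (length bs) n"
    and bs: "dirs bs"
  shows "pderivs bs (\<lambda>x. \<Sum>n. f n x) = (\<lambda>x. \<Sum>n. pderivs bs (f n) x) \<and>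
    (\<lambda>x. \<Sum>n. pderivs bs (f n) x) differentiable_on UNIV"
  using bs
proof (induction bs)
  case Nil
  have "(\<lambda>x. \<Sum>n. f n x) differentiable_on UNIV"
  proof (rule pd_series(1))
    show "norm (f n x) \<le> M 0 n" for n x using M(2)[of "[]"] by simp
    show "norm (pd b (f n) x) \<le> M 1 n" if "b \<in> Basis" for n x b using M(2)[of "[b]"] that by simp
  qed (use M sm in \<open>auto simp: smooth_differentiable\<close>)
  then show ?case by simp
next
  case (Cons b bs)
  have D: "(\<lambda>x. \<Sum>n. pderivs cs (f n) x) differentiable_on UNIV \<and>
    (\<forall>b\<in>Basis. pd b (\<lambda>x. \<Sum>n. pderivs cs (f n) x) = (\<lambda>x. \<Sum>n. pd b (pderivs cs (f n)) x))"
    if cs: "dirs cs" for cs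
  proof (intro conjI ballI)
    note * = smooth_differentiable[OF smooth_pderivs[OF sm cs]] M(1)[of "length cs"] M(2)[OF cs]
    have **: "norm (pd b (pderivs cs (f n)) x) \<le> M (Suc (length cs)) n" if "b \<in> Basis" for n x b
      using M(2)[of "b # cs"] that cs by simp
    show "(\<lambda>x. \<Sum>n. pderivs cs (f n) x) differentiable_on UNIV"
      by (rule pd_series(1)[OF * ** M(1)])
    show "pd b (\<lambda>x. \<Sum>n. pderivs cs (f n) x) = (\<lambda>x. \<Sum>n. pd b (pderivs cs (f n)) x)" if "b \<in> Basis" for b
      by (rule pd_series(2)[OF * ** M(1) that])
  qed
  show ?case using Cons D[of bs] D[of "b # bs"] by simp
qed

text \<open>
  Completeness of the Schwartz space, in the form in which it is used: absolute convergence in every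
  seminorm.
\<close>

lemma schwartz_series:
  assumes f: "\<And>n. f n \<in> schwartz" and s: "\<And>N. summable (\<lambda>n. schwartz_seminorm N (f n))"
  shows "(\<lambda>x. \<Sum>n. f n x) \<in> schwartz"
    and "schwartz_seminorm N (\<lambda>x. \<Sum>n. f n x) \<le> (\<Sum>n. schwartz_seminorm N (f n))"
    and "summable (\<lambda>n. f n x)"
proof -
  have b: "norm (pderivs bs (f n) x) \<le> schwartz_seminorm (length bs) (f n)" if "dirs bs" for bs n x
    using schwartz_seminorm_bound'[OF f that order_refl, of 0] by simp
  have D: "pderivs bs (\<lambda>x. \<Sum>n. f n x) = (\<lambda>x. \<Sum>n. pderivs bs (f n) x) \<and>
      (\<lambda>x. \<Sum>n. pderivs bs (f n) x) differentiable_on UNIV" if "dirs bs" for bs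
    by (rule pderivs_series[OF schwartz_smooth[OF f] s b that])
  have sm: "smooth (\<lambda>x. \<Sum>n. f n x)" unfolding smooth_def using D by simp
  have B: "(1 + norm x) ^ N * norm (pderivs bs (\<lambda>x. \<Sum>n. f n x) x) \<le> (\<Sum>n. schwartz_seminorm N (f n))"
    if bs: "dirs bs" "length bs \<le> N" for N bs x
  proof -
    have le: "norm ((1 + norm x) ^ N *\<^sub>R pderivs bs (f n) x) \<le> schwartz_seminorm N (f n)" for n
      using schwartz_seminorm_bound[OF f bs, of x] by (simp add: power_abs)
    have "(1 + norm x) ^ N * norm (pderivs bs (\<lambda>x. \<Sum>n. f n x) x)
      = norm ((1 + norm x) ^ N *\<^sub>R (\<Sum>n. pderivs bs (f n) x))"
      using D[OF bs(1)] by (simp add: power_abs)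
    also have "(1 + norm x) ^ N *\<^sub>R (\<Sum>n. pderivs bs (f n) x)
      = (\<Sum>n. (1 + norm x) ^ N *\<^sub>R pderivs bs (f n) x)"
      using summable_comparison_test'[OF s[of "length bs"], of 0 "\<lambda>n. pderivs bs (f n) x"] b[OF bs(1)]
      by (intro suminf_scaleR_right) auto
    also have "norm \<dots> \<le> (\<Sum>n. schwartz_seminorm N (f n))"
      by (intro norm_suminf_le le s)
    finally show ?thesis .
  qed
  show "(\<lambda>x. \<Sum>n. f n x) \<in> schwartz" using sm by (intro schwartzI_N) (auto intro!: exI B)
  show "schwartz_seminorm N (\<lambda>x. \<Sum>n. f n x) \<le> (\<Sum>n. schwartz_seminorm N (f n))"
    by (rule schwartz_seminorm_le[OF B])
  show "summable (\<lambda>n. f n x)"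
    using summable_comparison_test'[OF s[of 0], of 0 "\<lambda>n. f n x"] b[of "[]"] by auto
qed

lemma tempered_add: "T \<in> tempered \<Longrightarrow> f \<in> schwartz \<Longrightarrow> g \<in> schwartz \<Longrightarrow> T (\<lambda>x. f x + g x) = T f + T g"
  and tempered_cmult: "T \<in> tempered \<Longrightarrow> f \<in> schwartz \<Longrightarrow> T (\<lambda>x. c * f x) = c * T f"
  by (auto simp: tempered_def)

lemma tempered_zero: "T \<in> tempered \<Longrightarrow> T (\<lambda>_. 0) = 0"
  using tempered_cmult[OF _ schwartz_zero, of T 0] by simp

lemma tempered_sum: "T \<in> tempered \<Longrightarrow> (\<And>i. i \<in> I \<Longrightarrow> f i \<in> schwartz) \<Longrightarrow>
    T (\<lambda>x. \<Sum>i\<in>I. f i x) = (\<Sum>i\<in>I. T (f i))"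
proof (induction I rule: infinite_finite_induct)
  case (insert x F)
  then have "(\<lambda>xa. \<Sum>i\<in>F. f i xa) \<in> schwartz" by (intro schwartz_sum) auto
  with insert show ?case by (simp add: tempered_add[OF insert.prems(1)])
qed (auto simp: tempered_zero)

lemma tempered_bound:
  assumes "T \<in> tempered"
  obtains N C where "C \<ge> 0" "\<And>f. f \<in> schwartz \<Longrightarrow> norm (T f) \<le> C * schwartz_seminorm N f"
proof -
  from assms have "\<exists>N C. \<forall>f\<in>schwartz. norm (T f) \<le> C * schwartz_seminorm N f"
    by (simp add: tempered_def)
  then obtain N C where C: "\<And>f. f \<in> schwartz \<Longrightarrow> norm (T f) \<le> C * schwartz_seminorm N f"
    by blast
  have "norm (T f) \<le> \<bar>C\<bar> * schwartz_seminorm N f" if "f \<in> schwartz" for f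
    using C[OF that] mult_right_mono[OF abs_ge_self schwartz_seminorm_nonneg[OF that]] by (rule order_trans)
  then show thesis by (intro that[of "\<bar>C\<bar>"]) auto
qed

text \<open>
  A tempered distribution is controlled by one seminorm, in which the tails of the series vanish.
\<close>

lemma tempered_series:
  assumes T: "T \<in> tempered"
    and f: "\<And>n. f n \<in> schwartz" and s: "\<And>N. summable (\<lambda>n. schwartz_seminorm N (f n))"
  shows "(\<lambda>n. T (f n)) sums T (\<lambda>x. \<Sum>n. f n x)"
proof -
  obtain N C where C: "C \<ge> 0" "\<And>f. f \<in> schwartz \<Longrightarrow> norm (T f) \<le> C * schwartz_seminorm N f"
    by (rule tempered_bound[OF T], rule that)
  let ?F = "\<lambda>x. \<Sum>n. f n x"
  have tail: "norm (T ?F - (\<Sum>n<k. T (f n))) \<le> C * (\<Sum>n. schwartz_seminorm N (f (n + k)))" for k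
  proof -
    let ?R = "\<lambda>x. \<Sum>n. f (n + k) x"
    have sk: "summable (\<lambda>n. schwartz_seminorm N (f (n + k)))" for N
      using s[of N] summable_iff_shift[of "\<lambda>n. schwartz_seminorm N (f n)" k] by simp
    note R = schwartz_series[of "\<lambda>n. f (n + k)", OF f sk]
    have "?F = (\<lambda>x. ?R x + (\<Sum>n<k. f n x))"
      using suminf_split_initial_segment[OF schwartz_series(3)[OF f s]] by auto
    then have "T ?F = T ?R + (\<Sum>n<k. T (f n))"
      by (simp add: tempered_add[OF T] tempered_sum[OF T] R f schwartz_sum)
    then have "norm (T ?F - (\<Sum>n<k. T (f n))) \<le> C * schwartz_seminorm N ?R" using C(2)[OF R(1)] by simp
    also have "\<dots> \<le> C * (\<Sum>n. schwartz_seminorm N (f (n + k)))"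
      by (intro mult_left_mono R C)
    finally show ?thesis .
  qed
  have "(\<lambda>k. \<Sum>n. schwartz_seminorm N (f (n + k))) \<longlonglongrightarrow> 0"
    by (rule suminf_exist_split2[OF s])
  then have "(\<lambda>k. C * (\<Sum>n. schwartz_seminorm N (f (n + k)))) \<longlonglongrightarrow> 0"
    by (intro tendsto_eq_intros) auto
  then have "(\<lambda>k. T ?F - (\<Sum>n<k. T (f n))) \<longlonglongrightarrow> 0"
    by (rule Lim_null_comparison[rotated]) (use tail in auto)
  then have "(\<lambda>k. T ?F - (T ?F - (\<Sum>n<k. T (f n)))) \<longlonglongrightarrow> T ?F - 0" by (intro tendsto_intros)
  then show ?thesis by (simp add: sums_def)
qed

section \<open>Integrals over Euclidean space and Gaussians\<close>

lemma lborel_integral_affine: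
  fixes f :: "'a::euclidean_space \<Rightarrow> 'b::{banach, second_countable_topology}"
  assumes [measurable]: "f \<in> borel_measurable borel" and c: "c \<noteq> 0"
  shows "(LINT x|lborel. f x) = \<bar>c\<bar> ^ DIM('a) *\<^sub>R (LINT x|lborel. f (t + c *\<^sub>R x))"
    and "integrable lborel f \<longleftrightarrow> integrable lborel (\<lambda>x. f (t + c *\<^sub>R x))"
proof -
  have "(LINT x|lborel. f x) = (LINT x|density (distr lborel borel (\<lambda>x. t
    + c *\<^sub>R x)) (\<lambda>_. \<bar>c\<bar>^DIM('a)). f x)"
    using lborel_affine[OF c, of t] by (metis (no_types, lifting))
  also have "\<dots> = \<bar>c\<bar> ^ DIM('a) *\<^sub>R (LINT x|lborel. f (t + c *\<^sub>R x))"
    by (simp add: integral_density integral_distr)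
  finally show "(LINT x|lborel. f x) = \<bar>c\<bar> ^ DIM('a) *\<^sub>R (LINT x|lborel. f (t + c *\<^sub>R x))" .
  have "integrable lborel f \<longleftrightarrow> integrable (density (distr lborel borel (\<lambda>x. t
    + c *\<^sub>R x)) (\<lambda>_. \<bar>c\<bar>^DIM('a))) f"
    using lborel_affine[OF c, of t] by (metis (no_types, lifting))
  also have "\<dots> \<longleftrightarrow> integrable lborel (\<lambda>x. \<bar>c\<bar> ^ DIM('a) *\<^sub>R f (t + c *\<^sub>R x))"
    by (simp add: integrable_density integrable_distr_eq)
  also have "\<dots> \<longleftrightarrow> integrable lborel (\<lambda>x. f (t + c *\<^sub>R x))"
  proof
    assume "integrable lborel (\<lambda>x. \<bar>c\<bar> ^ DIM('a) *\<^sub>R f (t + c *\<^sub>R x))"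
    then have "integrable lborel (\<lambda>x. (1 / \<bar>c\<bar> ^ DIM('a)) *\<^sub>R (\<bar>c\<bar> ^ DIM('a) *\<^sub>R f (t + c *\<^sub>R x)))"
      by (rule integrable_scaleR_right)
    then show "integrable lborel (\<lambda>x. f (t + c *\<^sub>R x))" using c by simp
  qed auto
  finally show "integrable lborel f \<longleftrightarrow> integrable lborel (\<lambda>x. f (t + c *\<^sub>R x))" .
qed

lemma lborel_nn_integral_affine:
  fixes f :: "'a::euclidean_space \<Rightarrow> ennreal"
  assumes [measurable]: "f \<in> borel_measurable borel" and c: "c \<noteq> 0"
  shows "(\<integral>\<^sup>+x. f x \<partial>lborel) = ennreal (\<bar>c\<bar> ^ DIM('a)) * (\<integral>\<^sup>+x. f (t + c *\<^sub>R x) \<partial>lborel)"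
proof -
  have "(\<integral>\<^sup>+x. f x \<partial>lborel)
      = (\<integral>\<^sup>+x. f x \<partial>density (distr lborel borel (\<lambda>x. t + c *\<^sub>R x)) (\<lambda>_. ennreal (\<bar>c\<bar>^DIM('a))))"
    using lborel_affine[OF c, of t] by (metis (no_types, lifting))
  then show ?thesis by (simp add: nn_integral_density nn_integral_distr nn_integral_cmult)
qed

text \<open>
  Lebesgue measure is the image of the product of the one-dimensional measures along the
  coordinates.
\<close>

lemma lborel_integral_prod:
  fixes f :: "'a::euclidean_space \<Rightarrow> real \<Rightarrow> 'b::{real_normed_field,banach,second_countable_topology}"
  assumes f: "\<And>b. b \<in> Basis \<Longrightarrow> integrable lborel (f b)"
  shows "integrable lborel (\<lambda>x::'a. \<Prod>b\<in>Basis. f b (x \<bullet> b))"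
    and "integral\<^sup>L lborel (\<lambda>x::'a. \<Prod>b\<in>Basis. f b (x \<bullet> b)) = (\<Prod>b\<in>Basis. (LINT x|lborel. f b x))"
proof -
  interpret product_sigma_finite "\<lambda>_::'a. lborel :: real measure" by standard
  have [measurable]: "f b \<in> borel_measurable borel" if "b \<in> Basis" for b
    using f[OF that] by (simp add: integrable_iff_bounded)
  let ?F = "\<lambda>x::'a. \<Prod>b\<in>Basis. f b (x \<bullet> b)"
  let ?P = "\<Pi>\<^sub>M b\<in>(Basis::'a set). (lborel :: real measure)"
  let ?T = "\<lambda>f. \<Sum>b\<in>(Basis::'a set). f b *\<^sub>R b"
  have F: "?F \<in> borel_measurable borel" by measurable
  have T: "?T \<in> ?P \<rightarrow>\<^sub>M borel" by measurable
  have FT: "?F (?T x) = (\<Prod>b\<in>Basis. f b (x b))" for x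
    by (intro prod.cong refl) (simp add: inner_sum_left inner_Basis if_distrib cong: if_cong)
  have "integrable ?P (\<lambda>x. \<Prod>b\<in>Basis. f b (x b))"
    using f by (intro product_integrable_prod) auto
  then show "integrable lborel ?F"
    by (subst lborel_eq) (simp add: integrable_distr_eq[OF T F] FT)
  show "integral\<^sup>L lborel ?F = (\<Prod>b\<in>Basis. (LINT x|lborel. f b x))"
    by (subst lborel_eq) (simp add: integral_distr[OF T F] FT product_integral_prod f)
qed

text \<open>
  The exponent \<open>2 d\<close> makes the weight smaller than the product of the integrable functions
  \<open>1 / (1 + x\<^sub>b\<^sup>2)\<close> of the coordinates.
\<close>

definition decay_weight :: "'a::euclidean_space \<Rightarrow> real" where
  "decay_weight x = 1 / (1 + norm x) ^ (2 * DIM('a))"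

lemma decay_weight_pos: "decay_weight x > 0"
  by (simp add: decay_weight_def add_pos_nonneg)

lemma decay_weight_measurable [measurable]: "decay_weight \<in> borel_measurable borel"
  unfolding decay_weight_def[abs_def] by measurable

lemma integrable_decay_weight: "integrable lborel (decay_weight :: 'a::euclidean_space \<Rightarrow> real)"
proof (rule Bochner_Integration.integrable_bound)
  have "integrable lborel (\<lambda>x::real. inverse (1 + x\<^sup>2))"
    using integrable_inverse_1_plus_square by (simp add: set_integrable_def)
  then show "integrable lborel (\<lambda>x::'a. \<Prod>b\<in>Basis. inverse (1 + (x \<bullet> b)\<^sup>2))"
    by (rule lborel_integral_prod(1))
  show "AE x::'a in lborel. norm (decay_weight x) \<le> norm (\<Prod>b\<in>Basis. inverse (1 + (x \<bullet> b)\<^sup>2))"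
  proof (rule AE_I2)
    fix x :: 'a
    have "(\<Prod>b\<in>(Basis::'a set). 1 + (x \<bullet> b)\<^sup>2) \<le> (\<Prod>b\<in>(Basis::'a set). (1 + norm x)\<^sup>2)"
    proof (rule prod_mono, safe)
      fix b :: 'a assume "b \<in> Basis"
      then have "\<bar>x \<bullet> b\<bar>\<^sup>2 \<le> (norm x)\<^sup>2" by (intro power_mono Basis_le_norm) auto
      then show "1 + (x \<bullet> b)\<^sup>2 \<le> (1 + norm x)\<^sup>2" by (simp add: power2_sum add_increasing2)
    qed simp
    also have "\<dots> = (1 + norm x) ^ (2 * DIM('a))" by (simp add: power_mult)
    finally have *: "(\<Prod>b\<in>(Basis::'a set). 1 + (x \<bullet> b)\<^sup>2) \<le> (1 + norm x) ^ (2 * DIM('a))" .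
    have "decay_weight x \<le> inverse (\<Prod>b\<in>(Basis::'a set). 1 + (x \<bullet> b)\<^sup>2)"
      unfolding decay_weight_def inverse_eq_divide
      using * by (intro divide_left_mono mult_pos_pos prod_pos) (auto simp: add_pos_nonneg)
    then show "norm (decay_weight x) \<le> norm (\<Prod>b\<in>Basis. inverse (1 + (x \<bullet> b)\<^sup>2))"
      using decay_weight_pos[of x] prod_nonneg[of Basis "\<lambda>b. 1 + (x \<bullet> b)\<^sup>2"] prod_inversef[of "\<lambda>b. 1
        + (x \<bullet> b)\<^sup>2" Basis]
      by (simp add: o_def abs_of_nonneg)
  qed
qed simp

lemma
  fixes f :: "'a::euclidean_space \<Rightarrow> 'b::{banach, second_countable_topology}"
  assumes "f \<in> borel_measurable borel" and B: "\<And>x. norm (f x) \<le> B * decay_weight x"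
  shows integrable_decay: "integrable lborel f"
    and integral_norm_decay: "(LINT x|lborel. norm (f x))
      \<le> B * integral\<^sup>L lborel (decay_weight :: 'a \<Rightarrow> real)"
proof -
  have i: "integrable lborel (\<lambda>x::'a. B * decay_weight x)"
    by (intro integrable_mult_right integrable_decay_weight)
  show 1: "integrable lborel f"
    by (rule Bochner_Integration.integrable_bound[OF i])
       (use assms in \<open>auto intro: order_trans[OF B abs_ge_self]\<close>)
  have "(LINT x|lborel. norm (f x)) \<le> integral\<^sup>L lborel (\<lambda>x::'a. B * decay_weight x)"
    by (rule integral_mono[OF integrable_norm[OF 1] i B])
  then show "(LINT x|lborel. norm (f x)) \<le> B * integral\<^sup>L lborel (decay_weight :: 'a \<Rightarrow> real)" by simp
qed

text \<open>
  The kernel \<open>exp(- i x \<cdot> \<xi>)\<close> of the Fourier transform, named so that its algebra can be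
  used without unfolding the exponential.
\<close>

definition ek :: "'a::euclidean_space \<Rightarrow> 'a \<Rightarrow> complex" where
  "ek x \<xi> = exp (- \<i> * complex_of_real (x \<bullet> \<xi>))"

lemma norm_ek [simp]: "norm (ek x \<xi>) = 1"
  by (simp add: ek_def norm_exp_eq_Re)

lemma ek_commute: "ek x \<xi> = ek \<xi> x"
  by (simp add: ek_def inner_commute)

lemma ek_add: "ek (x + y) \<xi> = ek x \<xi> * ek y \<xi>" "ek x (\<xi> + \<eta>) = ek x \<xi> * ek x \<eta>"
  by (auto simp: ek_def inner_add_left inner_add_right ring_distribs exp_add[symmetric] exp_diff simp flip: exp_minus)

lemma ek_zero [simp]: "ek 0 \<xi> = 1" "ek x 0 = 1" by (simp_all add: ek_def)

lemma ek_scale: "ek (c *\<^sub>R x) \<xi> = ek x (c *\<^sub>R \<xi>)" by (simp add: ek_def)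

lemma ek_uminus: "ek (- x) \<xi> = ek x (- \<xi>)" "cnj (ek x \<xi>) = ek x (- \<xi>)"
  by (simp_all add: ek_def exp_cnj)

lemma ek_measurable [measurable]:
  assumes [measurable]: "f \<in> M \<rightarrow>\<^sub>M borel" "g \<in> M \<rightarrow>\<^sub>M borel"
  shows "(\<lambda>x. ek (f x) (g x)) \<in> borel_measurable M"
  unfolding ek_def by measurable

lemma fourier_ek: "fourier f \<xi> = (LINT x|lborel. ek x \<xi> * f x)"
  by (simp add: fourier_def ek_def)

lemma inv_fourier_eq: "inv_fourier f (x::'a::euclidean_space)
  = complex_of_real (1 / (2 * pi) ^ DIM('a)) * fourier f (- x)"
  by (simp add: inv_fourier_def fourier_def inner_commute)

lemma integrable_ek:
  assumes "integrable lborel f"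
  shows "integrable lborel (\<lambda>x. ek x \<xi> * f x)"
  using assms by (rule Bochner_Integration.integrable_bound) (use assms in \<open>auto simp: norm_mult\<close>)

lemma norm_fourier_le:
  shows "norm (fourier f \<xi>) \<le> (LINT x|lborel. norm (f x))"
  unfolding fourier_ek using integral_norm_bound[of lborel "\<lambda>x. ek x \<xi> * f x"] by (simp add: norm_mult)

lemma fourier_measurable [measurable]:
  assumes "f \<in> borel_measurable borel"
  shows "fourier f \<in> borel_measurable borel"
proof -
  have [measurable]: "f \<in> borel_measurable borel" by fact
  show ?thesis unfolding fourier_ek[abs_def] by measurable
qed

text \<open>
  Fubini for the product of two integrable functions and a bounded kernel; every exchange of
  Fourier integrals below is of this kind.
\<close>

lemma integral_swap_bounded_kernel:
  fixes a b :: "'a::euclidean_space \<Rightarrow> complex" and k :: "'a \<Rightarrow> 'a \<Rightarrow> complex"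
  assumes a: "integrable lborel a" and b: "integrable lborel b"
    and k[measurable]: "(\<lambda>(x, y). k x y) \<in> borel_measurable (lborel \<Otimes>\<^sub>M lborel)"
    and K: "\<And>x y. norm (k x y) \<le> K"
  shows "(LINT x|lborel. a x * (LINT y|lborel. k x y * b y))
    = (LINT y|lborel. b y * (LINT x|lborel. k x y * a x))"
proof -
  have [measurable]: "a \<in> borel_measurable borel" "b \<in> borel_measurable borel"
    using a b by (simp_all add: integrable_iff_bounded)
  have km: "k x \<in> borel_measurable borel" for x
  proof -
    have "(\<lambda>y. (case (x, y) of (x, y) \<Rightarrow> k x y)) \<in> borel_measurable lborel"
      by (rule measurable_compose[OF _ k]) simp
    then show ?thesis by simp
  qed
  have int: "integrable lborel (\<lambda>y. k x y * b y)" for x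
  proof (rule Bochner_Integration.integrable_bound)
    show "integrable lborel (\<lambda>y. K * norm (b y))" using b by auto
    show "AE y in lborel. norm (k x y * b y) \<le> norm (K * norm (b y))"
      using K by (intro AE_I2) (auto simp: norm_mult abs_mult intro!: mult_right_mono order_trans[OF K abs_ge_self])
  qed (use km in measurable)
  have K0: "0 \<le> K" by (rule order_trans[OF norm_ge_zero K[of undefined undefined]])
  have I: "integrable (lborel \<Otimes>\<^sub>M lborel) (case_prod (\<lambda>x y. a x * (k x y * b y)))"
  proof (rule lborel_pair.Fubini_integrable)
    show "case_prod (\<lambda>x y. a x * (k x y * b y)) \<in> borel_measurable (lborel \<Otimes>\<^sub>M lborel)"
      unfolding split_beta' using k[unfolded split_beta'] by measurable
    show "AE x in lborel. integrable lborel (\<lambda>y. case (x, y) of (x, y) \<Rightarrow> a x * (k x y * b y))"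
      using int by auto
    have m: "(\<lambda>x. LINT y|lborel. norm (a x * (k x y * b y))) \<in> borel_measurable lborel"
      using k[unfolded split_beta'] by measurable
    have bd: "norm (LINT y|lborel. norm (a x * (k x y * b y)))
      \<le> norm (norm (a x) * (K * (LINT y|lborel. norm (b y))))" for x
    proof -
      have "(LINT y|lborel. norm (a x * (k x y * b y)))
        \<le> (LINT y|lborel. norm (a x) * (K * norm (b y)))"
      proof (rule integral_mono)
        show "integrable lborel (\<lambda>y. norm (a x * (k x y * b y)))"
          by (rule integrable_norm[OF integrable_mult_right[OF int]])
        show "integrable lborel (\<lambda>y. norm (a x) * (K * norm (b y)))"
          using b by (intro integrable_mult_right integrable_norm)
        show "norm (a x * (k x y * b y)) \<le> norm (a x) * (K * norm (b y))" for y
          unfolding norm_mult by (intro mult_left_mono mult_right_mono K) auto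
      qed
      also have "\<dots> = norm (a x) * (K * (LINT y|lborel. norm (b y)))"
        by (simp only: integral_mult_right_zero)
      finally have le: "(LINT y|lborel. norm (a x * (k x y * b y)))
        \<le> norm (a x) * (K * (LINT y|lborel. norm (b y)))" .
      have "0 \<le> (LINT y|lborel. norm (a x * (k x y
        * b y)))" by (rule Bochner_Integration.integral_nonneg) simp
      then show ?thesis
        using order_trans[OF le abs_ge_self] by (simp only: real_norm_def abs_of_nonneg)
    qed
    have "integrable lborel (\<lambda>x. norm (a x) * (K * (LINT y|lborel. norm (b y))))"
      by (intro integrable_mult_left integrable_norm a)
    from Bochner_Integration.integrable_bound[OF this m AE_I2, OF bd]
    show "integrable lborel (\<lambda>x. LINT y|lborel. norm (case (x, y) of (x, y) \<Rightarrow> a x * (k x y * b y)))"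
      unfolding prod.case .
  qed
  have "(LINT x|lborel. a x * (LINT y|lborel. k x y * b y))
    = (LINT x|lborel. LINT y|lborel. a x * (k x y * b y))"
    by simp
  also have "\<dots> = (LINT y|lborel. LINT x|lborel. a x * (k x y * b y))"
    by (rule lborel_pair.Fubini_integral[OF I, symmetric])
  also have "\<dots> = (LINT y|lborel. LINT x|lborel. b y * (k x y * a x))"
    by (simp add: mult_ac)
  finally show ?thesis by simp
qed

lemma norm_sq_coords: "(norm x)\<^sup>2 = (\<Sum>b\<in>Basis. (x \<bullet> b)\<^sup>2)"
  by (subst power2_norm_eq_inner, subst euclidean_inner) (simp only: power2_eq_square)

definition gauss :: "'a::euclidean_space \<Rightarrow> real" where
  "gauss x = (\<Prod>b\<in>Basis. std_normal_density (x \<bullet> b))"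

lemma gauss_eq: "gauss (x::'a::euclidean_space) = exp (- (norm x)\<^sup>2 / 2) / sqrt (2 * pi) ^ DIM('a)"
proof -
  have "gauss x = (\<Prod>b\<in>(Basis::'a set). exp (- (x \<bullet> b)\<^sup>2 / 2) / sqrt (2 * pi))"
    by (simp add: gauss_def std_normal_density_def)
  also have "\<dots> = exp (\<Sum>b\<in>Basis. - (x \<bullet> b)\<^sup>2 / 2) / sqrt (2 * pi) ^ DIM('a)"
    by (simp only: prod_dividef exp_sum[OF finite_Basis] prod_constant)
  also have "(\<Sum>b\<in>Basis. - (x \<bullet> b)\<^sup>2 / 2) = - (norm x)\<^sup>2 / 2"
    by (simp add: norm_sq_coords sum_negf sum_divide_distrib)
  finally show ?thesis .
qed

lemma gauss_measurable [measurable]: "gauss \<in> borel_measurable borel"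
  unfolding gauss_def[abs_def] by measurable

lemma gauss_nonneg: "0 \<le> gauss x"
  by (simp add: gauss_def prod_nonneg)

lemma integrable_gauss: "integrable lborel gauss"
  and integral_gauss: "(LINT x|lborel. gauss x) = 1"
  unfolding gauss_def[abs_def]
  using lborel_integral_prod[of "\<lambda>_. std_normal_density"] by simp_all

text \<open>
  The kernel factors over the coordinates, and in each coordinate the integral is the characteristic
  function of the standard normal distribution.
\<close>

lemma fourier_gauss: "fourier (\<lambda>x. complex_of_real (gauss x)) \<xi> = exp (- (norm \<xi>)\<^sup>2 / 2)"
proof -
  let ?f = "\<lambda>b t. iexp (- (\<xi> \<bullet> b) * t) * complex_of_real (std_normal_density t)"
  have fint: "integrable lborel (?f b)" for b
    by (rule Bochner_Integration.integrable_bound[of _ "std_normal_density"]) (auto simp: norm_mult)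
  have fval: "(LINT t|lborel. ?f b t) = exp (- (\<xi> \<bullet> b)\<^sup>2 / 2)" for b
  proof -
    have "(LINT t|lborel. ?f b t) = char std_normal_distribution (- (\<xi> \<bullet> b))"
      unfolding char_def by (subst integral_density) (auto simp: scaleR_conv_of_real mult_ac)
    then show ?thesis by (simp add: char_std_normal_distribution)
  qed
  have "ek x \<xi> * complex_of_real (gauss x) = (\<Prod>b\<in>Basis. ?f b (x \<bullet> b))" for x
  proof -
    have "ek x \<xi> = exp (\<Sum>b\<in>Basis. \<i> * complex_of_real (- (\<xi> \<bullet> b) * (x \<bullet> b)))"
      by (simp add: ek_def euclidean_inner[of x \<xi>] sum_distrib_left sum_negf mult_ac)
    then show ?thesis by (simp add: exp_sum gauss_def prod.distrib)
  qed
  then have "fourier (\<lambda>x. complex_of_real (gauss x)) \<xi> = (LINT x|lborel. (\<Prod>b\<in>Basis. ?f b (x \<bullet> b)))"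
    by (simp only: fourier_ek)
  also have "\<dots> = (\<Prod>b\<in>Basis. (LINT t|lborel. ?f b t))"
    by (rule lborel_integral_prod(2)[OF fint])
  also have "\<dots> = (\<Prod>b\<in>Basis. complex_of_real (exp (- (\<xi> \<bullet> b)\<^sup>2 / 2)))"
    by (simp only: fval)
  also have "\<dots> = complex_of_real (exp (\<Sum>b\<in>Basis. - (\<xi> \<bullet> b)\<^sup>2 / 2))"
    by (simp add: exp_sum)
  also have "(\<Sum>b\<in>Basis. - (\<xi> \<bullet> b)\<^sup>2 / 2) = - (norm \<xi>)\<^sup>2 / 2"
    by (simp add: norm_sq_coords sum_negf sum_divide_distrib)
  finally show ?thesis by simp
qed

text \<open>
  A Gaussian cutoff in frequency; it increases to one as \<open>\<epsilon>\<close> tends to zero.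
\<close>

definition gcut :: "real \<Rightarrow> 'a::euclidean_space \<Rightarrow> real" where
  "gcut \<epsilon> \<xi> = exp (- (norm (\<epsilon> *\<^sub>R \<xi>))\<^sup>2 / 2)"

lemma gcut_measurable [measurable]: "gcut \<epsilon> \<in> borel_measurable borel"
  unfolding gcut_def[abs_def] by measurable

lemma gcut_eq: "gcut \<epsilon> (\<xi>::'a::euclidean_space) = sqrt (2 * pi) ^ DIM('a) * gauss (\<epsilon> *\<^sub>R \<xi>)"
  by (simp add: gcut_def gauss_eq)

lemma gcut_bounds: "0 < gcut \<epsilon> \<xi>" "gcut \<epsilon> \<xi> \<le> 1"
  by (simp_all add: gcut_def)

lemma integrable_gauss_scaled: "\<epsilon> \<noteq> 0 \<Longrightarrow> integrable lborel (\<lambda>x. gauss (t + \<epsilon> *\<^sub>R x))"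
  using lborel_integral_affine(2)[of gauss \<epsilon> t] by (simp add: integrable_gauss)

lemma integrable_gcut: "\<epsilon> \<noteq> 0 \<Longrightarrow> integrable lborel (gcut \<epsilon> :: 'a::euclidean_space \<Rightarrow> real)"
  using integrable_gauss_scaled[of \<epsilon> "0::'a"] by (simp add: gcut_eq[abs_def])

text \<open>
  The Fourier transform of the Gaussian cutoff: a positive kernel of mass \<open>(2\<pi>)^d\<close> which
  concentrates at the origin as \<open>\<epsilon>\<close> tends to zero.
\<close>

definition gker :: "real \<Rightarrow> 'a::euclidean_space \<Rightarrow> real" where
  "gker \<epsilon> z = (2 * pi) ^ DIM('a) * (gauss ((1 / \<epsilon>) *\<^sub>R z) / \<epsilon> ^ DIM('a))"

lemma gker_nonneg: "\<epsilon> > 0 \<Longrightarrow> 0 \<le> gker \<epsilon> z"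
  by (simp add: gker_def gauss_nonneg)

lemma gker_measurable [measurable]: "gker \<epsilon> \<in> borel_measurable borel"
  unfolding gker_def[abs_def] by measurable

lemma gauss_uminus: "gauss (- x) = gauss x"
  by (simp add: gauss_eq)

lemma gker_uminus: "gker \<epsilon> (- x) = gker \<epsilon> x"
  by (simp add: gker_def gauss_uminus)

lemma fourier_gcut:
  assumes e: "\<epsilon> > 0"
  shows "fourier (\<lambda>\<xi>. complex_of_real (gcut \<epsilon> \<xi>)) z = complex_of_real (gker \<epsilon> (z::'a::euclidean_space))"
proof -
  let ?h = "\<lambda>\<eta>. ek \<eta> ((1 / \<epsilon>) *\<^sub>R z) * complex_of_real (gauss \<eta>)"
  have "(LINT \<eta>|lborel. ?h \<eta>) = \<bar>\<epsilon>\<bar> ^ DIM('a) *\<^sub>R (LINT \<xi>|lborel. ?h (0 + \<epsilon> *\<^sub>R \<xi>))"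
    using e by (intro lborel_integral_affine) auto
  then have "complex_of_real (exp (- (norm ((1 / \<epsilon>) *\<^sub>R z))\<^sup>2 / 2))
    = complex_of_real (\<epsilon> ^ DIM('a)) * (LINT \<xi>|lborel. ek \<xi> z * complex_of_real (gauss (\<epsilon> *\<^sub>R \<xi>)))"
    using e fourier_gauss[of "(1 / \<epsilon>) *\<^sub>R z"] by (simp add: fourier_ek scaleR_conv_of_real ek_scale)
  then have "(LINT \<xi>|lborel. ek \<xi> z * complex_of_real (gauss (\<epsilon> *\<^sub>R \<xi>)))
    = complex_of_real (exp (- (norm ((1 / \<epsilon>) *\<^sub>R z))\<^sup>2 / 2)) / complex_of_real (\<epsilon> ^ DIM('a))"
    using e by (simp add: field_simps)
  moreover have "fourier (\<lambda>\<xi>. complex_of_real (gcut \<epsilon> \<xi>)) z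
    = complex_of_real (sqrt (2 * pi) ^ DIM('a)) * (LINT \<xi>|lborel. ek \<xi> z * complex_of_real (gauss (\<epsilon> *\<^sub>R \<xi>)))"
  proof -
    have "(\<lambda>\<xi>. ek \<xi> z * complex_of_real (gcut \<epsilon> \<xi>))
      = (\<lambda>\<xi>. complex_of_real (sqrt (2 * pi) ^ DIM('a)) * (ek \<xi> z * complex_of_real (gauss (\<epsilon> *\<^sub>R \<xi>))))"
      by (simp add: fun_eq_iff gcut_eq)
    then show ?thesis unfolding fourier_ek by (simp only: integral_mult_right_zero)
  qed
  moreover have "complex_of_real (sqrt (2 * pi) ^ DIM('a))
    * (complex_of_real E / complex_of_real (\<epsilon> ^ DIM('a)))
      = complex_of_real ((2 * pi) ^ DIM('a) * (E / sqrt (2 * pi) ^ DIM('a) / \<epsilon> ^ DIM('a)))" for E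
  proof -
    have abs: "S * (E / e) = P * (E / S / e)" if "S * S = P" "S \<noteq> 0" for S P e :: real
      using that by auto
    have "sqrt (2 * pi) ^ DIM('a) * sqrt (2 * pi) ^ DIM('a) = (2 * pi) ^ DIM('a)"
    proof -
      have "sqrt (2 * pi) * sqrt (2 * pi) = 2 * pi" by simp
      then show ?thesis unfolding power_mult_distrib[symmetric] by (simp only:)
    qed
    from abs[OF this] have "sqrt (2 * pi) ^ DIM('a) * (E / \<epsilon> ^ DIM('a))
      = (2 * pi) ^ DIM('a) * (E / sqrt (2 * pi) ^ DIM('a) / \<epsilon> ^ DIM('a))"
      by (metis power_not_zero real_sqrt_eq_zero_cancel_iff mult_eq_0_iff pi_neq_zero zero_neq_numeral)
    then show ?thesis by (simp only: flip: of_real_mult of_real_divide)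
  qed
  ultimately show ?thesis by (simp only: gker_def gauss_eq)
qed

lemma nn_integral_gker:
  fixes t :: "'a::euclidean_space"
  assumes e: "\<epsilon> > 0"
  shows "(\<integral>\<^sup>+z. ennreal (gker \<epsilon> (t + z)) \<partial>lborel) = ennreal ((2 * pi) ^ DIM('a))"
proof -
  have "(\<integral>\<^sup>+z. ennreal (gker \<epsilon> (t + z)) \<partial>lborel)
    = ennreal (\<bar>\<epsilon>\<bar> ^ DIM('a)) * (\<integral>\<^sup>+z. ennreal (gker \<epsilon> (t + (- t + \<epsilon> *\<^sub>R z))) \<partial>lborel)"
    using e by (intro lborel_nn_integral_affine) auto
  also have "\<dots> = ennreal (\<epsilon> ^ DIM('a)) * (\<integral>\<^sup>+z. ennreal ((2 * pi) ^ DIM('a) / \<epsilon> ^ DIM('a))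
    * ennreal (gauss (z::'a)) \<partial>lborel)"
    using e by (simp add: gker_def gauss_nonneg flip: ennreal_mult)
  also have "(\<integral>\<^sup>+z. ennreal ((2 * pi) ^ DIM('a) / \<epsilon> ^ DIM('a)) * ennreal (gauss (z::'a)) \<partial>lborel)
      = ennreal ((2 * pi) ^ DIM('a) / \<epsilon> ^ DIM('a))"
  proof -
    have "(\<integral>\<^sup>+z. ennreal (gauss (z::'a)) \<partial>lborel) = ennreal (LINT z|lborel. gauss (z::'a))"
      by (rule nn_integral_eq_integral[OF integrable_gauss]) (simp add: gauss_nonneg)
    then show ?thesis by (simp add: nn_integral_cmult integral_gauss)
  qed
  finally show ?thesis using e by (simp flip: ennreal_mult)
qed

section \<open>Derivatives and the Fourier transform\<close>

lemma schwartz_decay_power: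
  fixes f :: "'a::euclidean_space \<Rightarrow> complex"
  assumes "f \<in> schwartz"
  shows "norm x ^ k * norm (f x) \<le> schwartz_seminorm (2 * DIM('a) + k) f * decay_weight x"
proof -
  have r: "1 + norm x > 0" by (simp add: add_pos_nonneg)
  have "(1 + norm x) ^ (2 * DIM('a)) * (norm x ^ k * norm (f x))
    \<le> (1 + norm x) ^ (2 * DIM('a)) * ((1 + norm x) ^ k * norm (f x))"
    by (intro mult_left_mono mult_right_mono power_mono) auto
  also have "\<dots> \<le> schwartz_seminorm (2 * DIM('a) + k) f"
    using schwartz_seminorm_bound[OF assms, of "[]" "2 * DIM('a)
      + k" x] by (simp add: power_add mult.assoc)
  finally show ?thesis using r by (simp add: decay_weight_def pos_le_divide_eq mult.commute)
qed

lemma schwartz_decay: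
  fixes f :: "'a::euclidean_space \<Rightarrow> complex"
  shows "f \<in> schwartz \<Longrightarrow> norm (f x) \<le> schwartz_seminorm (2 * DIM('a)) f * decay_weight x"
  using schwartz_decay_power[of f x 0] by simp

lemma schwartz_integrable: "f \<in> schwartz \<Longrightarrow> integrable lborel f"
  by (rule integrable_decay[OF schwartz_measurable schwartz_decay])

lemma schwartz_integrable_power:
  assumes "f \<in> schwartz"
  shows "integrable lborel (\<lambda>x. norm x ^ k * norm (f x))"
proof (rule integrable_decay)
  have [measurable]: "f \<in> borel_measurable borel" by (rule schwartz_measurable[OF assms])
  show "(\<lambda>x. norm x ^ k * norm (f x)) \<in> borel_measurable borel" by measurable
  show "norm (norm x ^ k * norm (f x)) \<le> schwartz_seminorm (2 * DIM('a) + k) f * decay_weight x" for x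
    using schwartz_decay_power[OF assms, of x k] by simp
qed

lemma norm_fourier_schwartz:
  fixes f :: "'a::euclidean_space \<Rightarrow> complex"
  assumes "f \<in> schwartz"
  shows "norm (fourier f \<xi>) \<le> integral\<^sup>L lborel (decay_weight :: 'a \<Rightarrow> real) * schwartz_seminorm (2
    * DIM('a)) f"
  using order_trans[OF norm_fourier_le integral_norm_decay[OF schwartz_measurable schwartz_decay]] assms
  by (simp add: mult.commute)

lemma fourier_cmult: "fourier (\<lambda>x. c * f x) \<xi> = c * fourier f \<xi>"
  unfolding fourier_ek by (simp only: mult.left_commute[of _ c] integral_mult_right_zero)

lemma fourier_add:
  "integrable lborel f \<Longrightarrow> integrable lborel g \<Longrightarrow> fourier (\<lambda>x. f x + g x) \<xi> = fourier f \<xi> + fourier g \<xi>"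
  unfolding fourier_ek ring_distribs by (intro Bochner_Integration.integral_add integrable_ek)

lemma fourier_sum:
  assumes "\<And>i. i \<in> I \<Longrightarrow> integrable lborel (f i)"
  shows "fourier (\<lambda>x. \<Sum>i\<in>I. f i x) \<xi> = (\<Sum>i\<in>I. fourier (f i) \<xi>)"
  unfolding fourier_ek sum_distrib_left
  by (intro Bochner_Integration.integral_sum integrable_ek assms)

text \<open>
  An error of second order in the increment identifies the derivative.
\<close>

lemma has_derivative_quadratic:
  assumes "bounded_linear L" and "\<And>h. norm (f (x + h) - f x - L h) \<le> K * (norm h)\<^sup>2"
  shows "(f has_derivative L) (at x)"
proof (rule has_derivativeI_sandwich[of 1])
  fix y assume "y \<noteq> x"
  then have "norm (y - x) > 0" by simp
  then show "norm (f y - f x - L (y - x)) / norm (y - x) \<le> K * norm (y - x)"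
    using assms(2)[of "y - x"] by (simp add: pos_divide_le_eq power2_eq_square mult.assoc)
next
  have "((\<lambda>y. K * norm (y - x)) \<longlongrightarrow> K * norm (x - x)) (at x)"
    by (intro tendsto_intros)
  then show "((\<lambda>y. K * norm (y - x)) \<longlongrightarrow> 0) (at x)" by simp
qed (use assms in auto)

lemma ek_approx: "norm (ek x h - 1 + \<i> * complex_of_real (x \<bullet> h)) \<le> (norm x)\<^sup>2 * (norm h)\<^sup>2"
proof -
  have "norm (ek x h - 1 + \<i> * complex_of_real (x \<bullet> h)) \<le> \<bar>x \<bullet> h\<bar>\<^sup>2 / 2"
    using iexp_approx1[of "- (x \<bullet> h)" 1] by (simp add: ek_def numeral_2_eq_2 algebra_simps)
  also have "\<dots> \<le> \<bar>x \<bullet> h\<bar>\<^sup>2" by simp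
  also have "\<dots> \<le> (norm x * norm h)\<^sup>2" by (intro power_mono Cauchy_Schwarz_ineq2) auto
  finally show ?thesis by (simp add: power_mult_distrib)
qed

text \<open>
  The kernel satisfies \<open>exp(- i x \<cdot> h) = 1 - i x \<cdot> h + O(|x|\<^sup>2 |h|\<^sup>2)\<close>, and the second
  moment of a Schwartz function is finite.
\<close>

lemma fourier_has_derivative:
  fixes f :: "'a::euclidean_space \<Rightarrow> complex"
  assumes f: "f \<in> schwartz"
  shows "(fourier f has_derivative
    (\<lambda>h. \<Sum>b\<in>Basis. (h \<bullet> b) *\<^sub>R fourier (\<lambda>x. - \<i> * (complex_of_real (x \<bullet> b) * f x)) \<xi>)) (at \<xi>)"
proof (rule has_derivative_quadratic)
  show "bounded_linear (\<lambda>h. \<Sum>b\<in>Basis. (h \<bullet> b) *\<^sub>R fourier (\<lambda>x. - \<i> * (complex_of_real (x \<bullet> b)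
    * f x)) \<xi>)"
    by (intro bounded_linear_sum bounded_linear_intros)
  let ?g = "\<lambda>b x. - \<i> * (complex_of_real (x \<bullet> b) * f x)"
  have g: "?g b \<in> schwartz" if "b \<in> Basis" for b
    by (intro schwartz_cmult schwartz_coord f that)
  fix h :: 'a
  let ?r = "\<lambda>x. ek x \<xi> * (ek x h - 1 + \<i> * complex_of_real (x \<bullet> h)) * f x"
  have L: "(\<Sum>b\<in>Basis. (h \<bullet> b) *\<^sub>R fourier (?g b) \<xi>)
    = (LINT x|lborel. ek x \<xi> * (- \<i> * complex_of_real (x \<bullet> h) * f x))"
    and Lint: "integrable lborel (\<lambda>x. ek x \<xi> * (- \<i> * complex_of_real (x \<bullet> h) * f x))"
  proof -
    have eq: "- \<i> * complex_of_real (x \<bullet> h) * f x = (\<Sum>b\<in>Basis. complex_of_real (h \<bullet> b) * ?g b x)" for x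
      by (subst euclidean_inner) (simp add: sum_distrib_left sum_distrib_right mult_ac sum_negf)
    have i: "integrable lborel (\<lambda>x. complex_of_real (h \<bullet> b) * ?g b x)" if "b \<in> Basis" for b
      by (intro integrable_mult_right schwartz_integrable g that)
    show "integrable lborel (\<lambda>x. ek x \<xi> * (- \<i> * complex_of_real (x \<bullet> h) * f x))"
      unfolding eq by (intro integrable_ek Bochner_Integration.integrable_sum i)
    have "(LINT x|lborel. ek x \<xi> * (- \<i> * complex_of_real (x \<bullet> h) * f x))
       = fourier (\<lambda>x. \<Sum>b\<in>Basis. complex_of_real (h \<bullet> b) * ?g b x) \<xi>"
      unfolding eq by (simp only: fourier_ek)
    also have "\<dots> = (\<Sum>b\<in>Basis. complex_of_real (h \<bullet> b) * fourier (?g b) \<xi>)"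
      by (subst fourier_sum[OF i]) (auto simp only: fourier_cmult)
    finally show "(\<Sum>b\<in>Basis. (h \<bullet> b) *\<^sub>R fourier (?g b) \<xi>)
      = (LINT x|lborel. ek x \<xi> * (- \<i> * complex_of_real (x \<bullet> h) * f x))"
      by (simp add: scaleR_conv_of_real)
  qed
  note fi = schwartz_integrable[OF f]
  have "fourier f (\<xi> + h) - fourier f \<xi> - (\<Sum>b\<in>Basis. (h \<bullet> b) *\<^sub>R fourier (?g b) \<xi>)
    = (LINT x|lborel. ek x (\<xi> + h) * f x - ek x \<xi> * f x - ek x \<xi> * (- \<i> * complex_of_real (x \<bullet> h) * f x))"
    unfolding L fourier_ek[of f "\<xi> + h"] fourier_ek[of f \<xi>]
    by (simp only: Bochner_Integration.integral_diff Bochner_Integration.integrable_diff Lint integrable_ek fi)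
  also have "(\<lambda>x. ek x (\<xi> + h) * f x - ek x \<xi> * f x - ek x \<xi> * (- \<i> * complex_of_real (x \<bullet> h) * f x))
    = ?r"
    by (simp add: fun_eq_iff ek_add algebra_simps)
  also have "norm (LINT x|lborel. ?r x) \<le> (LINT x|lborel. (norm h)\<^sup>2 * ((norm x)\<^sup>2 * norm (f x)))"
  proof (rule order_trans[OF integral_norm_bound integral_mono])
    have bd: "norm (?r x) \<le> (norm h)\<^sup>2 * ((norm x)\<^sup>2 * norm (f x))" for x
      using mult_right_mono[OF ek_approx[of x h], of "norm (f x)"] by (simp add: norm_mult mult_ac)
    then show "norm (?r x) \<le> (norm h)\<^sup>2 * ((norm x)\<^sup>2 * norm (f x))" for x .
    show i: "integrable lborel (\<lambda>x. (norm h)\<^sup>2 * ((norm x)\<^sup>2 * norm (f x)))"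
      by (intro integrable_mult_right schwartz_integrable_power f)
    have [measurable]: "f \<in> borel_measurable borel" by (rule schwartz_measurable[OF f])
    have m: "?r \<in> borel_measurable lborel" by measurable
    show "integrable lborel (\<lambda>x. norm (?r x))"
      by (rule integrable_norm, rule Bochner_Integration.integrable_bound[OF i m AE_I2]) (use bd in \<open>simp add: abs_mult\<close>)
  qed
  also have "\<dots> = (LINT x|lborel. (norm x)\<^sup>2 * norm (f x)) * (norm h)\<^sup>2"
    by (simp only: integral_mult_right_zero mult.commute)
  finally show "norm (fourier f (\<xi> + h) - fourier f \<xi> - (\<Sum>b\<in>Basis. (h \<bullet> b) *\<^sub>R fourier (?g b) \<xi>))
    \<le> (LINT x|lborel. (norm x)\<^sup>2 * norm (f x)) * (norm h)\<^sup>2" .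
qed

lemma pd_fourier:
  assumes f: "f \<in> schwartz" and b: "b \<in> Basis"
  shows "pd b (fourier f) = fourier (\<lambda>x. - \<i> * (complex_of_real (x \<bullet> b) * f x))"
  using pd_eqI[OF fourier_has_derivative[OF f], of b] b
  by (simp add: fun_eq_iff inner_Basis if_distrib[of "\<lambda>c. c *\<^sub>R _"] cong: if_cong)

lemma fourier_differentiable: "f \<in> schwartz \<Longrightarrow> fourier f differentiable_on UNIV"
  by (rule differentiable_onI_has[OF fourier_has_derivative])

text \<open>
  Continuity of a map of the Schwartz space, expressed through the seminorms; linearity is kept
  separate.
\<close>

definition schwartz_op :: "(('a::euclidean_space \<Rightarrow> complex) \<Rightarrow> 'a \<Rightarrow> complex) \<Rightarrow> bool" where
  "schwartz_op L \<longleftrightarrow> (\<forall>f\<in>schwartz. L f \<in> schwartz) \<and>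
    (\<forall>N. \<exists>M C. 0 \<le> C \<and> (\<forall>f\<in>schwartz. schwartz_seminorm N (L f) \<le> C * schwartz_seminorm M f))"

lemma schwartz_op_compose:
  assumes "schwartz_op L" "schwartz_op L'"
  shows "schwartz_op (\<lambda>f. L (L' f))"
  unfolding schwartz_op_def
proof (intro conjI allI)
  show "\<forall>f\<in>schwartz. L (L' f) \<in> schwartz" using assms by (simp add: schwartz_op_def)
  fix N
  obtain M C where 1: "0 \<le> C" "\<And>f. f \<in> schwartz \<Longrightarrow> schwartz_seminorm N (L f) \<le> C * schwartz_seminorm M f"
    using assms(1) unfolding schwartz_op_def by meson
  obtain M' C' where 2: "0 \<le> C'" "\<And>f. f \<in> schwartz \<Longrightarrow>
    schwartz_seminorm M (L' f) \<le> C' * schwartz_seminorm M' f"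
    using assms(2) unfolding schwartz_op_def by meson
  have "schwartz_seminorm N (L (L' f)) \<le> (C * C') * schwartz_seminorm M' f" if "f \<in> schwartz" for f
  proof -
    have "schwartz_seminorm N (L (L' f)) \<le> C * schwartz_seminorm M (L' f)"
      using 1 assms(2) that by (simp add: schwartz_op_def)
    also have "\<dots> \<le> C * (C' * schwartz_seminorm M' f)" by (intro mult_left_mono 1 2 that)
    finally show ?thesis by (simp add: mult.assoc)
  qed
  then show "\<exists>M C. 0 \<le> C \<and> (\<forall>f\<in>schwartz. schwartz_seminorm N (L (L' f)) \<le> C * schwartz_seminorm M f)"
    using 1(1) 2(1) by (intro exI[of _ M'] exI[of _ "C * C'"]) auto
qed

lemma schwartz_op_coord:
  assumes b: "b \<in> Basis"
  shows "schwartz_op (\<lambda>f x. complex_of_real (x \<bullet> b) * f x)"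
  unfolding schwartz_op_def
proof (intro conjI allI)
  fix N
  show "\<exists>M C. 0 \<le> C \<and> (\<forall>f\<in>schwartz. schwartz_seminorm N (\<lambda>x. complex_of_real (x \<bullet> b) * f x)
    \<le> C * schwartz_seminorm M f)"
    using schwartz_seminorm_mult[OF coord_slow_growth[OF b], of _ N]
    by (intro exI[of _ "N + 1"] exI[of _ "2 ^ N * 1"]) auto
qed (use schwartz_coord[OF b] in auto)

lemma schwartz_op_cmult: "schwartz_op (\<lambda>f x. c * f x)"
  unfolding schwartz_op_def using schwartz_cmult schwartz_seminorm_cmult by (metis norm_ge_zero)

text \<open>
  Every derivative of a transform is the transform of a function obtained by multiplication with
  coordinates, which is a continuous operation.
\<close>

lemma pderivs_fourier:
  assumes "dirs bs"
  shows "\<exists>L. schwartz_op L \<and> (\<forall>f\<in>schwartz. pderivs bs (fourier f) = fourier (L f))"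
  using assms
proof (induction bs)
  case Nil
  have "schwartz_op (\<lambda>f. f)" unfolding schwartz_op_def by (metis mult_1 order_refl zero_le_one)
  then show ?case by (intro exI[of _ "\<lambda>f. f"]) simp
next
  case (Cons b bs)
  then obtain L where L: "schwartz_op L" "\<And>f. f \<in> schwartz \<Longrightarrow>
    pderivs bs (fourier f) = fourier (L f)" by auto
  have b: "b \<in> Basis" using Cons by simp
  have "pderivs (b # bs) (fourier f) = fourier (\<lambda>x. - \<i> * (complex_of_real (x \<bullet> b)
    * L f x))" if "f \<in> schwartz" for f
    using that b L pd_fourier[of "L f" b] by (simp add: schwartz_op_def)
  moreover have "schwartz_op (\<lambda>f x. - \<i> * (complex_of_real (x \<bullet> b) * L f x))"
    by (rule schwartz_op_compose[OF schwartz_op_compose[OF schwartz_op_cmult schwartz_op_coord[OF b]] L(1)])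
  ultimately show ?case by blast
qed

text \<open>
  The mean value inequality along a segment of length at most one, on which the decay weight changes
  by a bounded factor; this dominates the difference quotients.
\<close>

lemma schwartz_translate_bound:
  fixes f :: "'a::euclidean_space \<Rightarrow> complex"
  assumes f: "f \<in> schwartz" and b: "b \<in> Basis" and h: "0 < h" "h \<le> 1"
  shows "norm (f (x + h *\<^sub>R b) - f x) \<le> h * (2 ^ (2 * DIM('a)) * schwartz_seminorm (2
    * DIM('a)) (pd b f) * decay_weight x)"
proof -
  let ?\<phi> = "\<lambda>t. f (x + t *\<^sub>R b)"
  have d: "(?\<phi> has_derivative (\<lambda>s. s *\<^sub>R pd b f (x + t *\<^sub>R b))) (at t)" for t
  proof -
    have "(?\<phi> has_derivative (\<lambda>s. frechet_derivative f (at (x + t *\<^sub>R b)) (s *\<^sub>R b))) (at t)"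
      by (rule has_derivative_compose[of "\<lambda>t. x + t *\<^sub>R b", OF _ has_derivative_frechet])
         (auto intro!: derivative_eq_intros smooth_differentiable schwartz_smooth f)
    moreover have "linear (frechet_derivative f (at (x + t *\<^sub>R b)))"
      using smooth_differentiable[OF schwartz_smooth[OF f]]
      by (simp add: differentiable_on_def linear_frechet_derivative)
    ultimately show ?thesis by (simp add: linear_cmul pd_def)
  qed
  have "\<exists>t\<in>{0<..<h}. norm (?\<phi> h - ?\<phi> 0) \<le> norm ((h - 0) *\<^sub>R pd b f (x + t *\<^sub>R b))"
    using h d by (intro mvt_general) (auto intro!: has_derivative_continuous_on[OF has_derivative_at_withinI])
  then obtain t where t: "0 < t" "t < h" and *: "norm (?\<phi> h - ?\<phi> 0) \<le> h * norm (pd b f (x + t *\<^sub>R b))"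
    using h by auto
  have "norm (pd b f (x + t *\<^sub>R b)) \<le> schwartz_seminorm (2 * DIM('a)) (pd b f) * decay_weight (x
    + t *\<^sub>R b)"
    by (intro schwartz_decay schwartz_pd f b)
  also have "decay_weight (x + t *\<^sub>R b) \<le> 2 ^ (2 * DIM('a)) * decay_weight x"
  proof -
    have "norm x \<le> norm (x + t *\<^sub>R b) + norm (t *\<^sub>R b)"
      using norm_triangle_ineq4[of "x + t *\<^sub>R b" "t *\<^sub>R b"] by simp
    moreover have "norm (t *\<^sub>R b) \<le> 1" using t h b by simp
    moreover have "1 + n \<le> 2 * (1 + m)" if "n \<le> m + k" "k \<le> 1" "0 \<le> m" for n m k :: real
      using that by simp
    ultimately have "1 + norm x \<le> 2 * (1 + norm (x + t *\<^sub>R b))"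
      using norm_ge_zero by blast
    then have "(1 + norm x) ^ (2 * DIM('a)) \<le> (2 * (1 + norm (x + t *\<^sub>R b))) ^ (2 * DIM('a))"
      by (intro power_mono) auto
    moreover have "0 < (1 + norm x) ^ (2 * DIM('a))" "0 < (1 + norm (x + t *\<^sub>R b)) ^ (2 * DIM('a))"
      by (intro zero_less_power; simp add: add_pos_nonneg)+
    moreover have "1 / B \<le> P * (1 / A)" if "A \<le> P * B" "0 < A" "0 < B" for A B P :: real
      using that by (simp add: field_simps)
    ultimately show ?thesis unfolding decay_weight_def power_mult_distrib by blast
  qed
  finally have "norm (pd b f (x + t *\<^sub>R b))
    \<le> schwartz_seminorm (2 * DIM('a)) (pd b f) * (2 ^ (2 * DIM('a)) * decay_weight x)"
    using schwartz_seminorm_nonneg[OF schwartz_pd[OF f b]] by (simp add: mult_left_mono)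
  then have "h * norm (pd b f (x + t *\<^sub>R b))
    \<le> h * (schwartz_seminorm (2 * DIM('a)) (pd b f) * (2 ^ (2 * DIM('a)) * decay_weight x))"
    using h by (intro mult_left_mono) auto
  then show ?thesis using * by (simp add: mult_ac)
qed

text \<open>
  Translating \<open>f\<close> by \<open>- h b\<close> multiplies the transform by \<open>exp(i h b \<cdot> \<xi>)\<close>.  Dividing by \<open>h\<close>
  and letting \<open>h\<close> tend to zero, by dominated convergence on one side, gives the formula.
\<close>

lemma fourier_pd:
  fixes f :: "'a::euclidean_space \<Rightarrow> complex"
  assumes f: "f \<in> schwartz" and b: "b \<in> Basis"
  shows "fourier (pd b f) \<xi> = \<i> * complex_of_real (\<xi> \<bullet> b) * fourier f \<xi>"
proof -
  define h where "h n = 1 / real (Suc n)" for n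
  have h: "0 < h n" "h n \<le> 1" for n by (simp_all add: h_def)
  have h0: "h \<longlonglongrightarrow> 0" unfolding h_def using LIMSEQ_inverse_real_of_nat by (simp add: inverse_eq_divide)
  let ?s = "\<lambda>n x. ek x \<xi> * ((f (x + h n *\<^sub>R b) - f x) /\<^sub>R h n)"
  have fm[measurable]: "f \<in> borel_measurable borel" "pd b f \<in> borel_measurable borel"
    by (intro schwartz_measurable schwartz_pd f b)+
  have transl: "(LINT x|lborel. ek x \<xi> * f (x + t *\<^sub>R b)) = ek (- (t *\<^sub>R b)) \<xi> * fourier f \<xi>" for t
  proof -
    have "fourier f \<xi> = (LINT x|lborel. ek (t *\<^sub>R b + x) \<xi> * f (t *\<^sub>R b + x))"
      unfolding fourier_ek using lborel_integral_affine(1)[of "\<lambda>x. ek x \<xi> * f x" 1 "t *\<^sub>R b"] by simp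
    also have "\<dots> = ek (t *\<^sub>R b) \<xi> * (LINT x|lborel. ek x \<xi> * f (x + t *\<^sub>R b))"
    proof -
      have "(\<lambda>x. ek (t *\<^sub>R b + x) \<xi> * f (t *\<^sub>R b + x))
        = (\<lambda>x. ek (t *\<^sub>R b) \<xi> * (ek x \<xi> * f (x + t *\<^sub>R b)))"
        by (rule ext) (simp add: ek_add ac_simps)
      then show ?thesis by (simp only: integral_mult_right_zero)
    qed
    finally have "ek (- (t *\<^sub>R b)) \<xi> * fourier f \<xi>
      = ek (- (t *\<^sub>R b) + t *\<^sub>R b) \<xi> * (LINT x|lborel. ek x \<xi> * f (x + t *\<^sub>R b))"
      by (simp only: ek_add mult.assoc)
    then show ?thesis by simp
  qed
  have int: "integrable lborel (\<lambda>x. ek x \<xi> * f (x + t *\<^sub>R b))" for t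
    using schwartz_integrable[OF f] lborel_integral_affine(2)[of f 1 "t *\<^sub>R b"]
    by (intro integrable_ek) (simp add: add.commute)
  have s_eq: "(LINT x|lborel. ?s n x) = ((ek (- (h n *\<^sub>R b)) \<xi> - 1) /\<^sub>R h n) * fourier f \<xi>" for n
  proof -
    have "(LINT x|lborel. ?s n x) = (LINT x|lborel. (ek x \<xi> * f (x + h n *\<^sub>R b) - ek x \<xi> * f (x
      + 0 *\<^sub>R b)) /\<^sub>R h n)"
      by (simp add: algebra_simps)
    also have "\<dots> = ((LINT x|lborel. ek x \<xi> * f (x + h n *\<^sub>R b)) - (LINT x|lborel. ek x \<xi> * f (x
      + 0 *\<^sub>R b))) /\<^sub>R h n"
      by (simp only: integral_scaleR_right Bochner_Integration.integral_diff[OF int int])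
    also have "\<dots> = ((ek (- (h n *\<^sub>R b)) \<xi> - 1) /\<^sub>R h n) * fourier f \<xi>"
      unfolding transl by (simp add: algebra_simps)
    finally show ?thesis .
  qed
  have lim1: "(\<lambda>n. LINT x|lborel. ?s n x) \<longlonglongrightarrow> (LINT x|lborel. ek x \<xi> * pd b f x)"
  proof (rule integral_dominated_convergence)
    let ?w = "\<lambda>x. 2 ^ (2 * DIM('a)) * schwartz_seminorm (2 * DIM('a)) (pd b f) * decay_weight x"
    show "integrable lborel ?w" by (intro integrable_mult_right integrable_decay_weight)
    show "AE x in lborel. norm (?s n x) \<le> ?w x" for n
    proof (rule AE_I2)
      fix x
      have "norm (?s n x) = norm (f (x + h n *\<^sub>R b) - f x) / h n"
        using h[of n] by (simp add: norm_mult divide_inverse_commute)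
      then show "norm (?s n x) \<le> ?w x"
        using schwartz_translate_bound[OF f b h, of x n] h[of n] by (simp add: pos_divide_le_eq mult_ac)
    qed
    show "AE x in lborel. (\<lambda>n. ?s n x) \<longlonglongrightarrow> ek x \<xi> * pd b f x"
    proof (rule AE_I2)
      fix x
      have "((\<lambda>t. f (x + t *\<^sub>R b)) has_derivative (\<lambda>s. s *\<^sub>R pd b f x)) (at 0)"
      proof -
        have "((\<lambda>t. f (x + t *\<^sub>R b)) has_derivative (\<lambda>s. frechet_derivative f (at (x
          + 0 *\<^sub>R b)) (s *\<^sub>R b))) (at 0)"
          by (rule has_derivative_compose[of "\<lambda>t. x + t *\<^sub>R b", OF _ has_derivative_frechet])
             (auto intro!: derivative_eq_intros smooth_differentiable schwartz_smooth f)
        moreover have "linear (frechet_derivative f (at x))"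
          using smooth_differentiable[OF schwartz_smooth[OF f]]
          by (simp add: differentiable_on_def linear_frechet_derivative)
        ultimately show ?thesis by (simp add: linear_cmul pd_def)
      qed
      then have D: "((\<lambda>t. norm (f (x + t *\<^sub>R b) - f x - t *\<^sub>R pd b f x) / norm t) \<longlongrightarrow> 0) (at 0)"
        by (simp add: has_derivative_at)
      have fl: "filterlim h (at 0) sequentially"
        using h0 h(1) by (auto simp: filterlim_at intro!: always_eventually) (metis less_irrefl)
      have "(\<lambda>n. norm (f (x + h n *\<^sub>R b) - f x - h n *\<^sub>R pd b f x) / norm (h n)) \<longlonglongrightarrow> 0"
        by (rule filterlim_compose[OF D fl])
      moreover have "norm (f (x + h n *\<^sub>R b) - f x - h n *\<^sub>R pd b f x) / norm (h n)
          = norm ((f (x + h n *\<^sub>R b) - f x) /\<^sub>R h n - pd b f x)" for n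
      proof -
        have "(f (x + h n *\<^sub>R b) - f x) /\<^sub>R h n - pd b f x
          = (f (x + h n *\<^sub>R b) - f x - h n *\<^sub>R pd b f x) /\<^sub>R h n"
          using h(1)[of n] by (simp add: scaleR_diff_right)
        then show ?thesis by (simp add: divide_inverse_commute)
      qed
      ultimately have "(\<lambda>n. (f (x + h n *\<^sub>R b) - f x) /\<^sub>R h n) \<longlonglongrightarrow> pd b f x"
        by (simp add: tendsto_norm_zero_iff LIM_zero_iff)
      then show "(\<lambda>n. ?s n x) \<longlonglongrightarrow> ek x \<xi> * pd b f x"
        by (intro tendsto_mult tendsto_const)
    qed
  qed measurable
  have lim2: "(\<lambda>n. LINT x|lborel. ?s n x) \<longlonglongrightarrow> \<i> * complex_of_real (\<xi> \<bullet> b) * fourier f \<xi>"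
  proof -
    have "(\<lambda>n. (ek (- (h n *\<^sub>R b)) \<xi> - 1) /\<^sub>R h n) \<longlonglongrightarrow> \<i> * complex_of_real (\<xi> \<bullet> b)"
    proof -
      let ?K = "(norm b)\<^sup>2 * (norm \<xi>)\<^sup>2"
      have "norm ((ek (- (h n *\<^sub>R b)) \<xi> - 1) /\<^sub>R h n - \<i> * complex_of_real (\<xi> \<bullet> b)) \<le> h n * ?K" for n
      proof -
        have "norm (ek (- (h n *\<^sub>R b)) \<xi> - 1 - h n *\<^sub>R (\<i> * complex_of_real (\<xi> \<bullet> b)))
          \<le> h n * (h n * ?K)"
          using ek_approx[of "- (h n *\<^sub>R b)" \<xi>] h[of n]
          by (simp add: power_mult_distrib power2_eq_square scaleR_conv_of_real inner_commute mult_ac)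
        then have "norm ((ek (- (h n *\<^sub>R b)) \<xi> - 1 - h n *\<^sub>R (\<i> * complex_of_real (\<xi> \<bullet> b))) /\<^sub>R h n)
          \<le> h n * ?K"
          using h[of n] by (simp add: pos_divide_le_eq divide_inverse_commute[symmetric] mult_ac)
        then show ?thesis using h[of n] by (simp add: scaleR_diff_right)
      qed
      then have "(\<lambda>n. (ek (- (h n *\<^sub>R b)) \<xi> - 1) /\<^sub>R h n - \<i> * complex_of_real (\<xi> \<bullet> b)) \<longlonglongrightarrow> 0"
        by (intro Lim_null_comparison[OF always_eventually tendsto_mult_left_zero[OF h0]] allI)
      then show ?thesis by (rule LIM_zero_cancel)
    qed
    then show ?thesis unfolding s_eq by (intro tendsto_mult tendsto_const)
  qed
  from LIMSEQ_unique[OF lim1 lim2] show ?thesis by (simp add: fourier_ek)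
qed

section \<open>Fourier inversion and the Bessel inequality\<close>

lemma schwartz_seminorm_mono:
  assumes "f \<in> schwartz" "N \<le> M"
  shows "schwartz_seminorm N f \<le> schwartz_seminorm M f"
  using assms by (intro schwartz_seminorm_le schwartz_seminorm_bound') auto

text \<open>
  Since \<open>|\<xi>|\<close> is at most the sum of the \<open>|\<xi>\<^sub>b|\<close>, each power of \<open>|\<xi>|\<close> is traded for
  one derivative of the function.
\<close>

lemma fourier_decay:
  "\<exists>M C. 0 \<le> C \<and> (\<forall>f\<in>schwartz. \<forall>\<xi>::'a::euclidean_space. (1 + norm \<xi>) ^ N * norm (fourier f \<xi>)
    \<le> C * schwartz_seminorm M f)"
proof (induction N)
  case 0
  have "0 \<le> integral\<^sup>L lborel (decay_weight :: 'a \<Rightarrow> real)"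
    using decay_weight_pos by (intro Bochner_Integration.integral_nonneg) (auto intro: less_imp_le)
  then show ?case using norm_fourier_schwartz by fastforce
next
  case (Suc N)
  then obtain M C where C: "0 \<le> C"
    "\<And>f (\<xi>::'a). f \<in> schwartz \<Longrightarrow> (1 + norm \<xi>) ^ N * norm (fourier f \<xi>)
      \<le> C * schwartz_seminorm M f" by blast
  have "(1 + norm \<xi>) ^ Suc N * norm (fourier f \<xi>) \<le> (C * (1 + DIM('a))) * schwartz_seminorm (Suc M) f"
    if f: "f \<in> schwartz" for f :: "'a \<Rightarrow> complex" and \<xi> :: 'a
  proof -
    let ?w = "(1 + norm \<xi>) ^ N"
    have w: "0 \<le> ?w" by simp
    have "?w * (norm \<xi> * norm (fourier f \<xi>)) \<le> ?w * ((\<Sum>b\<in>Basis. \<bar>\<xi> \<bullet> b\<bar>) * norm (fourier f \<xi>))"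
      by (intro mult_left_mono mult_right_mono norm_le_l1) auto
    also have "\<dots> = (\<Sum>b\<in>Basis. ?w * norm (fourier (pd b f) \<xi>))"
      by (simp add: fourier_pd[OF f] norm_mult sum_distrib_left sum_distrib_right mult_ac)
    also have "\<dots> \<le> (\<Sum>b\<in>(Basis::'a set). C * schwartz_seminorm (Suc M) f)"
    proof (rule sum_mono)
      fix b :: 'a assume b: "b \<in> Basis"
      have "?w * norm (fourier (pd b f) \<xi>) \<le> C * schwartz_seminorm M (pd b f)"
        by (rule C(2)[OF schwartz_pd[OF f b]])
      also have "\<dots> \<le> C * schwartz_seminorm (Suc M) f"
        by (intro mult_left_mono schwartz_seminorm_pd f b C)
      finally show "?w * norm (fourier (pd b f) \<xi>) \<le> C * schwartz_seminorm (Suc M) f" .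
    qed
    finally have 1: "?w * (norm \<xi> * norm (fourier f \<xi>))
      \<le> DIM('a) * (C * schwartz_seminorm (Suc M) f)" by simp
    have "C * schwartz_seminorm M f \<le> C * schwartz_seminorm (Suc M) f"
      by (intro mult_left_mono schwartz_seminorm_mono f C) auto
    with C(2)[OF f, of \<xi>] 1 show ?thesis by (simp add: algebra_simps)
  qed
  moreover have "0 \<le> C * (1 + DIM('a))" using C(1) by simp
  ultimately show ?case by blast
qed

text \<open>
  Derivatives of the transform are transforms of Schwartz functions, and all transforms of Schwartz
  functions decay.
\<close>

lemma schwartz_op_fourier: "schwartz_op (fourier :: ('a::euclidean_space \<Rightarrow> complex) \<Rightarrow> _)"
proof -
  have ex: "\<exists>M C. 0 \<le> C \<and> (\<forall>f\<in>schwartz. \<forall>x. (1 + norm x) ^ N * norm (pderivs bs (fourier f) x)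
    \<le> C * schwartz_seminorm M f)"
    if bs: "dirs bs" for bs :: "'a list" and N
  proof -
    obtain L where L: "schwartz_op L" "\<And>f. f \<in> schwartz \<Longrightarrow> pderivs bs (fourier f) = fourier (L f)"
      using pderivs_fourier[OF bs] by blast
    obtain M C where C: "0 \<le> C"
      "\<And>f (\<xi>::'a). f \<in> schwartz \<Longrightarrow> (1 + norm \<xi>) ^ N * norm (fourier f \<xi>) \<le> C * schwartz_seminorm M f"
      using fourier_decay[of N] by blast
    obtain M' C' where C': "0 \<le> C'" "\<And>f. f \<in> schwartz \<Longrightarrow>
      schwartz_seminorm M (L f) \<le> C' * schwartz_seminorm M' f"
      using L(1) unfolding schwartz_op_def by meson
    have "(1 + norm x) ^ N * norm (pderivs bs (fourier f) x) \<le> (C * C') * schwartz_seminorm M' f"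
      if f: "f \<in> schwartz" for f :: "'a \<Rightarrow> complex" and x
    proof -
      have "(1 + norm x) ^ N * norm (pderivs bs (fourier f) x) \<le> C * schwartz_seminorm M (L f)"
        using L f by (simp add: C(2) schwartz_op_def)
      also have "\<dots> \<le> C * (C' * schwartz_seminorm M' f)" by (intro mult_left_mono C' f C)
      finally show ?thesis by (simp add: mult.assoc)
    qed
    then show ?thesis using C(1) C'(1) by (intro exI[of _ M'] exI[of _ "C * C'"]) auto
  qed
  have sm: "smooth (fourier f)" if f: "f \<in> schwartz" for f :: "'a \<Rightarrow> complex"
    unfolding smooth_def
  proof (intro allI impI)
    fix bs :: "'a list" assume "dirs bs"
    from pderivs_fourier[OF this] obtain L where "schwartz_op L" "pderivs bs (fourier f)
      = fourier (L f)"
      using f by blast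
    then show "pderivs bs (fourier f) differentiable_on UNIV"
      using f by (simp add: fourier_differentiable schwartz_op_def)
  qed
  have S: "fourier f \<in> schwartz" if f: "f \<in> schwartz" for f :: "'a \<Rightarrow> complex"
    using sm[OF f] ex f by (intro schwartzI) blast+
  show ?thesis unfolding schwartz_op_def
  proof (intro conjI allI ballI S)
    fix N
    let ?A = "{bs::'a list. dirs bs \<and> length bs \<le> N}"
    have fin: "finite ?A" by (rule finite_lists_length_le) simp
    obtain M C where C: "\<And>bs. dirs bs \<Longrightarrow> 0 \<le> C bs"
      "\<And>bs f (x::'a). dirs bs \<Longrightarrow> f \<in> schwartz \<Longrightarrow>
        (1 + norm x) ^ N * norm (pderivs bs (fourier f) x) \<le> C bs * schwartz_seminorm (M bs) f"
      using ex[of _ N] by metis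
    have bound: "schwartz_seminorm N (fourier f) \<le> sum C ?A * schwartz_seminorm (sum M ?A) f"
      if f: "f \<in> schwartz" for f :: "'a \<Rightarrow> complex"
    proof (rule schwartz_seminorm_le)
      fix bs :: "'a list" and x assume bs: "dirs bs" "length bs \<le> N"
      have "(1 + norm x) ^ N * norm (pderivs bs (fourier f) x) \<le> C bs * schwartz_seminorm (M bs) f"
        by (rule C(2)[OF bs(1) f])
      also have "\<dots> \<le> sum C ?A * schwartz_seminorm (sum M ?A) f"
      proof (rule mult_mono)
        show "C bs \<le> sum C ?A" using bs fin C(1) by (intro member_le_sum) auto
        show "schwartz_seminorm (M bs) f \<le> schwartz_seminorm (sum M ?A) f"
          using bs fin by (intro schwartz_seminorm_mono f member_le_sum) auto
        show "0 \<le> sum C ?A" using C(1) by (intro sum_nonneg) auto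
        show "0 \<le> schwartz_seminorm (M bs) f" by (rule schwartz_seminorm_nonneg[OF f])
      qed
      finally show "(1 + norm x) ^ N * norm (pderivs bs (fourier f) x)
        \<le> sum C ?A * schwartz_seminorm (sum M ?A) f" .
    qed
    have pos: "0 \<le> sum C ?A" by (intro sum_nonneg C(1)) auto
    show "\<exists>M C. 0 \<le> C \<and> (\<forall>f\<in>(schwartz :: ('a \<Rightarrow> complex) set). schwartz_seminorm N (fourier f)
      \<le> C * schwartz_seminorm M f)"
      using pos bound by (intro exI[of _ "sum M ?A"] exI[of _ "sum C ?A"] conjI ballI)
  qed
qed

lemma schwartz_fourier: "f \<in> schwartz \<Longrightarrow> fourier f \<in> schwartz"
  using schwartz_op_fourier[unfolded schwartz_op_def] by blast

lemma schwartz_inv_fourier: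
  assumes "f \<in> schwartz"
  shows "inv_fourier f \<in> schwartz"
proof -
  have "inv_fourier f = (\<lambda>x. complex_of_real (1 / (2 * pi) ^ DIM('a)) * fourier f ((- 1) *\<^sub>R x))"
    by (simp add: fun_eq_iff inv_fourier_eq)
  moreover have "(\<lambda>x. complex_of_real (1 / (2 * pi) ^ DIM('a)) * fourier f ((- 1) *\<^sub>R x)) \<in> schwartz"
    by (intro schwartz_cmult schwartz_scaled schwartz_fourier assms) simp
  ultimately show ?thesis by (simp only:)
qed

lemma integral_swap_ek:
  fixes a b :: "'a::euclidean_space \<Rightarrow> complex"
  assumes a: "integrable lborel a" and b: "integrable lborel b"
  shows "(LINT \<xi>|lborel. a \<xi> * (LINT y|lborel. ek y \<xi> * b y))
    = (LINT y|lborel. b y * (LINT \<xi>|lborel. ek y \<xi> * a \<xi>))"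
    and "(LINT \<xi>|lborel. a \<xi> * (LINT y|lborel. ek y (- \<xi>) * b y))
      = (LINT y|lborel. b y * (LINT \<xi>|lborel. ek y (- \<xi>) * a \<xi>))"
proof -
  have "(\<lambda>(x::'a, y). ek y x) \<in> borel_measurable (lborel \<Otimes>\<^sub>M lborel)"
    and "(\<lambda>(x::'a, y). ek y (- x)) \<in> borel_measurable (lborel \<Otimes>\<^sub>M lborel)"
    unfolding split_beta' by measurable
  from this[THEN integral_swap_bounded_kernel[OF a b], of 1]
  show "(LINT \<xi>|lborel. a \<xi> * (LINT y|lborel. ek y \<xi> * b y))
    = (LINT y|lborel. b y * (LINT \<xi>|lborel. ek y \<xi> * a \<xi>))"
    and "(LINT \<xi>|lborel. a \<xi> * (LINT y|lborel. ek y (- \<xi>) * b y))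
      = (LINT y|lborel. b y * (LINT \<xi>|lborel. ek y (- \<xi>) * a \<xi>))"
    by simp_all
qed

lemma gcut_tendsto: "(\<lambda>n. gcut (1 / real (Suc n)) \<xi>) \<longlonglongrightarrow> 1"
proof -
  have "(\<lambda>n. 1 / real (Suc n)) \<longlonglongrightarrow> 0" using LIMSEQ_inverse_real_of_nat by (simp add: inverse_eq_divide)
  then have "(\<lambda>n. exp (- (norm ((1 / real (Suc n)) *\<^sub>R \<xi>))\<^sup>2 / 2)) \<longlonglongrightarrow> exp (- (norm (0 *\<^sub>R \<xi>))\<^sup>2 / 2)"
    by (intro tendsto_intros) auto
  then show ?thesis by (simp add: gcut_def)
qed

text \<open>
  Fourier inversion.  With the Gaussian cutoff the double integral may be exchanged and becomes the
  average of \<open>f\<close> around \<open>x\<close> against a Gaussian of width \<open>\<epsilon>\<close>.  Both sides converge by dominated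
  convergence as \<open>\<epsilon>\<close> tends to zero.
\<close>

lemma fourier_fourier:
  fixes f :: "'a::euclidean_space \<Rightarrow> complex"
  assumes f: "f \<in> schwartz"
  shows "fourier (fourier f) (- x) = (2 * pi) ^ DIM('a) * f x"
proof -
  define e where "e n = 1 / real (Suc n)" for n
  have e: "e n > 0" for n by (simp add: e_def)
  have e0: "e \<longlonglongrightarrow> 0" unfolding e_def using LIMSEQ_inverse_real_of_nat by (simp add: inverse_eq_divide)
  have fi: "integrable lborel f" and Fi: "integrable lborel (fourier f)"
    using f by (auto intro: schwartz_integrable schwartz_fourier)
  have fm[measurable]: "f \<in> borel_measurable borel" "fourier f \<in> borel_measurable borel"
    using f by (auto intro: schwartz_measurable schwartz_fourier)
  let ?a = "\<lambda>n \<xi>. ek \<xi> (- x) * complex_of_real (gcut (e n) \<xi>)"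
  let ?A = "\<lambda>n. (LINT \<xi>|lborel. ?a n \<xi> * fourier f \<xi>)"
  have A: "?A n = (2 * pi) ^ DIM('a) * (LINT z|lborel. complex_of_real (gauss z) * f (x
    + e n *\<^sub>R z))" for n
  proof -
    have ai: "integrable lborel (?a n)"
      using e[of n] integrable_gcut[of "e n"] by (intro integrable_ek integrable_of_real) auto
    have "?A n = (LINT \<xi>|lborel. ?a n \<xi> * (LINT y|lborel. ek y \<xi> * f y))" by (simp add: fourier_ek)
    also have "\<dots> = (LINT y|lborel. f y * (LINT \<xi>|lborel. ek y \<xi> * ?a n \<xi>))"
      by (rule integral_swap_ek(1)[OF ai fi])
    also have "(\<lambda>y. LINT \<xi>|lborel. ek y \<xi> * ?a n \<xi>) = (\<lambda>y. complex_of_real (gker (e n) (y - x)))"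
    proof
      fix y
      have "ek y \<xi> * ?a n \<xi> = ek \<xi> (y - x) * complex_of_real (gcut (e n) \<xi>)" for \<xi>
        using ek_add(2)[of \<xi> y "- x"] by (simp add: ek_commute[of y \<xi>])
      then show "(LINT \<xi>|lborel. ek y \<xi> * ?a n \<xi>) = complex_of_real (gker (e n) (y - x))"
        using fourier_gcut[OF e, of n "y - x"] by (simp only: fourier_ek)
    qed
    also have "(LINT y|lborel. f y * complex_of_real (gker (e n) (y - x)))
      = \<bar>e n\<bar> ^ DIM('a) *\<^sub>R (LINT z|lborel. f (x + e n *\<^sub>R z) * complex_of_real (gker (e n) (x + e n *\<^sub>R z - x)))"
      using e[of n] by (intro lborel_integral_affine) auto
    also have "(\<lambda>z. f (x + e n *\<^sub>R z) * complex_of_real (gker (e n) (x + e n *\<^sub>R z - x)))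
       = (\<lambda>z. complex_of_real ((2 * pi) ^ DIM('a) / e n ^ DIM('a)) * (complex_of_real (gauss z) * f (x + e n *\<^sub>R z)))"
      using e[of n] by (simp add: gker_def fun_eq_iff)
    finally show ?thesis using e[of n]
      by (simp only: integral_mult_right_zero) (simp add: scaleR_conv_of_real)
  qed
  have lim1: "?A \<longlonglongrightarrow> (LINT \<xi>|lborel. ek \<xi> (- x) * complex_of_real 1 * fourier f \<xi>)"
  proof (rule integral_dominated_convergence[where w="\<lambda>\<xi>. norm (fourier f \<xi>)"])
    show "AE \<xi> in lborel. (\<lambda>n. ?a n \<xi> * fourier f \<xi>) \<longlonglongrightarrow> ek \<xi> (- x) * complex_of_real 1 * fourier f \<xi>"
      unfolding e_def by (intro AE_I2 tendsto_mult tendsto_const tendsto_of_real gcut_tendsto)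
    show "AE \<xi> in lborel. norm (?a n \<xi> * fourier f \<xi>) \<le> norm (fourier f \<xi>)" for n
      by (intro AE_I2) (simp add: norm_mult abs_of_pos mult_left_le_one_le less_imp_le gcut_bounds)
  qed (use Fi in auto)
  have lim2: "(\<lambda>n. LINT z|lborel. complex_of_real (gauss z) * f (x + e n *\<^sub>R z))
    \<longlonglongrightarrow> (LINT z|lborel. complex_of_real (gauss z) * f (x + 0 *\<^sub>R z))"
  proof (rule integral_dominated_convergence[where w="\<lambda>z. gauss z * schwartz_seminorm 0 f"])
    show "integrable lborel (\<lambda>z. gauss z * schwartz_seminorm 0 f)"
      by (intro integrable_mult_left integrable_gauss)
    have "isCont f y" for y
      using smooth_continuous[OF schwartz_smooth[OF f]] by (simp add: continuous_on_eq_continuous_at)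
    then show "AE z in lborel. (\<lambda>n. complex_of_real (gauss z) * f (x + e n *\<^sub>R z))
      \<longlonglongrightarrow> complex_of_real (gauss z) * f (x + 0 *\<^sub>R z)"
      by (intro AE_I2 tendsto_mult tendsto_const isCont_tendsto_compose[of _ f] tendsto_add tendsto_scaleR e0)
    show "AE z in lborel. norm (complex_of_real (gauss z) * f (x + e n *\<^sub>R z))
      \<le> gauss z * schwartz_seminorm 0 f" for n
      using schwartz_seminorm_bound[OF f, of "[]" 0]
      by (intro AE_I2) (auto simp: norm_mult abs_of_nonneg gauss_nonneg intro!: mult_left_mono)
  qed auto
  have "(LINT z|lborel. complex_of_real (gauss z) * f (x + 0 *\<^sub>R z))
    = complex_of_real (integral\<^sup>L lborel (gauss :: 'a \<Rightarrow> real)) * f x"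
    by simp
  then have "?A \<longlonglongrightarrow> (2 * pi) ^ DIM('a) * f x"
    unfolding A using lim2 by (auto simp: integral_gauss intro!: tendsto_mult)
  from LIMSEQ_unique[OF lim1 this] show ?thesis by (simp add: fourier_ek)
qed

lemma inv_fourier_fourier:
  fixes f :: "'a::euclidean_space \<Rightarrow> complex"
  shows "f \<in> schwartz \<Longrightarrow> inv_fourier (fourier f) = f"
  by (simp add: fun_eq_iff inv_fourier_eq fourier_fourier)

lemma fourier_reflect:
  fixes f :: "'a::euclidean_space \<Rightarrow> complex"
  assumes "f \<in> borel_measurable borel"
  shows "fourier (\<lambda>x. f (- x)) \<xi> = fourier f (- \<xi>)"
proof -
  have [measurable]: "f \<in> borel_measurable borel" by fact
  have "(LINT x|lborel. ek x (- \<xi>) * f x)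
    = \<bar>- 1\<bar> ^ DIM('a) *\<^sub>R (LINT x|lborel. ek (0 + (- 1) *\<^sub>R x) (- \<xi>) * f (0 + (- 1) *\<^sub>R x))"
    by (intro lborel_integral_affine) auto
  then show ?thesis by (simp add: fourier_ek ek_uminus)
qed

lemma fourier_inv_fourier:
  fixes f :: "'a::euclidean_space \<Rightarrow> complex"
  assumes f: "f \<in> schwartz"
  shows "fourier (inv_fourier f) = f"
proof
  fix x
  have "fourier (inv_fourier f) x = complex_of_real (1 / (2 * pi) ^ DIM('a))
    * fourier (\<lambda>y. fourier f (- y)) x"
    unfolding inv_fourier_eq[abs_def] by (rule fourier_cmult)
  then show "fourier (inv_fourier f) x = f x"
    by (simp add: fourier_reflect fourier_fourier f schwartz_measurable schwartz_fourier)
qed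

lemma inv_fourier_pd:
  assumes f: "f \<in> schwartz" and b: "b \<in> Basis"
  shows "inv_fourier (pd b f) = (\<lambda>x. - \<i> * complex_of_real (x \<bullet> b) * inv_fourier f x)"
  by (simp add: fun_eq_iff inv_fourier_eq fourier_pd[OF f b])

abbreviation energy :: "('a::euclidean_space \<Rightarrow> complex) \<Rightarrow> ennreal" where
  "energy f \<equiv> \<integral>\<^sup>+x. ennreal ((norm (f x))\<^sup>2) \<partial>lborel"

text \<open>
  Schur's test: a product is at most half the sum of the squares, and the kernel has the same mass
  in each variable.
\<close>

lemma gker_bessel_bound:
  fixes p :: "'a::euclidean_space \<Rightarrow> complex"
  assumes pm[measurable]: "p \<in> borel_measurable borel" and e: "\<epsilon> > 0"
  shows "(\<integral>\<^sup>+x. (\<integral>\<^sup>+y. ennreal (norm (p x) * norm (p y) * gker \<epsilon> (x - y)) \<partial>lborel) \<partial>lborel)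
    \<le> ennreal ((2 * pi) ^ DIM('a)) * (energy p)"
proof -
  let ?D = "ennreal ((2 * pi) ^ DIM('a))" and ?I = "energy p"
  have g1: "(\<integral>\<^sup>+y. ennreal (gker \<epsilon> (x - y)) \<partial>lborel) = ?D" for x :: 'a
    using nn_integral_gker[OF e, of "- x"] gker_uminus[of \<epsilon> "x - _"] by (simp add: algebra_simps)
  have g2: "(\<integral>\<^sup>+x. ennreal (gker \<epsilon> (x - y)) \<partial>lborel) = ?D" for y :: 'a
    using nn_integral_gker[OF e, of "- y"] by (simp add: algebra_simps)
  have half: "norm (p x) * norm (p y) \<le> (norm (p x))\<^sup>2 / 2 + (norm (p y))\<^sup>2 / 2" for x y
    using sum_squares_bound[of "norm (p x)" "norm (p y)"] by simp
  have "ennreal (norm (p x) * norm (p y) * gker \<epsilon> (x - y))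
    \<le> ennreal ((norm (p x))\<^sup>2 / 2) * ennreal (gker \<epsilon> (x - y)) + ennreal ((norm (p y))\<^sup>2 / 2) * ennreal (gker \<epsilon> (x - y))" for x y
  proof -
    have g: "0 \<le> gker \<epsilon> (x - y)" by (rule gker_nonneg[OF e])
    have "ennreal (norm (p x) * norm (p y) * gker \<epsilon> (x - y))
      \<le> ennreal (((norm (p x))\<^sup>2 / 2 + (norm (p y))\<^sup>2 / 2) * gker \<epsilon> (x - y))"
      by (intro ennreal_leI mult_right_mono half g)
    also have "\<dots> = ennreal ((norm (p x))\<^sup>2 / 2) * ennreal (gker \<epsilon> (x - y))
      + ennreal ((norm (p y))\<^sup>2 / 2) * ennreal (gker \<epsilon> (x - y))"
      using g by (subst (1 2) ennreal_mult[symmetric]) (auto simp: ring_distribs)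
    finally show ?thesis .
  qed
  then have "(\<integral>\<^sup>+x. (\<integral>\<^sup>+y. ennreal (norm (p x) * norm (p y) * gker \<epsilon> (x - y)) \<partial>lborel) \<partial>lborel)
    \<le> (\<integral>\<^sup>+x. (\<integral>\<^sup>+y. ennreal ((norm (p x))\<^sup>2 / 2) * ennreal (gker \<epsilon> (x - y)) + ennreal ((norm (p y))\<^sup>2 / 2) * ennreal (gker \<epsilon> (x - y)) \<partial>lborel) \<partial>lborel)"
    by (intro nn_integral_mono) auto
  also have "\<dots> = (\<integral>\<^sup>+x. (\<integral>\<^sup>+y. ennreal ((norm (p x))\<^sup>2 / 2) * ennreal (gker \<epsilon> (x - y)) \<partial>lborel) \<partial>lborel)
      + (\<integral>\<^sup>+x. (\<integral>\<^sup>+y. ennreal ((norm (p y))\<^sup>2 / 2) * ennreal (gker \<epsilon> (x - y)) \<partial>lborel) \<partial>lborel)"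
  proof -
    have "(\<integral>\<^sup>+y. ennreal ((norm (p x))\<^sup>2 / 2) * ennreal (gker \<epsilon> (x - y))
      + ennreal ((norm (p y))\<^sup>2 / 2) * ennreal (gker \<epsilon> (x - y)) \<partial>lborel)
      = (\<integral>\<^sup>+y. ennreal ((norm (p x))\<^sup>2 / 2) * ennreal (gker \<epsilon> (x - y)) \<partial>lborel)
      + (\<integral>\<^sup>+y. ennreal ((norm (p y))\<^sup>2 / 2) * ennreal (gker \<epsilon> (x - y)) \<partial>lborel)" for x
      by (rule nn_integral_add) measurable
    then show ?thesis by (simp only:) (rule nn_integral_add; measurable)
  qed
  also have "(\<integral>\<^sup>+x. (\<integral>\<^sup>+y. ennreal ((norm (p x))\<^sup>2 / 2) * ennreal (gker \<epsilon> (x - y)) \<partial>lborel) \<partial>lborel)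
    = ?D * (\<integral>\<^sup>+x. ennreal ((norm (p x))\<^sup>2 / 2) \<partial>lborel)"
    by (simp add: nn_integral_cmult g1 nn_integral_multc mult.commute)
  also have "(\<integral>\<^sup>+x. (\<integral>\<^sup>+y. ennreal ((norm (p y))\<^sup>2 / 2) * ennreal (gker \<epsilon> (x - y)) \<partial>lborel) \<partial>lborel)
      = (\<integral>\<^sup>+y. (\<integral>\<^sup>+x. ennreal ((norm (p y))\<^sup>2 / 2) * ennreal (gker \<epsilon> (x - y)) \<partial>lborel) \<partial>lborel)"
    by (rule lborel_pair.Fubini') measurable
  also have "\<dots> = ?D * (\<integral>\<^sup>+x. ennreal ((norm (p x))\<^sup>2 / 2) \<partial>lborel)"
    by (simp add: nn_integral_cmult g2 nn_integral_multc mult.commute)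
  also have "?D * (\<integral>\<^sup>+x. ennreal ((norm (p x))\<^sup>2 / 2) \<partial>lborel)
    + ?D * (\<integral>\<^sup>+x. ennreal ((norm (p x))\<^sup>2 / 2) \<partial>lborel) = ?D * ?I"
    by (simp flip: distrib_left nn_integral_add ennreal_plus)
  finally show ?thesis .
qed

lemma norm_LINT_le_nn_integral:
  fixes f :: "'a \<Rightarrow> complex"
  shows "ennreal (norm (LINT x|M. f x)) \<le> (\<integral>\<^sup>+x. ennreal (norm (f x)) \<partial>M)"
  by (cases "integrable M f") (auto intro: integral_norm_bound_ennreal simp: not_integrable_integral_eq)

text \<open>
  With the Gaussian cutoff the energy of the transform is a double integral of \<open>p\<close> and its conjugate
  against the kernel \<open>gker\<close>, which Schur's test bounds; Fatou's lemma removes the cutoff.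
\<close>

lemma fourier_bessel:
  fixes p :: "'a::euclidean_space \<Rightarrow> complex"
  assumes p: "integrable lborel p"
  shows "(energy (fourier p))
    \<le> ennreal ((2 * pi) ^ DIM('a)) * (energy p)" (is "_ \<le> ?B")
proof -
  have pm[measurable]: "p \<in> borel_measurable borel" using p by (simp add: integrable_iff_bounded)
  have pc: "integrable lborel (\<lambda>x. cnj (p x))" using p by simp
  let ?P = "LINT x|lborel. norm (p x)"
  have cut: "(\<integral>\<^sup>+\<xi>. ennreal ((norm (fourier p \<xi>))\<^sup>2 * gcut \<epsilon> \<xi>) \<partial>lborel) \<le> ?B" if e: "\<epsilon> > 0" for \<epsilon>
  proof -
    let ?g = "\<lambda>\<xi>. complex_of_real (gcut \<epsilon> \<xi>)"
    let ?h = "\<lambda>\<xi>. cnj (fourier p \<xi>) * ?g \<xi>"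
    have gi: "integrable lborel ?g" using integrable_gcut[of \<epsilon>] e by (intro integrable_of_real) auto
    have [measurable]: "(\<lambda>\<xi>. cnj (fourier p \<xi>)) \<in> borel_measurable borel"
      by (rule borel_measurable_continuous_on[of cnj]) (auto intro: continuous_intros)
    have hi: "integrable lborel ?h"
    proof (rule Bochner_Integration.integrable_bound)
      show "integrable lborel (\<lambda>\<xi>. ?P * gcut \<epsilon> \<xi> :: real)"
        using e by (intro integrable_mult_right integrable_gcut) auto
      show "AE \<xi> in lborel. norm (?h \<xi>) \<le> norm (?P * gcut \<epsilon> \<xi>)"
      proof (rule AE_I2)
        fix \<xi>
        have "norm (fourier p \<xi>) * gcut \<epsilon> \<xi> \<le> ?P * gcut \<epsilon> \<xi>"
          using gcut_bounds(1)[of \<epsilon> \<xi>] by (intro mult_right_mono norm_fourier_le) auto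
        then show "norm (?h \<xi>) \<le> norm (?P * gcut \<epsilon> \<xi>)"
          using gcut_bounds(1)[of \<epsilon> \<xi>] by (auto simp: norm_mult abs_of_pos intro: order_trans[OF _ abs_ge_self])
      qed
    qed measurable
    have inner: "(LINT \<xi>|lborel. ek x \<xi> * ?h \<xi>)
      = (LINT y|lborel. cnj (p y) * complex_of_real (gker \<epsilon> (x - y)))" for x
    proof -
      have cF: "cnj (fourier p \<xi>) = (LINT y|lborel. ek y (- \<xi>) * cnj (p y))" for \<xi>
        unfolding fourier_ek by (subst Bochner_Integration.integral_cnj[symmetric]) (simp add: ek_uminus(2))
      have "(LINT \<xi>|lborel. ek x \<xi> * ?h \<xi>)
        = (LINT \<xi>|lborel. (ek x \<xi> * ?g \<xi>) * (LINT y|lborel. ek y (- \<xi>) * cnj (p y)))"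
        unfolding cF by (simp only: mult_ac)
      also have "\<dots> = (LINT y|lborel. cnj (p y) * (LINT \<xi>|lborel. ek y (- \<xi>) * (ek x \<xi> * ?g \<xi>)))"
        by (rule integral_swap_ek(2)[OF _ pc]) (use integrable_ek[OF gi, of x] in \<open>simp add: ek_commute[of x]\<close>)
      also have "(\<lambda>y. LINT \<xi>|lborel. ek y (- \<xi>) * (ek x \<xi> * ?g \<xi>))
        = (\<lambda>y. complex_of_real (gker \<epsilon> (x - y)))"
      proof
        fix y
        have "ek y (- \<xi>) * (ek x \<xi> * ?g \<xi>) = ek \<xi> (x - y) * ?g \<xi>" for \<xi>
          using ek_add(2)[of \<xi> x "- y"] ek_uminus(1)[of y \<xi>] by (simp add: ek_commute[of _ \<xi>] ek_commute[of y])
        then show "(LINT \<xi>|lborel. ek y (- \<xi>) * (ek x \<xi> * ?g \<xi>)) = complex_of_real (gker \<epsilon> (x - y))"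
          using fourier_gcut[OF e, of "x - y"] by (simp only: fourier_ek)
      qed
      finally show ?thesis .
    qed
    have main: "(LINT \<xi>|lborel. ?h \<xi> * fourier p \<xi>)
      = (LINT x|lborel. p x * (LINT y|lborel. cnj (p y) * complex_of_real (gker \<epsilon> (x - y))))"
    proof -
      have "(LINT \<xi>|lborel. ?h \<xi> * fourier p \<xi>) = (LINT x|lborel. p x * (LINT \<xi>|lborel. ek x \<xi> * ?h \<xi>))"
        unfolding fourier_ek[of p] by (rule integral_swap_ek(1)[OF hi[unfolded fourier_ek[of p]] p])
      then show ?thesis by (simp only: inner)
    qed
    have sq: "?h \<xi> * fourier p \<xi> = complex_of_real ((norm (fourier p \<xi>))\<^sup>2 * gcut \<epsilon> \<xi>)" for \<xi>
      by (simp add: complex_norm_square mult_ac del: of_real_power)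
    have hi2: "integrable lborel (\<lambda>\<xi>. (norm (fourier p \<xi>))\<^sup>2 * gcut \<epsilon> \<xi>)"
    proof (rule Bochner_Integration.integrable_bound)
      show "integrable lborel (\<lambda>\<xi>. ?P\<^sup>2 * gcut \<epsilon> \<xi> :: real)"
        using e by (intro integrable_mult_right integrable_gcut) auto
      show "AE \<xi> in lborel. norm ((norm (fourier p \<xi>))\<^sup>2 * gcut \<epsilon> \<xi>) \<le> norm (?P\<^sup>2 * gcut \<epsilon> \<xi>)"
      proof (rule AE_I2)
        fix \<xi>
        have "(norm (fourier p \<xi>))\<^sup>2 * gcut \<epsilon> \<xi> \<le> ?P\<^sup>2 * gcut \<epsilon> \<xi>"
          using gcut_bounds(1)[of \<epsilon> \<xi>] by (intro mult_right_mono power_mono norm_fourier_le) auto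
        then show "norm ((norm (fourier p \<xi>))\<^sup>2 * gcut \<epsilon> \<xi>) \<le> norm (?P\<^sup>2 * gcut \<epsilon> \<xi>)"
          using gcut_bounds(1)[of \<epsilon> \<xi>] by (simp add: abs_mult abs_of_pos)
      qed
    qed measurable
    have nn: "0 \<le> (norm (fourier p \<xi>))\<^sup>2 * gcut \<epsilon> \<xi>" for \<xi> using gcut_bounds(1)[of \<epsilon> \<xi>] by simp
    have "(\<integral>\<^sup>+\<xi>. ennreal ((norm (fourier p \<xi>))\<^sup>2 * gcut \<epsilon> \<xi>) \<partial>lborel)
      = ennreal (LINT \<xi>|lborel. (norm (fourier p \<xi>))\<^sup>2 * gcut \<epsilon> \<xi>)"
      using nn by (intro nn_integral_eq_integral hi2) auto
    also have "\<dots> \<le> ennreal (norm (LINT \<xi>|lborel. ?h \<xi> * fourier p \<xi>))"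
    proof -
      have "(LINT \<xi>|lborel. ?h \<xi> * fourier p \<xi>)
        = complex_of_real (LINT \<xi>|lborel. (norm (fourier p \<xi>))\<^sup>2 * gcut \<epsilon> \<xi>)"
        unfolding sq by (rule integral_complex_of_real)
      then show ?thesis by (simp only: norm_of_real) (intro ennreal_leI abs_ge_self)
    qed
    also have "\<dots> \<le> (\<integral>\<^sup>+x. ennreal (norm (p x * (LINT y|lborel. cnj (p y)
      * complex_of_real (gker \<epsilon> (x - y))))) \<partial>lborel)"
      unfolding main by (rule norm_LINT_le_nn_integral)
    also have "\<dots> \<le> (\<integral>\<^sup>+x. (\<integral>\<^sup>+y. ennreal (norm (p x) * norm (p y) * gker \<epsilon> (x - y)) \<partial>lborel) \<partial>lborel)"
    proof (rule nn_integral_mono)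
      fix x
      have "ennreal (norm (p x * (LINT y|lborel. cnj (p y) * complex_of_real (gker \<epsilon> (x - y)))))
         \<le> ennreal (norm (p x)) * (\<integral>\<^sup>+y. ennreal (norm (cnj (p y) * complex_of_real (gker \<epsilon> (x - y)))) \<partial>lborel)"
        unfolding norm_mult[of "p x"] by (subst ennreal_mult) (auto intro!: mult_left_mono norm_LINT_le_nn_integral)
      also have "\<dots> = (\<integral>\<^sup>+y. ennreal (norm (p x) * norm (p y) * gker \<epsilon> (x - y)) \<partial>lborel)"
        by (simp add: norm_mult ennreal_mult' abs_of_nonneg gker_nonneg[OF e] mult.assoc flip: nn_integral_cmult)
      finally show "ennreal (norm (p x * (LINT y|lborel. cnj (p y) * complex_of_real (gker \<epsilon> (x - y)))))
        \<le> (\<integral>\<^sup>+y. ennreal (norm (p x) * norm (p y) * gker \<epsilon> (x - y)) \<partial>lborel)" .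
    qed
    also have "\<dots> \<le> ?B" by (rule gker_bessel_bound[OF pm e])
    finally show ?thesis .
  qed
  have "(energy (fourier p))
     = (\<integral>\<^sup>+\<xi>. liminf (\<lambda>n. ennreal ((norm (fourier p \<xi>))\<^sup>2 * gcut (1 / real (Suc n)) \<xi>)) \<partial>lborel)"
  proof (rule nn_integral_cong)
    fix \<xi>
    have "(\<lambda>n. ennreal ((norm (fourier p \<xi>))\<^sup>2 * gcut (1 / real (Suc n)) \<xi>))
      \<longlonglongrightarrow> ennreal ((norm (fourier p \<xi>))\<^sup>2 * 1)"
      by (intro tendsto_ennrealI tendsto_mult tendsto_const gcut_tendsto)
    then show "ennreal ((norm (fourier p \<xi>))\<^sup>2)
      = liminf (\<lambda>n. ennreal ((norm (fourier p \<xi>))\<^sup>2 * gcut (1 / real (Suc n)) \<xi>))"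
      by (simp add: lim_imp_Liminf)
  qed
  also have "\<dots> \<le> liminf (\<lambda>n. \<integral>\<^sup>+\<xi>. ennreal ((norm (fourier p \<xi>))\<^sup>2
    * gcut (1 / real (Suc n)) \<xi>) \<partial>lborel)"
    by (rule nn_integral_liminf) measurable
  also have "\<dots> \<le> liminf (\<lambda>n::nat. ?B)"
    by (intro Liminf_mono always_eventually allI cut) simp
  also have "\<dots> = ?B" by (simp add: Liminf_const)
  finally show ?thesis .
qed

section \<open>Bounded symbols, uniform boundedness and Taylor series\<close>

abbreviation "bd_range \<equiv> {f. bounded (range f)}"

lemma bd_range_add:
  fixes f g :: "'a \<Rightarrow> complex"
  shows "f \<in> bd_range \<Longrightarrow> g \<in> bd_range \<Longrightarrow> (\<lambda>x. f x + g x) \<in> bd_range"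
  by (auto intro: bounded_plus_comp)

lemma bd_range_mult:
  fixes f g :: "'a \<Rightarrow> complex"
  shows "f \<in> bd_range \<Longrightarrow> g \<in> bd_range \<Longrightarrow> (\<lambda>x. f x * g x) \<in> bd_range"
proof -
  assume "f \<in> bd_range" "g \<in> bd_range"
  then obtain A B where "\<And>x. norm (f x) \<le> A" "\<And>x. norm (g x) \<le> B" by (auto simp: bounded_iff)
  then have "norm (f x * g x) \<le> A * B" for x
    unfolding norm_mult by (meson mult_mono norm_ge_zero order_trans)
  then show ?thesis by (auto simp: bounded_iff)
qed

lemma iter_diff_const: "iter_diff n bd_range (\<lambda>_::'a::euclidean_space. c :: complex)"
  by (induction n arbitrary: c) (auto simp: pd_def)

lemmas iter_diff_bd_add = iter_diff_add[of bd_range, OF bd_range_add]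
lemmas iter_diff_bd_mult = iter_diff_mult[of bd_range, OF bd_range_add bd_range_mult]

text \<open>
  The symbol of \<open>P\<close>.
\<close>

definition bessel_symbol :: "'a::euclidean_space \<Rightarrow> real" where
  "bessel_symbol \<xi> = 1 / (1 + (norm \<xi>)\<^sup>2)"

text \<open>
  Let \<open>w\<close> be the symbol and \<open>q\<^sub>b = \<xi>\<^sub>b w\<close>.  These functions are bounded, and
  \<open>\<partial>\<^sub>c w = - 2 q\<^sub>c w\<close> and \<open>\<partial>\<^sub>c q\<^sub>b = \<delta>\<^sub>b\<^sub>c w - 2 q\<^sub>b q\<^sub>c\<close>, so the algebra that they generate is
  closed under differentiation.
\<close>

lemma bounded_derivs_bessel_symbol:
  "bounded_derivs (\<lambda>\<xi>::'a::euclidean_space. complex_of_real (bessel_symbol \<xi>))"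
proof -
  let ?w = "\<lambda>\<xi>::'a. complex_of_real (bessel_symbol \<xi>)"
  let ?q = "\<lambda>b (\<xi>::'a). complex_of_real ((\<xi> \<bullet> b) * bessel_symbol \<xi>)"
  have pos: "1 + (norm \<xi>)\<^sup>2 > 0" for \<xi> :: 'a by (simp add: add_pos_nonneg)
  have d: "((\<lambda>\<xi>. bessel_symbol \<xi>) has_derivative (\<lambda>h. - 2 * (\<xi> \<bullet> h)
    * (bessel_symbol \<xi>)\<^sup>2)) (at \<xi>)" for \<xi> :: 'a
    unfolding bessel_symbol_def power2_norm_eq_inner
    using pos[of \<xi>, unfolded power2_norm_eq_inner]
    by (auto intro!: derivative_eq_intros simp: power2_norm_eq_inner power2_eq_square inner_commute field_simps fun_eq_iff)
  have dw: "(?w has_derivative (\<lambda>h. complex_of_real (- 2 * (\<xi> \<bullet> h)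
    * (bessel_symbol \<xi>)\<^sup>2))) (at \<xi>)" for \<xi> :: 'a
    by (rule bounded_linear.has_derivative[OF bounded_linear_of_real d])
  have dq: "(?q b has_derivative (\<lambda>h. complex_of_real ((\<xi> \<bullet> b) * (- 2 * (\<xi> \<bullet> h)
    * (bessel_symbol \<xi>)\<^sup>2) + (h \<bullet> b) * bessel_symbol \<xi>))) (at \<xi>)" for \<xi> b :: 'a
    by (rule bounded_linear.has_derivative[OF bounded_linear_of_real], rule derivative_eq_intros, (auto intro!: derivative_eq_intros d)[2]) auto
  have pw: "pd c ?w = (\<lambda>\<xi>. (- 2) * (?q c \<xi> * ?w \<xi>))" for c
    unfolding pd_eqI[OF dw] by (simp add: fun_eq_iff power2_eq_square)
  have pq: "pd c (?q b) = (\<lambda>\<xi>. complex_of_real (c \<bullet> b) * ?w \<xi> + (- 2) * (?q b \<xi> * ?q c \<xi>))" for b c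
    unfolding pd_eqI[OF dq] by (simp add: fun_eq_iff power2_eq_square)
  have bw: "norm (?w \<xi>) \<le> 1" for \<xi> :: 'a
    unfolding norm_of_real bessel_symbol_def using pos[of \<xi>] by simp
  have bq: "norm (?q b \<xi>) \<le> 1" if "b \<in> Basis" for b \<xi> :: 'a
  proof -
    have "\<bar>\<xi> \<bullet> b\<bar> \<le> norm \<xi>" using that by (rule Basis_le_norm)
    also have "norm \<xi> \<le> 1 + (norm \<xi>)\<^sup>2"
    proof -
      have "0 \<le> (norm \<xi> - 1)\<^sup>2" by simp
      also have "(norm \<xi> - 1)\<^sup>2 = (norm \<xi>)\<^sup>2 - 2 * norm \<xi> + 1" by (simp add: power2_diff)
      finally show ?thesis using norm_ge_zero[of \<xi>] by linarith
    qed
    finally show ?thesis unfolding norm_of_real using pos[of \<xi>] by (simp add: bessel_symbol_def abs_mult)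
  qed
  have "iter_diff n bd_range ?w \<and> (\<forall>b\<in>Basis. iter_diff n bd_range (?q b))" for n
  proof (induction n)
    case 0
    show ?case using bw bq by (auto simp: bounded_iff)
  next
    case (Suc n)
    have b: "?w \<in> bd_range" "\<forall>b\<in>Basis. ?q b \<in> bd_range" using bw bq by (auto simp: bounded_iff)
    show ?case unfolding iter_diff.simps(2) pw pq
      using b Suc differentiable_onI_has[OF dw] differentiable_onI_has[OF dq]
      by (intro conjI ballI iter_diff_bd_add iter_diff_bd_mult iter_diff_const) auto
  qed
  then show ?thesis by (simp add: bounded_derivs_def)
qed

text \<open>
  The symbol of \<open>- \<Delta> P\<close>.
\<close>

definition symbol :: "'a::euclidean_space \<Rightarrow> real" where
  "symbol \<xi> = (norm \<xi>)\<^sup>2 / (1 + (norm \<xi>)\<^sup>2)"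

lemma symbol_eq: "symbol \<xi> = 1 - bessel_symbol \<xi>"
proof -
  have "1 + (norm \<xi>)\<^sup>2 \<noteq> 0" using zero_le_power2[of "norm \<xi>"] by linarith
  then show ?thesis by (simp add: symbol_def bessel_symbol_def field_simps)
qed

lemma bounded_derivs_power:
  assumes "bounded_derivs a"
  shows "\<exists>R\<ge>0. \<forall>n. \<forall>f\<in>schwartz. (\<lambda>x. a x ^ n * f x) \<in> schwartz \<and>
    schwartz_seminorm N (\<lambda>x. a x ^ n * f x) \<le> R ^ n * schwartz_seminorm N f"
proof -
  obtain R where R: "R \<ge> 0" "\<And>f. f \<in> schwartz \<Longrightarrow>
    schwartz_seminorm N (\<lambda>x. a x * f x) \<le> R * schwartz_seminorm N f"
    using bounded_derivs_seminorm[OF assms] by blast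
  have "(\<lambda>x. a x ^ n * f x) \<in> schwartz \<and> schwartz_seminorm N (\<lambda>x. a x ^ n * f x)
    \<le> R ^ n * schwartz_seminorm N f"
    if "f \<in> schwartz" for n f
  proof (induction n)
    case (Suc n)
    then have S: "(\<lambda>x. a x ^ n * f x) \<in> schwartz" by simp
    have "schwartz_seminorm N (\<lambda>x. a x * (a x ^ n * f x)) \<le> R * schwartz_seminorm N (\<lambda>x. a x ^ n * f x)"
      by (rule R(2)[OF S])
    also have "\<dots> \<le> R * (R ^ n * schwartz_seminorm N f)" using Suc R(1) by (intro mult_left_mono) auto
    finally show ?case using bounded_derivs_mult_schwartz[OF assms S] by (simp add: mult.assoc)
  qed (use that in simp)
  then show ?thesis using R(1) by blast
qed

text \<open>
  In each seminorm the powers of \<open>a\<close> cost a factor \<open>R^n\<close>, so every power series in \<open>a\<close> with infinite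
  radius of convergence acts on the Schwartz space, and tempered distributions may be applied term
  by term.
\<close>

lemma schwartz_entire_multiplier:
  assumes a: "bounded_derivs a" and f: "f \<in> schwartz"
    and c: "\<And>R. R \<ge> 0 \<Longrightarrow> summable (\<lambda>n. norm (c n) * R ^ n)"
  shows "(\<lambda>x. \<Sum>n. c n * (a x ^ n * f x)) \<in> schwartz" (is ?A)
    and "T \<in> tempered \<Longrightarrow> (\<lambda>n. c n * T (\<lambda>x. a x ^ n * f x)) sums T (\<lambda>x. \<Sum>n. c n * (a x ^ n * f x))"
    and "T \<in> tempered \<Longrightarrow> summable (\<lambda>n. norm (c n * T (\<lambda>x. a x ^ n * f x)))"
proof -
  have S: "(\<lambda>x. a x ^ n * f x) \<in> schwartz" for n using bounded_derivs_power[OF a] f by blast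
  have g: "(\<lambda>x. c n * (a x ^ n * f x)) \<in> schwartz" for n by (rule schwartz_cmult[OF S])
  have s: "summable (\<lambda>n. norm (c n) * schwartz_seminorm N (\<lambda>x. a x ^ n * f x))" for N
  proof -
    obtain R where R: "R \<ge> 0" "\<And>n. schwartz_seminorm N (\<lambda>x. a x ^ n * f x)
      \<le> R ^ n * schwartz_seminorm N f"
      using bounded_derivs_power[OF a, of N] f by blast
    show ?thesis
    proof (rule summable_comparison_test')
      show "summable (\<lambda>n. (norm (c n) * R ^ n) * schwartz_seminorm N f)"
        by (intro summable_mult2 c R)
      show "norm (norm (c n) * schwartz_seminorm N (\<lambda>x. a x ^ n * f x))
        \<le> (norm (c n) * R ^ n) * schwartz_seminorm N f" for n
        using mult_left_mono[OF R(2), of "norm (c n)" n] schwartz_seminorm_nonneg[OF S]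
        by (simp add: abs_of_nonneg mult.assoc)
    qed
  qed
  have s': "summable (\<lambda>n. schwartz_seminorm N (\<lambda>x. c n * (a x ^ n * f x)))" for N
    by (rule summable_comparison_test'[OF s[of N]])
       (simp add: schwartz_seminorm_nonneg g schwartz_seminorm_cmult[OF S])
  show ?A by (rule schwartz_series(1)[OF g s'])
  assume T: "T \<in> tempered"
  show "(\<lambda>n. c n * T (\<lambda>x. a x ^ n * f x)) sums T (\<lambda>x. \<Sum>n. c n * (a x ^ n * f x))"
    using tempered_series[OF T g s'] by (simp add: tempered_cmult[OF T S])
  obtain N C where C: "C \<ge> 0" "\<And>f. f \<in> schwartz \<Longrightarrow> norm (T f) \<le> C * schwartz_seminorm N f"
    by (rule tempered_bound[OF T], rule that)
  show "summable (\<lambda>n. norm (c n * T (\<lambda>x. a x ^ n * f x)))"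
  proof (rule summable_comparison_test')
    show "summable (\<lambda>n. C * (norm (c n) * schwartz_seminorm N (\<lambda>x. a x ^ n * f x)))"
      by (intro summable_mult s)
    show "norm (norm (c n * T (\<lambda>x. a x ^ n * f x)))
      \<le> C * (norm (c n) * schwartz_seminorm N (\<lambda>x. a x ^ n * f x))" for n
      using mult_left_mono[OF C(2)[OF S], of "norm (c n)" n] by (simp add: norm_mult mult_ac)
  qed
qed

text \<open>
  A Cauchy sequence of bounded sequences converges uniformly.
\<close>

lemma complete_bounded_sequences: "uniform_space_class.complete (UNIV :: (nat \<Rightarrow>\<^sub>C complex) set)"
  unfolding complete_def
proof safe
  fix f :: "nat \<Rightarrow> nat \<Rightarrow>\<^sub>C complex"
  assume "Cauchy f"
  then obtain g where "uniform_limit UNIV f g sequentially"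
    using uniformly_convergent_eq_cauchy[of "\<lambda>_. True" f]
    unfolding Cauchy_def uniform_limit_sequentially_iff
    by (metis dist_fun_lt_imp_dist_val_lt)
  from uniform_limit_bcontfunE[OF this sequentially_bot] show "\<exists>l\<in>UNIV. f \<longlonglongrightarrow> l"
    by (metis UNIV_I)
qed

text \<open>
  The Baire argument of Banach and Steinhaus in the space of bounded sequences.  The second hypothesis
  covers that space by the closed sets \<open>E K\<close>, one of which contains a ball; moving its centre in a
  single coordinate isolates the corresponding term.
\<close>

lemma uniform_boundedness_sequences:
  fixes h :: "nat \<Rightarrow> 'i \<Rightarrow> complex"
  assumes s: "\<And>t. t \<in> A \<Longrightarrow> summable (\<lambda>n. norm (h n t))"
    and b: "\<And>b. bounded (range b) \<Longrightarrow> bounded ((\<lambda>t. \<Sum>n. b n * h n t) ` A)"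
  shows "\<exists>B. \<forall>n. \<forall>t\<in>A. norm (h n t) \<le> B"
proof -
  define F where "F t x = (\<Sum>n. apply_bcontfun x n * h n t)" for t and x :: "nat \<Rightarrow>\<^sub>C complex"
  have sF: "summable (\<lambda>n. apply_bcontfun x n * h n t)" if "t \<in> A" for t x
  proof (rule summable_comparison_test'[where N=0])
    show "summable (\<lambda>n. norm x * norm (h n t))" by (intro summable_mult s that)
    show "norm (apply_bcontfun x n * h n t) \<le> norm x * norm (h n t)" for n
      unfolding norm_mult by (intro mult_right_mono norm_bounded) auto
  qed
  have linF: "bounded_linear (F t)" if t: "t \<in> A" for t
  proof (rule bounded_linear_intro)
    show "F t (x + y) = F t x + F t y" for x y
      by (simp add: F_def ring_distribs suminf_add[OF sF[OF t] sF[OF t]])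
    show "F t (r *\<^sub>R x) = r *\<^sub>R F t x" for r x
      by (simp add: F_def suminf_scaleR_right[OF sF[OF t]])
    show "norm (F t x) \<le> norm x * (\<Sum>n. norm (h n t))" for x
    proof -
      have "norm (F t x) \<le> (\<Sum>n. norm x * norm (h n t))"
        unfolding F_def
        by (rule norm_suminf_le) (auto simp: norm_mult intro!: mult_right_mono norm_bounded summable_mult s t)
      then show ?thesis by (simp add: suminf_mult s t)
    qed
  qed
  define E where "E K = {x. \<forall>t\<in>A. norm (F t x) \<le> real K}" for K :: nat
  have clE: "closed (E K)" for K
  proof -
    have "E K = (\<Inter>t\<in>A. {x. norm (F t x) \<le> real K})" by (auto simp: E_def)
    moreover have "closed {x. norm (F t x) \<le> real K}" if "t \<in> A" for t
      using linear_continuous_on[OF linF[OF that], of UNIV]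
      by (intro closed_Collect_le continuous_intros)
    ultimately show ?thesis by (auto intro: closed_INT)
  qed
  have cover: "\<Union>(range E) = UNIV"
  proof -
    have "\<exists>K. x \<in> E K" for x
    proof -
      have "bounded ((\<lambda>t. F t x) ` A)" unfolding F_def by (rule b) simp
      then obtain M where "\<And>t. t \<in> A \<Longrightarrow> norm (F t x) \<le> M" by (auto simp: bounded_iff)
      moreover obtain K :: nat where "M \<le> real K" using real_arch_simple by blast
      ultimately show ?thesis by (auto simp: E_def intro: order_trans)
    qed
    then show ?thesis by auto
  qed
  have "\<exists>K. interior (E K) \<noteq> {}"
  proof (rule ccontr)
    assume no: "\<nexists>K. interior (E K) \<noteq> {}"
    have "Met_TC.mtopology interior_of \<Union>(range E) = {}"
    proof (rule Met_TC.metric_Baire_category_alt)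
      show "Met_TC.mcomplete TYPE(nat \<Rightarrow>\<^sub>C complex)"
        unfolding mcomplete_iff_complete by (rule complete_bounded_sequences)
    qed (use clE no in auto)
    then show False unfolding cover by simp
  qed
  then obtain K x r where r: "r > 0" "ball x r \<subseteq> E K"
    by (metis all_not_in_conv mem_interior)
  have "norm (h n t) \<le> 4 * real K / r" if t: "t \<in> A" for n t
  proof -
    \<comment> \<open>A displacement of the centre that stays inside the ball.\<close>
    define e where "e = (\<lambda>k. if k = n then complex_of_real (r / 2) else 0)"
    have e: "e \<in> bcontfun" by (auto simp: bcontfun_def e_def bounded_iff intro!: exI[of _ "\<bar>r\<bar>"])
    define y where "y = Bcontfun e"
    have y: "apply_bcontfun y = e" by (simp add: y_def Bcontfun_inverse e)
    have "norm y \<le> r / 2" using r by (intro norm_bound) (auto simp: y e_def)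
    then have "norm y < r" using r(1) by linarith
    then have "x + y \<in> ball x r" by (simp add: dist_norm)
    then have 1: "norm (F t (x + y)) \<le> real K" using r t by (auto simp: E_def)
    have "x \<in> ball x r" using r by simp
    then have 2: "norm (F t x) \<le> real K" using subsetD[OF r(2)] t by (simp add: E_def)
    have "F t y = (\<Sum>k. if k = n then complex_of_real (r / 2) * h n t else 0)"
      unfolding F_def y by (intro suminf_cong) (auto simp: e_def)
    also have "\<dots> = complex_of_real (r / 2) * h n t"
      using sums_unique[OF sums_single[of n "\<lambda>_. complex_of_real (r / 2)
        * h n t"]] by (simp add: eq_commute[of _ n])
    finally have "complex_of_real (r / 2) * h n t = F t (x + y) - F t x"
      using linF[OF t] by (simp add: bounded_linear.linear linear_add)
    then have "r / 2 * norm (h n t) = norm (F t (x + y) - F t x)"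
      using r by (metis abs_of_pos half_gt_zero norm_mult norm_of_real)
    also have "\<dots> \<le> 2 * real K" using norm_triangle_ineq4[of "F t (x + y)" "F t x"] 1 2 by simp
    finally show ?thesis using r by (simp add: pos_le_divide_eq mult.commute)
  qed
  then show ?thesis by blast
qed

text \<open>
  The weight \<open>sqrt(n!)\<close> beats every geometric growth and is itself beaten by \<open>n!\<close>; both facts are
  needed, the first for the functions to which uniform boundedness is applied and the second for the
  Taylor remainder.
\<close>

lemma summable_power_over_sqrt_fact:
  assumes "R \<ge> 0"
  shows "summable (\<lambda>n. R ^ n / sqrt (fact n))"
proof -
  obtain N :: nat where N: "(2 * R)\<^sup>2 \<le> real N" using real_arch_simple by blast
  show ?thesis
  proof (rule summable_ratio_test[where c="1/2" and N=N])
    fix n assume n: "N \<le> n"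
    have "2 * R \<le> sqrt (real (Suc n))" using N n assms by (intro real_le_rsqrt) simp
    moreover have "sqrt (real (Suc n)) > 0" "sqrt (fact n) > 0" by simp_all
    ultimately have "R / sqrt (real (Suc n)) \<le> 1/2" by (simp add: pos_divide_le_eq)
    then have "R / sqrt (real (Suc n)) * (R ^ n / sqrt (fact n)) \<le> 1/2 * (R ^ n / sqrt (fact n))"
      using assms by (intro mult_right_mono) auto
    moreover have "sqrt (fact (Suc n)) = sqrt (real (Suc n)) * sqrt (fact n)"
      by (simp only: fact_Suc real_sqrt_mult of_nat_mult)
    ultimately show "norm (R ^ Suc n / sqrt (fact (Suc n))) \<le> 1/2 * norm (R ^ n / sqrt (fact n))"
      using assms by (simp add: abs_mult del: fact_Suc)
  qed simp
qed

text \<open>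
  Consider the Taylor polynomial with centre \<open>\<tau>\<close> evaluated at \<open>t\<close>.  As a function of \<open>\<tau>\<close> its
  derivative telescopes to the last term, which tends to zero by the bound on \<open>H\<close>.
\<close>

lemma taylor_of_derivative_chain:
  fixes H :: "nat \<Rightarrow> real \<Rightarrow> complex"
  assumes cont: "\<And>n. continuous_on {0..t} (H n)"
    and der: "\<And>n \<tau>. 0 < \<tau> \<Longrightarrow> \<tau> < t \<Longrightarrow> (H n has_vector_derivative H (Suc n) \<tau>) (at \<tau>)"
    and bd: "\<And>n \<tau>. 0 \<le> \<tau> \<Longrightarrow> \<tau> \<le> t \<Longrightarrow> norm (H n \<tau>) \<le> B * sqrt (fact n)"
    and t: "t > 0"
  shows "(\<lambda>n. (t ^ n / fact n) *\<^sub>R H n 0) sums H 0 t"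
proof -
  define G where "G N \<tau> = (\<Sum>n<N. ((t - \<tau>) ^ n / fact n) *\<^sub>R H n \<tau>)" for N \<tau>
  have derG: "(G (Suc N) has_vector_derivative ((t - \<tau>) ^ N / fact N) *\<^sub>R H (Suc N) \<tau>) (at \<tau>)"
    if "0 < \<tau>" "\<tau> < t" for N \<tau>
  proof (induction N)
    case 0
    show ?case unfolding G_def using der[OF that, of 0] by simp
  next
    case (Suc N)
    have p: "((\<lambda>\<tau>. (t - \<tau>) ^ Suc N / fact (Suc N)) has_vector_derivative - ((t - \<tau>) ^ N / fact N)) (at \<tau>)"
      unfolding has_real_derivative_iff_has_vector_derivative[symmetric]
      by (auto intro!: derivative_eq_intros simp del: power_Suc simp: divide_simps)
    have "((\<lambda>\<tau>. G (Suc N) \<tau> + ((t - \<tau>) ^ Suc N / fact (Suc N)) *\<^sub>R H (Suc N) \<tau>) has_vector_derivative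
      ((t - \<tau>) ^ N / fact N) *\<^sub>R H (Suc N) \<tau> + (((t - \<tau>) ^ Suc N / fact (Suc N)) *\<^sub>R H (Suc (Suc N)) \<tau> + (- ((t - \<tau>) ^ N / fact N)) *\<^sub>R H (Suc N) \<tau>)) (at \<tau>)"
      by (intro has_vector_derivative_add Suc.IH has_vector_derivative_scaleR der that)
         (use p in \<open>simp add: has_real_derivative_iff_has_vector_derivative\<close>)
    then show ?case by (simp add: G_def del: power_Suc fact_Suc)
  qed
  have bound: "norm (H 0 t - G (Suc N) 0) \<le> t * (t ^ N / fact N * (B * sqrt (fact (Suc N))))" for N
  proof -
    have "\<exists>x\<in>{0<..<t}. norm (G (Suc N) t - G (Suc N) 0)
      \<le> norm ((t - 0) *\<^sub>R (((t - x) ^ N / fact N) *\<^sub>R H (Suc N) x))"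
    proof (rule mvt_general[OF t])
      show "continuous_on {0..t} (G (Suc N))" unfolding G_def by (intro continuous_intros cont) auto
      show "(G (Suc N) has_derivative (\<lambda>h. h *\<^sub>R (((t - x) ^ N / fact N) *\<^sub>R H (Suc N) x))) (at x)" if "0 < x" "x < t" for x
        using derG[OF that] by (simp add: has_vector_derivative_def)
    qed
    then obtain x where x: "0 < x" "x < t"
      and le: "norm (G (Suc N) t - G (Suc N) 0) \<le> t * ((t - x) ^ N / fact N * norm (H (Suc N) x))"
      using t by (auto simp: abs_mult)
    have "(t - x) ^ N / fact N * norm (H (Suc N) x) \<le> t ^ N / fact N * (B * sqrt (fact (Suc N)))"
      using x bd[of x "Suc N"] by (intro mult_mono divide_right_mono power_mono) auto
    then have "t * ((t - x) ^ N / fact N * norm (H (Suc N) x))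
      \<le> t * (t ^ N / fact N * (B * sqrt (fact (Suc N))))"
      using t by (intro mult_left_mono) auto
    moreover have "G (Suc N) t = H 0 t"
      unfolding G_def by (subst sum.lessThan_Suc_shift) simp
    ultimately show ?thesis using le by simp
  qed
  have lim: "(\<lambda>N. t * (t ^ N / fact N * (B * sqrt (fact (Suc N))))) \<longlonglongrightarrow> 0"
  proof -
    \<comment> \<open>As \<open>N! = sqrt((N + 1)!)\<^sup>2 / (N + 1)\<close>, the remainder is of the order
      \<open>n t^n / sqrt(n!)\<close> with \<open>n = N + 1\<close>.\<close>
    have "t * (t ^ N / fact N * (B * sqrt (fact (Suc N))))
      = B * (t ^ Suc N * real (Suc N) / sqrt (fact (Suc N)))" for N
    proof -
      have f: "sqrt (fact (Suc N)) * sqrt (fact (Suc N)) = (fact (Suc N) :: real)" by simp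
      have "(fact N :: real) = fact (Suc N) / real (Suc N)" by simp
      also have "\<dots> = sqrt (fact (Suc N)) * sqrt (fact (Suc N)) / real (Suc N)" by (simp only: f)
      finally have "fact N = sqrt (fact (Suc N)) * sqrt (fact (Suc N)) / real (Suc N)" .
      then show ?thesis by (simp only:) (simp del: fact_Suc of_nat_Suc add: field_simps)
    qed
    moreover have "(\<lambda>N. t ^ N * real N / sqrt (fact N)) \<longlonglongrightarrow> 0"
    proof (rule Lim_null_comparison[OF always_eventually])
      show "(\<lambda>N. (2 * t) ^ N / sqrt (fact N)) \<longlonglongrightarrow> 0"
        using t by (intro summable_LIMSEQ_zero summable_power_over_sqrt_fact) auto
      show "\<forall>N. norm (t ^ N * real N / sqrt (fact N)) \<le> (2 * t) ^ N / sqrt (fact N)"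
      proof
        fix N
        have "real N \<le> 2 ^ N" using of_nat_less_two_power[of N, where 'a=real] by simp
        then have "t ^ N * real N \<le> t ^ N * 2 ^ N" using t by (intro mult_left_mono) auto
        then show "norm (t ^ N * real N / sqrt (fact N)) \<le> (2 * t) ^ N / sqrt (fact N)"
          using t by (simp add: power_mult_distrib divide_right_mono mult.commute abs_mult)
      qed
    qed
    ultimately show ?thesis
      using tendsto_mult_right_zero[OF LIMSEQ_Suc[of "\<lambda>N. t ^ N
        * real N / sqrt (fact N)" 0], of B] by simp
  qed
  have "(\<lambda>N. H 0 t - G (Suc N) 0) \<longlonglongrightarrow> 0"
    by (rule Lim_null_comparison[OF always_eventually lim]) (use bound in auto)
  then have "(\<lambda>N. H 0 t - (H 0 t - G (Suc N) 0)) \<longlonglongrightarrow> H 0 t - 0" by (intro tendsto_intros)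
  then have "(\<lambda>N. G (Suc N) 0) \<longlonglongrightarrow> H 0 t" by simp
  then have "(\<lambda>N. G N 0) \<longlonglongrightarrow> H 0 t" by (rule LIMSEQ_imp_Suc)
  then show ?thesis by (simp add: sums_def G_def)
qed

section \<open>The solution formula and frequency localization\<close>

lemma tempered_fourier:
  assumes T: "T \<in> tempered"
  shows "(\<lambda>\<phi>. T (fourier \<phi>)) \<in> tempered"
proof -
  have add: "fourier (\<lambda>x. f x + g x) = (\<lambda>\<xi>. fourier f \<xi>
    + fourier g \<xi>)" if "f \<in> schwartz" "g \<in> schwartz" for f g :: "'a \<Rightarrow> complex"
    using that by (intro ext fourier_add schwartz_integrable)
  have cm: "fourier (\<lambda>x. c * f x) = (\<lambda>\<xi>. c * fourier f \<xi>)" for c and f :: "'a \<Rightarrow> complex"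
    by (intro ext fourier_cmult)
  obtain N C where C: "C \<ge> 0" "\<And>f. f \<in> schwartz \<Longrightarrow> norm (T f) \<le> C * schwartz_seminorm N f"
    by (rule tempered_bound[OF T], rule that)
  obtain M D where D: "D \<ge> 0" "\<And>f::'a \<Rightarrow> complex. f \<in> schwartz \<Longrightarrow>
    schwartz_seminorm N (fourier f) \<le> D * schwartz_seminorm M f"
    using schwartz_op_fourier[where 'a='a] unfolding schwartz_op_def by meson
  have "norm (T (fourier f)) \<le> (C * D) * schwartz_seminorm M f" if "f \<in> schwartz" for f
  proof -
    have "norm (T (fourier f)) \<le> C * schwartz_seminorm N (fourier f)" by (intro C schwartz_fourier that)
    also have "\<dots> \<le> C * (D * schwartz_seminorm M f)" by (intro mult_left_mono D C that)
    finally show ?thesis by (simp add: mult.assoc)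
  qed
  then have "\<exists>N C. \<forall>f\<in>schwartz. norm (T (fourier f)) \<le> C * schwartz_seminorm N f" by blast
  then show ?thesis
    unfolding tempered_def mem_Collect_eq
    by (intro conjI ballI allI)
       (simp_all add: add cm tempered_add[OF T] tempered_cmult[OF T] schwartz_fourier)
qed

lemma fourier_multiplier_eq:
  "fourier_multiplier m T \<psi> = T (fourier (\<lambda>\<xi>. complex_of_real (m \<xi>) * inv_fourier \<psi> \<xi>))"
  by (simp add: fourier_multiplier_def inv_fourier_distr_def mult_distr_def fourier_distr_def)

lemma inv_fourier_sum:
  assumes "\<And>i. i \<in> I \<Longrightarrow> integrable lborel (f i)"
  shows "inv_fourier (\<lambda>x. \<Sum>i\<in>I. f i x) \<xi> = (\<Sum>i\<in>I. inv_fourier (f i) \<xi>)"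
  using assms by (simp add: inv_fourier_eq fourier_sum sum_distrib_left)

lemma inv_fourier_laplacian:
  fixes f :: "'a::euclidean_space \<Rightarrow> complex"
  assumes f: "f \<in> schwartz"
  shows "inv_fourier (laplacian f) \<xi> = - complex_of_real ((norm \<xi>)\<^sup>2) * inv_fourier f \<xi>"
proof -
  have "inv_fourier (laplacian f) \<xi> = (\<Sum>b\<in>Basis. inv_fourier (pd b (pd b f)) \<xi>)"
    unfolding laplacian_def[abs_def]
    by (simp add: inv_fourier_sum schwartz_integrable schwartz_pd f)
  also have "\<dots> = (\<Sum>b\<in>Basis. - complex_of_real ((\<xi> \<bullet> b)\<^sup>2) * inv_fourier f \<xi>)"
    by (intro sum.cong refl) (simp add: inv_fourier_pd schwartz_pd f power2_eq_square algebra_simps)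
  finally show ?thesis by (simp add: norm_sq_coords sum_negf flip: sum_distrib_right)
qed

text \<open>
  Both operators act on the test function, where two partial derivatives become
  \<open>- |\<xi>|\<^sup>2\<close> on the Fourier side.
\<close>

lemma laplacian_P_op:
  fixes \<psi> :: "'a::euclidean_space \<Rightarrow> complex"
  assumes "\<psi> \<in> schwartz"
  shows "laplacian_distr (P_op T) \<psi> = T (fourier (\<lambda>\<xi>. - complex_of_real (symbol \<xi>) * inv_fourier \<psi> \<xi>))"
  unfolding laplacian_distr_def P_op_def fourier_multiplier_eq
  by (simp add: inv_fourier_laplacian assms symbol_def mult.assoc)

lemma bounded_derivs_neg_symbol:
  "bounded_derivs (\<lambda>\<xi>::'a::euclidean_space. - complex_of_real (symbol \<xi>))"
proof -
  have "(\<lambda>\<xi>::'a. - complex_of_real (symbol \<xi>)) = (\<lambda>\<xi>. complex_of_real (bessel_symbol \<xi>) + - 1)"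
    by (simp add: fun_eq_iff symbol_eq)
  moreover have "iter_diff n bd_range (\<lambda>\<xi>::'a. complex_of_real (bessel_symbol \<xi>))" for n
    using bounded_derivs_bessel_symbol[where 'a='a] by (simp add: bounded_derivs_def)
  ultimately show ?thesis unfolding bounded_derivs_def
    by (simp only:) (intro allI iter_diff_bd_add iter_diff_const)
qed

lemma exp_multiplier_series:
  fixes z f :: complex
  shows "(\<Sum>n. (complex_of_real t ^ n / fact n) * (z ^ n * f)) = exp (complex_of_real t * z) * f"
proof -
  have "(\<lambda>n. ((complex_of_real t * z) ^ n /\<^sub>R fact n) * f) sums (exp (complex_of_real t * z) * f)"
    by (intro sums_mult2 exp_converges)
  then show ?thesis
    by (simp add: sums_iff scaleR_conv_of_real power_mult_distrib divide_inverse mult_ac)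
qed

lemma summable_exp_coeffs: "summable (\<lambda>n. norm (complex_of_real t ^ n / fact n) * R ^ n)"
proof -
  have "summable (\<lambda>n. inverse (fact n) * (\<bar>t\<bar> * R) ^ n)" by (rule summable_exp)
  then show ?thesis by (simp add: norm_mult norm_inverse norm_power power_mult_distrib divide_inverse mult_ac)
qed

text \<open>
  The exponential series of \<open>- t m\<close>.
\<close>

lemma heat_multiplier:
  fixes f :: "'a::euclidean_space \<Rightarrow> complex"
  assumes f: "f \<in> schwartz"
  shows "(\<lambda>\<xi>. complex_of_real (exp (- t * symbol \<xi>)) * f \<xi>) \<in> schwartz"
    and "T \<in> tempered \<Longrightarrow> (\<lambda>n. (complex_of_real t ^ n / fact n)
      * T (\<lambda>\<xi>. (- complex_of_real (symbol \<xi>)) ^ n * f \<xi>))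
      sums T (\<lambda>\<xi>. complex_of_real (exp (- t * symbol \<xi>)) * f \<xi>)"
proof -
  have eq: "(\<lambda>\<xi>. \<Sum>n. (complex_of_real t ^ n / fact n) * ((- complex_of_real (symbol \<xi>)) ^ n * f \<xi>))
     = (\<lambda>\<xi>. complex_of_real (exp (- t * symbol \<xi>)) * f \<xi>)"
    unfolding exp_multiplier_series by (simp add: exp_of_real[symmetric])
  note E = schwartz_entire_multiplier[OF bounded_derivs_neg_symbol f summable_exp_coeffs[of t], unfolded eq]
  show "(\<lambda>\<xi>. complex_of_real (exp (- t * symbol \<xi>)) * f \<xi>) \<in> schwartz" by (rule E(1))
  assume "T \<in> tempered"
  then show "(\<lambda>n. (complex_of_real t ^ n / fact n) * T (\<lambda>\<xi>. (- complex_of_real (symbol \<xi>)) ^ n * f \<xi>))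
      sums T (\<lambda>\<xi>. complex_of_real (exp (- t * symbol \<xi>)) * f \<xi>)" by (rule E(2))
qed

text \<open>
  Uniqueness for the diagonal equation.  The values \<open>H n\<close> of the curve on \<open>(- m)^n \<phi>\<close> form a chain
  of derivatives in time.  For a bounded sequence \<open>b\<close> the sum of \<open>b\<^sub>n H n / sqrt(n!)\<close> is the value of
  the curve on one Schwartz function, so it is continuous and hence bounded on \<open>[0, t]\<close>.  Uniform
  boundedness then bounds \<open>H n / sqrt(n!)\<close> there, and Taylor's formula applies.
\<close>

lemma evolution_fourier_side:
  fixes v :: "real \<Rightarrow> 'a::euclidean_space functional"
  assumes temp: "\<And>\<tau>. 0 \<le> \<tau> \<Longrightarrow> v \<tau> \<in> tempered"
    and cont: "\<And>\<phi>. \<phi> \<in> schwartz \<Longrightarrow> continuous_on {0..} (\<lambda>\<tau>. v \<tau> \<phi>)"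
    and der: "\<And>\<phi> \<tau>. \<phi> \<in> schwartz \<Longrightarrow> \<tau> > 0 \<Longrightarrow>
      ((\<lambda>\<tau>. v \<tau> \<phi>) has_vector_derivative v \<tau> (\<lambda>\<xi>. - complex_of_real (symbol \<xi>) * \<phi> \<xi>)) (at \<tau>)"
    and \<phi>: "\<phi> \<in> schwartz" and t: "t > 0"
  shows "v t \<phi> = v 0 (\<lambda>\<xi>. complex_of_real (exp (- t * symbol \<xi>)) * \<phi> \<xi>)"
proof -
  let ?a = "\<lambda>\<xi>::'a. - complex_of_real (symbol \<xi>)"
  define H where "H n \<tau> = v \<tau> (\<lambda>\<xi>. ?a \<xi> ^ n * \<phi> \<xi>)" for n \<tau>
  have S: "(\<lambda>\<xi>. ?a \<xi> ^ n * \<phi> \<xi>) \<in> schwartz" for n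
    using bounded_derivs_power[OF bounded_derivs_neg_symbol] \<phi> by blast
  have Hcont: "continuous_on {0..t} (H n)" for n
    unfolding H_def by (rule continuous_on_subset[OF cont[OF S]]) auto
  have Hder: "(H n has_vector_derivative H (Suc n) \<tau>) (at \<tau>)" if "\<tau> > 0" for n \<tau>
    using der[OF S that, of n] by (simp add: H_def[abs_def] mult.assoc)
  have coeffs: "summable (\<lambda>n. norm (b n / complex_of_real (sqrt (fact n))) * R ^ n)"
    if bdd: "bounded (range b)" and R: "R \<ge> 0" for b :: "nat \<Rightarrow> complex" and R
  proof -
    obtain M where M: "\<And>n. norm (b n) \<le> M" using bdd by (auto simp: bounded_iff)
    show ?thesis
    proof (rule summable_comparison_test')
      show "summable (\<lambda>n. M * (R ^ n / sqrt (fact n)))"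
        by (intro summable_mult summable_power_over_sqrt_fact R)
      show "norm (norm (b n / complex_of_real (sqrt (fact n))) * R ^ n)
        \<le> M * (R ^ n / sqrt (fact n))" for n
        using mult_right_mono[OF M, of "R ^ n / sqrt (fact n)" n] R
        by (simp add: norm_divide abs_mult)
    qed
  qed
  note E = schwartz_entire_multiplier[OF bounded_derivs_neg_symbol \<phi> coeffs]
  have "\<exists>B. \<forall>n. \<forall>\<tau>\<in>{0..t}. norm (H n \<tau> / complex_of_real (sqrt (fact n))) \<le> B"
  proof (rule uniform_boundedness_sequences)
    fix \<tau> assume \<tau>: "\<tau> \<in> {0..t}"
    show "summable (\<lambda>n. norm (H n \<tau> / complex_of_real (sqrt (fact n))))"
      using E(3)[of "\<lambda>_. 1", OF _ _ temp[of \<tau>]] \<tau> by (simp add: H_def norm_divide norm_mult)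
  next
    fix b :: "nat \<Rightarrow> complex" assume b: "bounded (range b)"
    let ?\<Phi> = "\<lambda>\<xi>. \<Sum>n. b n / complex_of_real (sqrt (fact n)) * (?a \<xi> ^ n * \<phi> \<xi>)"
    have "(\<Sum>n. b n * (H n \<tau> / complex_of_real (sqrt (fact n)))) = v \<tau> ?\<Phi>" if "\<tau> \<in> {0..t}" for \<tau>
      using E(2)[OF b _ temp[of \<tau>]] that by (simp add: H_def sums_iff)
    then have "(\<lambda>\<tau>. \<Sum>n. b n * (H n \<tau> / complex_of_real (sqrt (fact n)))) ` {0..t}
      = (\<lambda>\<tau>. v \<tau> ?\<Phi>) ` {0..t}"
      by (rule image_cong[OF refl])
    moreover have "compact ((\<lambda>\<tau>. v \<tau> ?\<Phi>) ` {0..t})"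
      by (rule compact_continuous_image[OF continuous_on_subset[OF cont[OF E(1)[OF b]]]]) auto
    ultimately show "bounded ((\<lambda>\<tau>. \<Sum>n. b n * (H n \<tau> / complex_of_real (sqrt (fact n)))) ` {0..t})"
      by (simp only: compact_imp_bounded)
  qed
  then obtain B where B: "\<And>n \<tau>. \<tau> \<in> {0..t} \<Longrightarrow>
    norm (H n \<tau> / complex_of_real (sqrt (fact n))) \<le> B" by blast
  have "(\<lambda>n. (t ^ n / fact n) *\<^sub>R H n 0) sums H 0 t"
  proof (rule taylor_of_derivative_chain[where B=B])
    show "continuous_on {0..t} (H n)" for n by (rule Hcont)
    show "(H n has_vector_derivative H (Suc n) \<tau>) (at \<tau>)" if "0 < \<tau>" for n \<tau> by (rule Hder[OF that])
    show "t > 0" by (rule t)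
    show "norm (H n \<tau>) \<le> B * sqrt (fact n)" if "0 \<le> \<tau>" "\<tau> \<le> t" for n \<tau>
      using B[of \<tau> n] that by (simp add: norm_divide pos_divide_le_eq)
  qed
  moreover have "(t ^ n / fact n) *\<^sub>R H n 0
    = (complex_of_real t ^ n / fact n) * v 0 (\<lambda>\<xi>. ?a \<xi> ^ n * \<phi> \<xi>)" for n
    by (simp add: H_def scaleR_conv_of_real)
  ultimately have "(\<lambda>n. (complex_of_real t ^ n / fact n) * v 0 (\<lambda>\<xi>. ?a \<xi> ^ n * \<phi> \<xi>)) sums H 0 t" by simp
  from sums_unique2[OF this heat_multiplier(2)[OF \<phi> temp]] show ?thesis by (simp add: H_def)
qed

lemma solution_formula:
  fixes \<psi> :: "'a::euclidean_space \<Rightarrow> complex"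
  assumes sol: "solves_linear u u0" and \<psi>: "\<psi> \<in> schwartz" and t: "t \<ge> 0"
  shows "u t \<psi> = u0 (fourier (\<lambda>\<xi>. complex_of_real (exp (- t * symbol \<xi>)) * inv_fourier \<psi> \<xi>))"
proof -
  let ?\<Phi> = "\<lambda>\<xi>. complex_of_real (exp (- t * symbol \<xi>)) * inv_fourier \<psi> \<xi>"
  have u: "\<And>\<tau>. \<tau> \<ge> 0 \<Longrightarrow> u \<tau> \<in> tempered" "\<And>\<psi>. \<psi> \<in> schwartz \<Longrightarrow> u 0 \<psi> = u0 \<psi>"
    "\<And>\<psi>. \<psi> \<in> schwartz \<Longrightarrow> continuous_on {0..} (\<lambda>t. u t \<psi>)"
    using sol by (auto simp: solves_linear_def)
  have der: "((\<lambda>\<tau>. u \<tau> (fourier \<phi>)) has_vector_derivative u \<tau> (fourier (\<lambda>\<xi>. - complex_of_real (symbol \<xi>) * \<phi> \<xi>))) (at \<tau>)"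
    if \<phi>: "\<phi> \<in> schwartz" and \<tau>: "\<tau> > 0" for \<phi> \<tau>
  proof -
    obtain D where "((\<lambda>\<tau>. u \<tau> (fourier \<phi>)) has_vector_derivative D) (at \<tau>)"
      "D - laplacian_distr (P_op (u \<tau>)) (fourier \<phi>) = 0"
      using sol schwartz_fourier[OF \<phi>] \<tau> unfolding solves_linear_def by blast
    then show ?thesis
      using \<phi> by (simp add: laplacian_P_op schwartz_fourier inv_fourier_fourier)
  qed
  have "u t (fourier (inv_fourier \<psi>)) = u 0 (fourier ?\<Phi>)"
  proof (cases "t = 0")
    case False
    show ?thesis
    proof (rule evolution_fourier_side[of "\<lambda>\<tau> \<phi>. u \<tau> (fourier \<phi>)"])
      show "(\<lambda>\<phi>. u \<tau> (fourier \<phi>)) \<in> tempered" if "0 \<le> \<tau>" for \<tau>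
        by (rule tempered_fourier[OF u(1)[OF that]])
      show "continuous_on {0..} (\<lambda>\<tau>. u \<tau> (fourier \<phi>))" if "\<phi> \<in> schwartz" for \<phi>
        by (rule u(3)[OF schwartz_fourier[OF that]])
      show "inv_fourier \<psi> \<in> schwartz" by (rule schwartz_inv_fourier[OF \<psi>])
      show "t > 0" using t False by simp
    qed (rule der)
  qed simp
  moreover have "fourier ?\<Phi> \<in> schwartz"
    by (intro schwartz_fourier heat_multiplier schwartz_inv_fourier \<psi>)
  ultimately show ?thesis by (simp add: fourier_inv_fourier \<psi> u)
qed

text \<open>
  The derivatives also vanish outside the ball, and on the ball they are bounded by compactness.
\<close>

lemma schwartz_compact_support:
  fixes f :: "'a::euclidean_space \<Rightarrow> complex"
  assumes sm: "smooth f" and supp: "\<And>x. R < norm x \<Longrightarrow> f x = 0"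
  shows "f \<in> schwartz"
proof (rule schwartzI[OF sm])
  fix N and bs :: "'a list" assume bs: "dirs bs"
  have cont: "continuous_on UNIV (pderivs bs f)"
    by (intro smooth_continuous smooth_pderivs sm bs)
  have "compact ((\<lambda>x. (1 + norm x) ^ N *\<^sub>R pderivs bs f x) ` cball 0 R)"
    by (intro compact_continuous_image continuous_intros continuous_on_subset[OF cont]) auto
  then obtain B where "\<forall>x\<in>cball 0 R. (1 + norm x) ^ N * norm (pderivs bs f x) \<le> B"
    by (auto simp: bounded_iff dest!: compact_imp_bounded)
  then have B: "(1 + norm x) ^ N * norm (pderivs bs f x) \<le> B" if "norm x \<le> R" for x
    using that by simp
  have "open {x::'a. R < norm x}" by (intro open_Collect_less continuous_intros)
  then have z: "pderivs bs f x = 0" if "R < norm x" for x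
    using pderivs_eq_0_on_open[of "{x. R < norm x}" f x bs] supp that by auto
  have "(1 + norm x) ^ N * norm (pderivs bs f x) \<le> max B 0" for x
    using B[of x] z[of x] by (cases "norm x \<le> R") (auto simp: max_def)
  then show "\<exists>B. \<forall>x. (1 + norm x) ^ N * norm (pderivs bs f x) \<le> B" by blast
qed

lemma cutoff_schwartz:
  assumes "lp_cutoff chi" "c \<noteq> 0"
  shows "(\<lambda>\<xi>. complex_of_real (chi (c *\<^sub>R \<xi>))) \<in> schwartz"
proof -
  have "(\<lambda>\<xi>. complex_of_real (chi \<xi>)) \<in> schwartz"
  proof (rule schwartz_compact_support[where R="4/3"])
    show "smooth (\<lambda>\<xi>. complex_of_real (chi \<xi>))"
      using assms by (intro smooth_linear[OF bounded_linear_of_real]) (simp add: lp_cutoff_def)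
  qed (use assms in \<open>auto simp: lp_cutoff_def\<close>)
  from schwartz_scaled[OF this assms(2)] show ?thesis .
qed

definition lp_window :: "('a::euclidean_space \<Rightarrow> real) \<Rightarrow> int \<Rightarrow> 'a \<Rightarrow> real" where
  "lp_window chi k \<xi> = lp_phi chi ((2 powi (- k)) *\<^sub>R \<xi>)"

text \<open>
  A window equal to one on the annulus of \<open>lp_window\<close>.  It vanishes near the origin, which is what
  allows the symbol to be bounded from below on its support.
\<close>

definition lp_fat_window :: "('a::euclidean_space \<Rightarrow> real) \<Rightarrow> int \<Rightarrow> 'a \<Rightarrow> real" where
  "lp_fat_window chi k \<xi> = chi ((2 powi (- k) / 4) *\<^sub>R \<xi>) - chi ((2 powi (- k) * 2) *\<^sub>R \<xi>)"

lemma lp_window_schwartz: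
  assumes "lp_cutoff chi"
  shows "(\<lambda>\<xi>. complex_of_real (lp_window chi k \<xi>)) \<in> schwartz"
    and "(\<lambda>\<xi>. complex_of_real (lp_fat_window chi k \<xi>)) \<in> schwartz"
  using schwartz_diff[OF cutoff_schwartz[OF assms, of "2 powi (- k) / 2"] cutoff_schwartz[OF assms, of "2 powi (- k)"]]
    schwartz_diff[OF cutoff_schwartz[OF assms, of "2 powi (- k) / 4"] cutoff_schwartz[OF assms, of "2 powi (- k) * 2"]]
  by (simp_all add: lp_window_def lp_phi_def lp_fat_window_def)

lemma cutoff_eq_1: "lp_cutoff chi \<Longrightarrow> norm \<xi> < 3/4 \<Longrightarrow> chi \<xi> = 1"
  and cutoff_eq_0: "lp_cutoff chi \<Longrightarrow> norm \<xi> \<ge> 4/3 \<Longrightarrow> chi \<xi> = 0"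
  and cutoff_range: "lp_cutoff chi \<Longrightarrow> 0 \<le> chi \<xi> \<and> chi \<xi> \<le> 1"
  by (auto simp: lp_cutoff_def) (meson atLeastAtMost_iff range_subsetD)+

text \<open>
  With \<open>\<zeta> = 2^(- k) \<xi>\<close>, the window lives on \<open>3/4 \<le> |\<zeta>| < 8/3\<close>.  There \<open>|\<zeta>| / 4 < 3/4\<close> and
  \<open>2 |\<zeta>| \<ge> 4/3\<close>.
\<close>

lemma lp_window_absorb:
  assumes chi: "lp_cutoff chi"
  shows "lp_window chi k \<xi> * lp_fat_window chi k \<xi> = lp_window chi k \<xi>"
proof -
  let ?z = "(2 powi (- k)) *\<^sub>R \<xi>"
  have w: "lp_window chi k \<xi> = chi ((1/2) *\<^sub>R ?z) - chi ?z"
    and fw: "lp_fat_window chi k \<xi> = chi ((1/4) *\<^sub>R ?z) - chi (2 *\<^sub>R ?z)"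
    by (simp_all add: lp_window_def lp_phi_def lp_fat_window_def mult.commute)
  consider "norm ?z < 3/4" | "norm ?z \<ge> 8/3" | "3/4 \<le> norm ?z" "norm ?z < 8/3" by linarith
  then show ?thesis
  proof cases
    case 1
    then have "norm ((1/2) *\<^sub>R ?z) < 3/4" unfolding norm_scaleR using norm_ge_zero[of ?z] by linarith
    then have "chi ((1/2) *\<^sub>R ?z) = 1" "chi ?z = 1"
      using 1 by (simp_all only: cutoff_eq_1[OF chi])
    then show ?thesis by (simp add: w)
  next
    case 2
    then have "norm ((1/2) *\<^sub>R ?z) \<ge> 4/3" "norm ?z \<ge> 4/3" unfolding norm_scaleR[of "1/2"] by linarith+
    then have "chi ((1/2) *\<^sub>R ?z) = 0" "chi ?z = 0"
      by (simp_all only: cutoff_eq_0[OF chi])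
    then show ?thesis by (simp add: w)
  next
    case 3
    then have "norm ((1/4) *\<^sub>R ?z) < 3/4" "norm (2 *\<^sub>R ?z) \<ge> 4/3"
      unfolding norm_scaleR[of "1/4"] norm_scaleR[of 2] by linarith+
    then have "chi ((1/4) *\<^sub>R ?z) = 1" "chi (2 *\<^sub>R ?z) = 0"
      by (simp_all only: cutoff_eq_1[OF chi] cutoff_eq_0[OF chi])
    then show ?thesis by (simp add: fw)
  qed
qed

lemma lp_fat_window_bound:
  assumes chi: "lp_cutoff chi"
  shows "\<bar>lp_fat_window chi k \<xi>\<bar> \<le> 1"
  using cutoff_range[OF chi, of "(2 powi (- k) / 4) *\<^sub>R \<xi>"] cutoff_range[OF chi, of "(2 powi (- k)
    * 2) *\<^sub>R \<xi>"]
  unfolding lp_fat_window_def by linarith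

text \<open>
  Below the radius \<open>(3/8) 2^k\<close> both cutoffs are equal to one and cancel.
\<close>

lemma lp_fat_window_support:
  assumes chi: "lp_cutoff chi" and "lp_fat_window chi k \<xi> \<noteq> 0"
  shows "3/8 * 2 powi k \<le> norm \<xi>"
proof (rule ccontr)
  assume "\<not> ?thesis"
  then have "norm \<xi> < 3/8 * 2 powi k" by simp
  then have n: "2 powi (- k) * norm \<xi> < 3/8"
    by (simp add: power_int_minus field_simps)
  have "norm ((2 powi (- k) / 4) *\<^sub>R \<xi>) = 2 powi (- k) * norm \<xi> / 4"
    "norm ((2 powi (- k) * 2) *\<^sub>R \<xi>) = 2 powi (- k) * norm \<xi> * 2"
    by (simp_all add: abs_mult)
  moreover have "0 \<le> 2 powi (- k) * norm \<xi>" by simp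
  ultimately have "norm ((2 powi (- k) / 4) *\<^sub>R \<xi>) < 3/4" "norm ((2 powi (- k) * 2) *\<^sub>R \<xi>) < 3/4"
    using n by linarith+
  then have "chi ((2 powi (- k) / 4) *\<^sub>R \<xi>) = 1" "chi ((2 powi (- k) * 2) *\<^sub>R \<xi>) = 1"
    by (simp_all only: cutoff_eq_1[OF chi])
  then show False using assms(2) by (simp add: lp_fat_window_def)
qed

text \<open>
  The value of \<open>m\<close> at radius \<open>(3/8) 2^k\<close> is at least \<open>(9/73) min(1, 4^k)\<close>; the constant is
  rounded down to \<open>1/9\<close>.
\<close>

definition decay_rate :: "int \<Rightarrow> real" where
  "decay_rate k = min 1 (4 powi k) / 9"

lemma symbol_lower_bound:
  assumes "3/8 * 2 powi k \<le> norm \<xi>"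
  shows "decay_rate k \<le> symbol \<xi>"
proof -
  define a where "a = (3/8 * 2 powi k :: real)\<^sup>2"
  have p: "(2 powi k :: real) > 0" by simp
  have "(2 powi k)\<^sup>2 = (4 powi k :: real)"
    by (simp add: power2_eq_square flip: power_int_mult_distrib)
  then have a: "a = 9/64 * 4 powi k" by (simp add: a_def power_mult_distrib power2_eq_square)
  have a0: "a > 0" unfolding a by (intro mult_pos_pos) auto
  have le: "a \<le> (norm \<xi>)\<^sup>2" unfolding a_def using assms p by (intro power_mono) auto
  have mono: "a / (1 + a) \<le> s / (1 + s)" if "a \<le> s" for s
    using that a0 by (simp add: field_simps)
  have "min 1 (4 powi k) / 9 \<le> a / (1 + a)"
  proof (cases "(4 powi k :: real) \<le> 1")
    case True
    then have "4 powi k / 9 * (1 + a) \<le> 4 powi k / 9 * (1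
      + 9/64)" unfolding a by (intro mult_left_mono) auto
    also have "\<dots> \<le> a" using a a0 by simp
    finally show ?thesis using True a0 by (simp add: pos_le_divide_eq min_def)
  next
    case False
    then have "9/64 \<le> a" using a by simp
    then show ?thesis using False a0 by (simp add: pos_le_divide_eq min_def)
  qed
  also have "\<dots> \<le> symbol \<xi>" unfolding symbol_def by (rule mono[OF le])
  finally show ?thesis by (simp add: decay_rate_def)
qed

lemma lp_block_eq: "lp_block chi k T \<psi> = T (fourier (\<lambda>\<xi>. complex_of_real (lp_window chi k \<xi>)
  * inv_fourier \<psi> \<xi>))"
  by (simp add: lp_block_def fourier_multiplier_eq lp_window_def)

text \<open>
  The evolution acting on test functions: \<open>u(t)\<close> on \<open>\<psi>\<close> is \<open>u\<^sub>0\<close> on the evolved \<open>\<psi>\<close>.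
\<close>

definition heat_test :: "real \<Rightarrow> ('a::euclidean_space \<Rightarrow> complex) \<Rightarrow> 'a \<Rightarrow> complex" where
  "heat_test t \<psi> = fourier (\<lambda>\<xi>. complex_of_real (exp (- t * symbol \<xi>)) * inv_fourier \<psi> \<xi>)"

lemma heat_test_schwartz: "\<psi> \<in> schwartz \<Longrightarrow> heat_test t \<psi> \<in> schwartz"
  unfolding heat_test_def by (intro schwartz_fourier heat_multiplier schwartz_inv_fourier)

lemma schwartz_mult_schwartz: "f \<in> schwartz \<Longrightarrow> g \<in> schwartz \<Longrightarrow> (\<lambda>x. f x * g x) \<in> schwartz"
  by (rule bounded_derivs_mult_schwartz[OF schwartz_bounded_derivs])

text \<open>
  Frequency localization commutes with the evolution, as both are multipliers.
\<close>

lemma lp_block_solution: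
  assumes sol: "solves_linear u u0" and chi: "lp_cutoff chi" and \<psi>: "\<psi> \<in> schwartz" and t: "t \<ge> 0"
  shows "lp_block chi k (u t) \<psi> = lp_block chi k u0 (heat_test t \<psi>)"
proof -
  let ?f = "\<lambda>\<xi>. complex_of_real (lp_window chi k \<xi>) * inv_fourier \<psi> \<xi>"
  have f: "?f \<in> schwartz" by (intro schwartz_mult_schwartz lp_window_schwartz chi schwartz_inv_fourier \<psi>)
  have h: "(\<lambda>\<xi>. complex_of_real (exp (- t * symbol \<xi>)) * inv_fourier \<psi> \<xi>) \<in> schwartz"
    by (intro heat_multiplier schwartz_inv_fourier \<psi>)
  show ?thesis
    unfolding lp_block_eq heat_test_def solution_formula[OF sol schwartz_fourier[OF f] t]
      inv_fourier_fourier[OF f] inv_fourier_fourier[OF h]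
    by (simp add: mult_ac)
qed

text \<open>
  The partial sums for \<open>u(t)\<close> at \<open>\<psi>\<close> are those for \<open>u\<^sub>0\<close> at the evolved test function.
\<close>

lemma solution_S_h:
  assumes sol: "solves_linear u u0" and chi: "lp_cutoff chi" and u0: "u0 \<in> S_h chi" and t: "t \<ge> 0"
  shows "u t \<in> S_h chi"
proof -
  have "u t \<in> tempered" using sol t by (simp add: solves_linear_def)
  moreover have "((\<lambda>(m, n). \<Sum>k\<in>{- int m..int n}. lp_block chi k (u t) \<psi>) \<longlongrightarrow> u t \<psi>) (sequentially \<times>\<^sub>F sequentially)"
    if \<psi>: "\<psi> \<in> schwartz" for \<psi>
  proof -
    have "u t \<psi> = u0 (heat_test t \<psi>)"
      unfolding heat_test_def by (rule solution_formula[OF sol \<psi> t])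
    then show ?thesis
      using u0 heat_test_schwartz[OF \<psi>] by (simp add: lp_block_solution[OF sol chi \<psi> t] S_h_def)
  qed
  ultimately show ?thesis by (simp add: S_h_def)
qed

section \<open>Multipliers on square integrable functions\<close>

text \<open>
  A multiplier acting on an integrable function is a convolution; the transposition reflects the
  kernel.
\<close>

lemma fourier_mult_inv_fourier:
  fixes M p :: "'a::euclidean_space \<Rightarrow> complex"
  assumes M: "M \<in> schwartz" and p: "integrable lborel p"
  shows "fourier (\<lambda>\<xi>. M \<xi> * inv_fourier p \<xi>) x = (LINT y|lborel. p y * inv_fourier M (y - x))"
proof -
  let ?c = "complex_of_real (1 / (2 * pi) ^ DIM('a))"
  have "fourier (\<lambda>\<xi>. M \<xi> * inv_fourier p \<xi>) x
      = (LINT \<xi>|lborel. ?c * ((ek \<xi> x * M \<xi>) * (LINT y|lborel. ek y (- \<xi>) * p y)))"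
    unfolding fourier_ek inv_fourier_eq by (simp add: mult_ac)
  also have "\<dots> = ?c * (LINT y|lborel. p y * (LINT \<xi>|lborel. ek y (- \<xi>) * (ek \<xi> x * M \<xi>)))"
    unfolding integral_mult_right_zero
    by (subst integral_swap_ek(2)[OF integrable_ek[OF schwartz_integrable[OF M]] p]) (rule refl)
  also have "(\<lambda>y. LINT \<xi>|lborel. ek y (- \<xi>) * (ek \<xi> x * M \<xi>)) = (\<lambda>y. fourier M (- (y - x)))"
  proof
    fix y
    have "ek y (- \<xi>) * (ek \<xi> x * M \<xi>) = ek \<xi> (- (y - x)) * M \<xi>" for \<xi>
      using ek_add(2)[of \<xi> x "- y"] ek_uminus(1)[of y \<xi>] by (simp add: ek_commute[of _ \<xi>] ek_commute[of y])
    then show "(LINT \<xi>|lborel. ek y (- \<xi>) * (ek \<xi> x * M \<xi>)) = fourier M (- (y - x))"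
      by (simp only: fourier_ek)
  qed
  also have "?c * (LINT y|lborel. p y * fourier M (- (y - x)))
    = (LINT y|lborel. ?c * (p y * fourier M (- (y - x))))"
    by (simp only: integral_mult_right_zero)
  finally show ?thesis unfolding inv_fourier_eq by (simp only: mult.left_commute)
qed

definition convolve :: "('a::euclidean_space \<Rightarrow> complex) \<Rightarrow> ('a \<Rightarrow> complex) \<Rightarrow> 'a \<Rightarrow> complex" where
  "convolve f K y = (LINT x|lborel. f x * K (y - x))"

lemma schwartz_square_integrable:
  assumes "K \<in> schwartz"
  shows "integrable lborel (\<lambda>x. (norm (K x))\<^sup>2)"
proof (rule Bochner_Integration.integrable_bound)
  have [measurable]: "K \<in> borel_measurable borel" by (rule schwartz_measurable[OF assms])
  show "integrable lborel (\<lambda>x. schwartz_seminorm 0 K * norm (K x))"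
    by (intro integrable_mult_right integrable_norm schwartz_integrable assms)
  show "AE x in lborel. norm ((norm (K x))\<^sup>2) \<le> norm (schwartz_seminorm 0 K * norm (K x))"
  proof (rule AE_I2)
    fix x
    have "norm (K x) \<le> schwartz_seminorm 0 K" using schwartz_seminorm_bound[OF assms, of "[]" 0 x] by simp
    then have "norm (K x) * norm (K x) \<le> schwartz_seminorm 0 K
      * norm (K x)" by (rule mult_right_mono) simp
    then show "norm ((norm (K x))\<^sup>2) \<le> norm (schwartz_seminorm 0 K * norm (K x))"
      by (simp add: power2_eq_square)
  qed
qed (use schwartz_measurable[OF assms] in measurable)

context
  fixes f K :: "'a::euclidean_space \<Rightarrow> complex"
  assumes fm [measurable]: "f \<in> borel_measurable borel"
    and f2: "integrable lborel (\<lambda>x. (norm (f x))\<^sup>2)"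
    and K: "K \<in> schwartz"
begin

lemma convolve_measurable: "convolve f K \<in> borel_measurable borel"
proof -
  note [measurable] = schwartz_measurable[OF K]
  show ?thesis unfolding convolve_def[abs_def] by measurable
qed

text \<open>
  The bound \<open>a b \<le> a\<^sup>2 + b\<^sup>2\<close> for the integrand is uniform in \<open>y\<close> by translation invariance.
\<close>

lemma convolve_integrable: "integrable lborel (\<lambda>x. f x * K (y - x))"
  and convolve_norm_integral: "(LINT x|lborel. norm (f x * K (y - x)))
    \<le> (LINT x|lborel. (norm (f x))\<^sup>2) + (LINT x|lborel. (norm (K x))\<^sup>2)"
proof -
  note [measurable] = schwartz_measurable[OF K]
  have k2: "integrable lborel (\<lambda>x. (norm (K (y - x)))\<^sup>2)"
    using lborel_integral_affine(2)[of "\<lambda>x. (norm (K x))\<^sup>2" "- 1" y] schwartz_square_integrable[OF K] by simp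
  have k2v: "(LINT x|lborel. (norm (K (y - x)))\<^sup>2) = (LINT x|lborel. (norm (K x))\<^sup>2)"
    using lborel_integral_affine(1)[of "\<lambda>x. (norm (K x))\<^sup>2" "- 1" y] by simp
  have bd: "norm (f x * K (y - x)) \<le> (norm (f x))\<^sup>2 + (norm (K (y - x)))\<^sup>2" for x
    using sum_squares_bound[of "norm (f x)" "norm (K (y - x))"] mult_nonneg_nonneg[OF norm_ge_zero[of "f x"] norm_ge_zero[of "K (y - x)"]]
    unfolding norm_mult by linarith
  have i: "integrable lborel (\<lambda>x. (norm (f x))\<^sup>2 + (norm (K (y - x)))\<^sup>2)"
    by (intro Bochner_Integration.integrable_add f2 k2)
  show 1: "integrable lborel (\<lambda>x. f x * K (y - x))"
    by (rule Bochner_Integration.integrable_bound[OF i _ AE_I2]) (use order_trans[OF bd abs_ge_self] in auto)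
  have "(LINT x|lborel. norm (f x * K (y - x)))
    \<le> (LINT x|lborel. (norm (f x))\<^sup>2 + (norm (K (y - x)))\<^sup>2)"
    by (rule integral_mono[OF integrable_norm[OF 1] i bd])
  then show "(LINT x|lborel. norm (f x * K (y - x)))
    \<le> (LINT x|lborel. (norm (f x))\<^sup>2) + (LINT x|lborel. (norm (K x))\<^sup>2)"
    by (simp add: Bochner_Integration.integral_add[OF f2 k2] k2v)
qed

lemma convolve_bounded: "norm (convolve f K y)
  \<le> (LINT x|lborel. (norm (f x))\<^sup>2) + (LINT x|lborel. (norm (K x))\<^sup>2)"
  unfolding convolve_def by (rule order_trans[OF integral_norm_bound convolve_norm_integral])

text \<open>
  Moving the convolution to the test function by Fubini; the inner integrals are bounded uniformly
  in \<open>y\<close>.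
\<close>

lemma convolve_dual:
  assumes p: "integrable lborel p"
  shows "integrable lborel (\<lambda>y. convolve f K y * p y)"
    and "(LINT y|lborel. convolve f K y * p y)
      = (LINT x|lborel. f x * (LINT y|lborel. p y * K (y - x)))"
proof -
  let ?Q = "(LINT x|lborel. (norm (f x))\<^sup>2) + (LINT x|lborel. (norm (K x))\<^sup>2)"
  note [measurable] = schwartz_measurable[OF K] convolve_measurable
  have pm[measurable]: "p \<in> borel_measurable borel" using p by (simp add: integrable_iff_bounded)
  let ?F = "\<lambda>y x. p y * (f x * K (y - x))"
  have I: "integrable (lborel \<Otimes>\<^sub>M lborel) (case_prod ?F)"
  proof (rule lborel_pair.Fubini_integrable)
    show "case_prod ?F \<in> borel_measurable (lborel \<Otimes>\<^sub>M lborel)" by measurable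
    show "AE y in lborel. integrable lborel (\<lambda>x. case (y, x) of (y, x) \<Rightarrow> ?F y x)"
      unfolding prod.case by (intro AE_I2 integrable_mult_right convolve_integrable)
    have m: "(\<lambda>y. LINT x|lborel. norm (?F y x)) \<in> borel_measurable lborel" by measurable
    have i: "integrable lborel (\<lambda>y. norm (p y) * ?Q)" by (intro integrable_mult_left integrable_norm p)
    have "norm (LINT x|lborel. norm (?F y x)) \<le> norm (norm (p y) * ?Q)" for y
    proof -
      have "(LINT x|lborel. norm (?F y x)) = norm (p y) * (LINT x|lborel. norm (f x * K (y - x)))"
        unfolding norm_mult[of "p y"] by (rule integral_mult_right_zero)
      also have "\<dots> \<le> norm (p y) * ?Q" by (intro mult_left_mono convolve_norm_integral) auto
      finally have le: "(LINT x|lborel. norm (?F y x)) \<le> norm (p y) * ?Q" .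
      have "0 \<le> (LINT x|lborel. norm (?F y x))" by (rule Bochner_Integration.integral_nonneg) simp
      then show ?thesis using order_trans[OF le abs_ge_self] by (simp only: real_norm_def abs_of_nonneg)
    qed
    from Bochner_Integration.integrable_bound[OF i m AE_I2, OF this]
    show "integrable lborel (\<lambda>y. LINT x|lborel. norm (case (y, x) of (y, x) \<Rightarrow> ?F y x))"
      unfolding prod.case .
  qed
  have eq: "(LINT x|lborel. ?F y x) = convolve f K y * p y" for y
    unfolding convolve_def integral_mult_right_zero by (rule mult.commute)
  show "integrable lborel (\<lambda>y. convolve f K y * p y)"
    using lborel_pair.integrable_fst'[OF I] by (simp only: prod.case eq)
  have "(LINT y|lborel. convolve f K y * p y)
    = (LINT y|lborel. LINT x|lborel. ?F y x)" by (simp only: eq)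
  also have "\<dots> = (LINT x|lborel. LINT y|lborel. ?F y x)"
    by (rule lborel_pair.Fubini_integral[OF I, symmetric])
  also have "\<dots> = (LINT x|lborel. LINT y|lborel. f x * (p y * K (y - x)))"
    by (simp only: mult.left_commute)
  finally show "(LINT y|lborel. convolve f K y * p y)
    = (LINT x|lborel. f x * (LINT y|lborel. p y * K (y - x)))"
    by (simp only: integral_mult_right_zero)
qed

end

text \<open>
  One Bessel inequality for the inverse transform of \<open>p\<close> and one for the transform of the product; the
  powers of \<open>2\<pi>\<close> cancel.
\<close>

lemma multiplier_L2_contraction:
  fixes p M :: "'a::euclidean_space \<Rightarrow> complex"
  assumes p: "integrable lborel p" and M: "M \<in> schwartz" and e: "\<And>\<xi>. norm (M \<xi>) \<le> \<epsilon>" "\<epsilon> > 0"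
  shows "(\<integral>\<^sup>+x. ennreal ((norm (fourier (\<lambda>\<xi>. M \<xi> * inv_fourier p \<xi>) x))\<^sup>2) \<partial>lborel)
    \<le> ennreal (\<epsilon>\<^sup>2) * (energy p)"
proof -
  let ?h = "inv_fourier p" and ?D = "(2 * pi) ^ DIM('a)"
  have D: "?D > 0" by simp
  have [measurable]: "p \<in> borel_measurable borel" "M \<in> borel_measurable borel"
    using p schwartz_measurable[OF M] by (simp_all add: integrable_iff_bounded)
  have [measurable]: "?h \<in> borel_measurable borel" unfolding inv_fourier_eq[abs_def] by measurable
  have hb: "norm (?h \<xi>) \<le> 1 / ?D * (LINT x|lborel. norm (p x))" for \<xi>
    unfolding inv_fourier_eq norm_mult using norm_fourier_le[of p "- \<xi>"] D
    by (intro mult_mono) (auto simp: norm_divide norm_power norm_mult)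
  have i: "integrable lborel (\<lambda>\<xi>. M \<xi> * ?h \<xi>)"
  proof (rule Bochner_Integration.integrable_bound)
    show "integrable lborel (\<lambda>\<xi>. (1 / ?D * (LINT x|lborel. norm (p x))) * norm (M \<xi>))"
      by (intro integrable_mult_right integrable_norm schwartz_integrable M)
    show "AE \<xi> in lborel. norm (M \<xi> * ?h \<xi>)
      \<le> norm ((1 / ?D * (LINT x|lborel. norm (p x))) * norm (M \<xi>))"
    proof (rule AE_I2)
      fix \<xi>
      have "norm (M \<xi> * ?h \<xi>) \<le> (1 / ?D * (LINT x|lborel. norm (p x))) * norm (M \<xi>)"
        unfolding norm_mult by (subst mult.commute) (intro mult_right_mono hb norm_ge_zero)
      then show "norm (M \<xi> * ?h \<xi>) \<le> norm ((1 / ?D * (LINT x|lborel. norm (p x))) * norm (M \<xi>))"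
        unfolding real_norm_def by (rule order_trans[OF _ abs_ge_self])
    qed
  qed measurable
  have "(\<integral>\<^sup>+x. ennreal ((norm (fourier (\<lambda>\<xi>. M \<xi> * ?h \<xi>) x))\<^sup>2) \<partial>lborel)
      \<le> ennreal ?D * (\<integral>\<^sup>+\<xi>. ennreal ((norm (M \<xi> * ?h \<xi>))\<^sup>2) \<partial>lborel)"
    by (rule fourier_bessel[OF i])
  also have "(\<integral>\<^sup>+\<xi>. ennreal ((norm (M \<xi> * ?h \<xi>))\<^sup>2) \<partial>lborel)
      \<le> (\<integral>\<^sup>+\<xi>. ennreal (\<epsilon>\<^sup>2 / ?D\<^sup>2) * ennreal ((norm (fourier p (- \<xi>)))\<^sup>2) \<partial>lborel)"
  proof (rule nn_integral_mono)
    fix \<xi>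
    have "(norm (M \<xi> * ?h \<xi>))\<^sup>2 \<le> (\<epsilon> * norm (?h \<xi>))\<^sup>2"
      unfolding norm_mult by (intro power_mono mult_right_mono e) auto
    also have "\<dots> = \<epsilon>\<^sup>2 / ?D\<^sup>2 * (norm (fourier p (- \<xi>)))\<^sup>2"
      by (simp add: inv_fourier_eq norm_mult norm_divide norm_power power_mult_distrib power_divide)
    finally show "ennreal ((norm (M \<xi> * ?h \<xi>))\<^sup>2)
      \<le> ennreal (\<epsilon>\<^sup>2 / ?D\<^sup>2) * ennreal ((norm (fourier p (- \<xi>)))\<^sup>2)"
      by (simp add: ennreal_leI flip: ennreal_mult)
  qed
  also have "\<dots> = ennreal (\<epsilon>\<^sup>2 / ?D\<^sup>2) * (\<integral>\<^sup>+\<xi>. ennreal ((norm (fourier p (- \<xi>)))\<^sup>2) \<partial>lborel)"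
    by (rule nn_integral_cmult) measurable
  also have "(\<integral>\<^sup>+\<xi>. ennreal ((norm (fourier p (- \<xi>)))\<^sup>2) \<partial>lborel) = (energy (fourier p))"
    using lborel_nn_integral_affine[of "\<lambda>\<xi>. ennreal ((norm (fourier p \<xi>))\<^sup>2)" "- 1" 0] by simp
  also have "\<dots> \<le> ennreal ?D * (energy p)" by (rule fourier_bessel[OF p])
  also have "ennreal ?D * (ennreal (\<epsilon>\<^sup>2 / ?D\<^sup>2) * (ennreal ?D * (energy p)))
      = ennreal (?D * (\<epsilon>\<^sup>2 / ?D\<^sup>2) * ?D) * (energy p)"
  proof -
    have "ennreal D * (ennreal c * (ennreal D * I)) = ennreal (D * c * D) * I" if "0 \<le> D" "0
      \<le> c" for D c I
      using that by (simp add: ennreal_mult mult.assoc)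
    then show ?thesis using D by simp
  qed
  also have "?D * (\<epsilon>\<^sup>2 / ?D\<^sup>2) * ?D = \<epsilon>\<^sup>2" using D by (simp add: power2_eq_square)
  finally show ?thesis by (simp add: mult_left_mono)
qed

text \<open>
  Let \<open>X\<close> be the energy of the convolution on a ball.  Testing against the conjugate restricted to the
  ball, \<open>X\<close> is the integral of \<open>f\<close> times a function of energy at most \<open>\<epsilon>\<^sup>2 X\<close>, so
  \<open>X \<le> \<epsilon>\<^sup>2 A / 2 + X / 2\<close>, where \<open>A\<close> is the energy of \<open>f\<close>.  As \<open>X\<close> is finite it can be absorbed, and then
  the ball grows.
\<close>

lemma convolve_L2_bound:
  fixes f M :: "'a::euclidean_space \<Rightarrow> complex"
  assumes fm [measurable]: "f \<in> borel_measurable borel"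
    and f2: "integrable lborel (\<lambda>x. (norm (f x))\<^sup>2)"
    and M: "M \<in> schwartz" and e: "\<And>\<xi>. norm (M \<xi>) \<le> \<epsilon>" "\<epsilon> > 0"
  shows "(energy (convolve f (inv_fourier M)))
    \<le> ennreal (\<epsilon>\<^sup>2) * (energy f)"
proof -
  let ?K = "inv_fourier M"
  let ?g = "convolve f ?K" and ?a = "LINT x|lborel. (norm (f x))\<^sup>2"
  note K = schwartz_inv_fourier[OF M]
  note [measurable] = convolve_measurable[OF fm f2 K]
  define Q where "Q = ?a + (LINT x|lborel. (norm (?K x))\<^sup>2)"
  have gQ: "norm (?g y) \<le> Q" for y unfolding Q_def by (rule convolve_bounded[OF fm f2 K])
  have Q0: "0 \<le> Q" using gQ[of 0] by (rule order_trans[OF norm_ge_zero])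
  have a: "(energy f) = ennreal ?a"
    by (rule nn_integral_eq_integral[OF f2]) auto
  have cut: "(\<integral>\<^sup>+y. ennreal (indicator (cball 0 R) y * (norm (?g y))\<^sup>2) \<partial>lborel)
    \<le> ennreal (\<epsilon>\<^sup>2 * ?a)" for R :: real
  proof -
    let ?i = "\<lambda>y::'a. indicator (cball 0 R) y :: real"
    define p where "p y = complex_of_real (?i y) * cnj (?g y)" for y
    let ?v = "fourier (\<lambda>\<xi>. M \<xi> * inv_fourier p \<xi>)"
    have ii: "integrable lborel ?i"
      using emeasure_lborel_cball_finite[of "0::'a" R] by (intro integrable_real_indicator) auto
    have im [measurable]: "?i \<in> borel_measurable borel" by (rule borel_measurable_indicator) simp
    have cm: "(\<lambda>y. cnj (?g y)) \<in> borel_measurable borel"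
      by (rule borel_measurable_continuous_on[of cnj]) (auto intro: continuous_intros convolve_measurable[OF fm f2 K])
    have "(\<lambda>y. complex_of_real (?i y)) \<in> borel_measurable borel"
      by (rule borel_measurable_continuous_on[of complex_of_real]) (auto intro: continuous_intros im)
    then have [measurable]: "p \<in> borel_measurable borel"
      unfolding p_def[abs_def] by (rule borel_measurable_times[OF _ cm])
    have p: "integrable lborel p"
    proof (rule Bochner_Integration.integrable_bound)
      show "integrable lborel (\<lambda>y. Q * ?i y)" by (intro integrable_mult_right ii)
      show "AE y in lborel. norm (p y) \<le> norm (Q * ?i y)"
        using gQ Q0 by (intro AE_I2) (auto simp: p_def norm_mult indicator_def)
    qed measurable
    have [measurable]: "M \<in> borel_measurable borel" by (rule schwartz_measurable[OF M])
    have [measurable]: "inv_fourier p \<in> borel_measurable borel" unfolding inv_fourier_eq[abs_def] by measurable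
    have sq: "(norm (p y))\<^sup>2 = ?i y * (norm (?g y))\<^sup>2" "?g y * p y
      = complex_of_real (?i y * (norm (?g y))\<^sup>2)" for y
      by (auto simp: p_def norm_mult indicator_def complex_norm_square simp del: of_real_power)
    define X where "X = (LINT y|lborel. ?i y * (norm (?g y))\<^sup>2)"
    have Xi: "integrable lborel (\<lambda>y. ?i y * (norm (?g y))\<^sup>2)"
    proof (rule Bochner_Integration.integrable_bound)
      show "integrable lborel (\<lambda>y. Q\<^sup>2 * ?i y)" by (intro integrable_mult_right ii)
      show "AE y in lborel. norm (?i y * (norm (?g y))\<^sup>2) \<le> norm (Q\<^sup>2 * ?i y)"
        using gQ Q0 by (intro AE_I2) (auto simp: indicator_def intro: power_mono)
    qed (use im convolve_measurable[OF fm f2 K] in \<open>simp add: borel_measurable_times borel_measurable_power\<close>)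
    have Xn: "(\<integral>\<^sup>+y. ennreal (?i y * (norm (?g y))\<^sup>2) \<partial>lborel) = ennreal X"
      unfolding X_def by (rule nn_integral_eq_integral[OF Xi]) auto
    have X0: "0 \<le> X" unfolding X_def by (rule Bochner_Integration.integral_nonneg) auto
    have "complex_of_real X = (LINT y|lborel. ?g y * p y)"
      unfolding X_def sq by (rule integral_complex_of_real[symmetric])
    also have "\<dots> = (LINT x|lborel. f x * ?v x)"
      unfolding convolve_dual(2)[OF fm f2 K p] fourier_mult_inv_fourier[OF M p] by (rule refl)
    finally have "ennreal X = ennreal (norm (LINT x|lborel. f x * ?v x))"
      using X0 by (metis abs_of_nonneg norm_of_real)
    also have "\<dots> \<le> (\<integral>\<^sup>+x. ennreal (norm (f x * ?v x)) \<partial>lborel)" by (rule norm_LINT_le_nn_integral)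
    also have "\<dots> \<le> (\<integral>\<^sup>+x. ennreal (\<epsilon>\<^sup>2 / 2) * ennreal ((norm (f x))\<^sup>2)
      + ennreal (1 / (2 * \<epsilon>\<^sup>2)) * ennreal ((norm (?v x))\<^sup>2) \<partial>lborel)"
    proof (rule nn_integral_mono)
      fix x
      \<comment> \<open>The weights make the second term integrate to at most \<open>X / 2\<close>.\<close>
      have "norm (f x) * norm (?v x) \<le> \<epsilon>\<^sup>2 / 2 * (norm (f x))\<^sup>2 + 1 / (2 * \<epsilon>\<^sup>2) * (norm (?v x))\<^sup>2"
        using sum_squares_bound[of "\<epsilon> * norm (f x)" "norm (?v x) / \<epsilon>"] e(2) by (simp add: power_mult_distrib power_divide)
      then show "ennreal (norm (f x * ?v x))
        \<le> ennreal (\<epsilon>\<^sup>2 / 2) * ennreal ((norm (f x))\<^sup>2) + ennreal (1 / (2 * \<epsilon>\<^sup>2)) * ennreal ((norm (?v x))\<^sup>2)"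
        by (simp add: norm_mult ennreal_leI flip: ennreal_mult ennreal_plus)
    qed
    also have "\<dots> = (\<integral>\<^sup>+x. ennreal (\<epsilon>\<^sup>2 / 2) * ennreal ((norm (f x))\<^sup>2) \<partial>lborel)
      + (\<integral>\<^sup>+x. ennreal (1 / (2 * \<epsilon>\<^sup>2)) * ennreal ((norm (?v x))\<^sup>2) \<partial>lborel)"
      by (rule nn_integral_add) measurable
    also have "\<dots> = ennreal (\<epsilon>\<^sup>2 / 2) * ennreal ?a + ennreal (1 / (2 * \<epsilon>\<^sup>2)) * (energy ?v)"
      by (simp add: nn_integral_cmult a)
    also have "\<dots> \<le> ennreal (\<epsilon>\<^sup>2 / 2) * ennreal ?a
      + ennreal (1 / (2 * \<epsilon>\<^sup>2)) * (ennreal (\<epsilon>\<^sup>2) * ennreal X)"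
      using multiplier_L2_contraction[OF p M e] unfolding sq Xn by (intro add_left_mono mult_left_mono) auto
    also have "\<dots> = ennreal (\<epsilon>\<^sup>2 / 2 * ?a + 1 / (2 * \<epsilon>\<^sup>2) * (\<epsilon>\<^sup>2 * X))"
    proof -
      have "ennreal b * ennreal c + ennreal q * (ennreal r * ennreal X) = ennreal (b * c + q * (r * X))"
        if "0 \<le> b" "0 \<le> c" "0 \<le> q" "0 \<le> r" for b c q r
        using that X0 by (simp add: ennreal_mult)
      then show ?thesis by simp
    qed
    finally have "X \<le> \<epsilon>\<^sup>2 / 2 * ?a + 1 / (2 * \<epsilon>\<^sup>2) * (\<epsilon>\<^sup>2 * X)"
      using X0 by (subst (asm) ennreal_le_iff) (auto intro!: add_nonneg_nonneg mult_nonneg_nonneg)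
    then have "X \<le> \<epsilon>\<^sup>2 * ?a" using e(2) by simp
    then show ?thesis unfolding Xn by (rule ennreal_leI)
  qed
  have "(energy ?g)
     = (\<integral>\<^sup>+y. liminf (\<lambda>n. ennreal (indicator (cball 0 (real n)) y * (norm (?g y))\<^sup>2)) \<partial>lborel)"
  proof (rule nn_integral_cong)
    fix y :: 'a
    obtain N :: nat where N: "norm y \<le> real N" using real_arch_simple by blast
    have "\<forall>\<^sub>F n in sequentially. ennreal (indicator (cball 0 (real n)) y * (norm (?g y))\<^sup>2)
      = ennreal ((norm (?g y))\<^sup>2)"
      using eventually_ge_at_top[of N] by eventually_elim (use N in \<open>auto simp: indicator_def\<close>)
    then have "(\<lambda>n. ennreal (indicator (cball 0 (real n)) y * (norm (?g y))\<^sup>2))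
      \<longlonglongrightarrow> ennreal ((norm (?g y))\<^sup>2)"
      by (rule tendsto_eventually)
    then show "ennreal ((norm (?g y))\<^sup>2)
      = liminf (\<lambda>n. ennreal (indicator (cball 0 (real n)) y * (norm (?g y))\<^sup>2))"
      by (rule lim_imp_Liminf[OF sequentially_bot, symmetric])
  qed
  also have "\<dots> \<le> liminf (\<lambda>n. \<integral>\<^sup>+y. ennreal (indicator (cball 0 (real n)) y * (norm (?g y))\<^sup>2) \<partial>lborel)"
  proof (rule nn_integral_liminf)
    fix n :: nat
    have "(\<lambda>y::'a. indicator (cball 0 (real n)) y :: real) \<in> borel_measurable borel"
      by (rule borel_measurable_indicator) simp
    from borel_measurable_times[OF this borel_measurable_power[OF measurable_compose[OF convolve_measurable[OF fm f2 K] borel_measurable_norm]]]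
    show "(\<lambda>y. ennreal (indicator (cball 0 (real n)) y * (norm (?g y))\<^sup>2)) \<in> borel_measurable lborel"
      by simp
  qed
  also have "\<dots> \<le> liminf (\<lambda>n::nat. ennreal (\<epsilon>\<^sup>2 * ?a))"
    by (intro Liminf_mono always_eventually allI cut)
  also have "\<dots> = ennreal (\<epsilon>\<^sup>2) * (energy f)"
    by (simp add: Liminf_const a ennreal_mult)
  finally show ?thesis .
qed

lemma ennpowr_mono: "x \<le> y \<Longrightarrow> 0 \<le> a \<Longrightarrow> ennpowr x a \<le> ennpowr y a"
  by (auto simp: ennpowr_def top_unique less_top intro!: ennreal_leI powr_mono2 enn2real_mono)

lemma ennpowr_cmult:
  assumes "c > 0" "a > 0"
  shows "ennpowr (ennreal c * x) a = ennreal (c powr a) * ennpowr x a"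
proof (cases "x = \<infinity>")
  case True
  then show ?thesis using assms by (simp add: ennpowr_def ennreal_mult_eq_top_iff ennreal_top_mult ennreal_mult_top)
next
  case False
  then obtain y where "x = ennreal y" "0 \<le> y" by (cases x) auto
  then show ?thesis using assms by (simp add: ennpowr_def powr_mult enn2real_mult flip: ennreal_mult)
qed

lemma Lp_norm_2: "Lp_norm 2 f = ennpowr (energy f) (1/2)"
proof -
  have "(2::ennreal) \<noteq> \<infinity>" by simp
  moreover have "enn2real 2 = 2" by simp
  ultimately show ?thesis by (simp add: Lp_norm_def ennpowr_def)
qed

text \<open>
  Each square integrable representative of \<open>T\<close> yields, by convolution, a representative of \<open>T'\<close>.
\<close>

lemma multiplier_Lp_norm_distr:
  fixes T T' :: "'a::euclidean_space functional"
  assumes M: "M \<in> schwartz" and e: "\<And>\<xi>. norm (M \<xi>) \<le> \<epsilon>" "\<epsilon> > 0"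
    and T': "\<And>\<psi>. \<psi> \<in> schwartz \<Longrightarrow> T' \<psi> = T (fourier (\<lambda>\<xi>. M \<xi> * inv_fourier \<psi> \<xi>))"
  shows "Lp_norm_distr 2 T' \<le> ennreal \<epsilon> * Lp_norm_distr 2 T"
proof -
  have key: "Lp_norm_distr 2 T' \<le> ennreal \<epsilon> * Lp_norm 2 f" if f: "represents f T" for f
  proof (cases "(energy f) = \<infinity>")
    case True
    then show ?thesis using e(2) by (simp add: Lp_norm_2 ennpowr_def ennreal_mult_top)
  next
    case False
    have fm [measurable]: "f \<in> borel_measurable borel" using f by (simp add: represents_def)
    have f2: "integrable lborel (\<lambda>x. (norm (f x))\<^sup>2)"
      using False by (intro integrableI_nonneg) (auto simp: less_top)
    note K = schwartz_inv_fourier[OF M]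
    let ?g = "convolve f (inv_fourier M)"
    have "represents ?g T'"
      unfolding represents_def
    proof (intro conjI ballI)
      show "?g \<in> borel_measurable lborel" using convolve_measurable[OF fm f2 K] by simp
      fix \<psi> :: "'a \<Rightarrow> complex" assume \<psi>: "\<psi> \<in> schwartz"
      have S: "fourier (\<lambda>\<xi>. M \<xi> * inv_fourier \<psi> \<xi>) \<in> schwartz"
        by (intro schwartz_fourier schwartz_mult_schwartz M schwartz_inv_fourier \<psi>)
      note D = convolve_dual[OF fm f2 K schwartz_integrable[OF \<psi>]]
      show "integrable lborel (\<lambda>x. ?g x * \<psi> x)" by (rule D(1))
      have "T' \<psi> = (LINT x|lborel. f x * fourier (\<lambda>\<xi>. M \<xi> * inv_fourier \<psi> \<xi>) x)"
        using f S by (simp add: T' \<psi> represents_def)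
      then show "T' \<psi> = (LINT x|lborel. ?g x * \<psi> x)"
        unfolding D(2) fourier_mult_inv_fourier[OF M schwartz_integrable[OF \<psi>]] .
    qed
    then have "Lp_norm_distr 2 T' \<le> Lp_norm 2 ?g" unfolding Lp_norm_distr_def by (intro INF_lower) simp
    also have "\<dots> \<le> ennpowr (ennreal (\<epsilon>\<^sup>2) * (energy f)) (1/2)"
      unfolding Lp_norm_2 by (intro ennpowr_mono convolve_L2_bound fm f2 M e) simp
    also have "\<dots> = ennreal \<epsilon> * Lp_norm 2 f"
      using e(2) by (subst ennpowr_cmult) (auto simp: Lp_norm_2 powr_half_sqrt)
    finally show ?thesis .
  qed
  have "ennreal (1 / \<epsilon>) * Lp_norm_distr 2 T' \<le> Lp_norm_distr 2 T"
    unfolding Lp_norm_distr_def[of 2 T]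
  proof (rule INF_greatest)
    fix f assume "f \<in> {f. represents f T}"
    then have "ennreal (1 / \<epsilon>) * Lp_norm_distr 2 T' \<le> ennreal (1 / \<epsilon>) * (ennreal \<epsilon> * Lp_norm 2 f)"
      by (intro mult_left_mono key) auto
    also have "\<dots> = Lp_norm 2 f" using e(2) by (simp flip: mult.assoc ennreal_mult)
    finally show "ennreal (1 / \<epsilon>) * Lp_norm_distr 2 T' \<le> Lp_norm 2 f" .
  qed
  then have "ennreal \<epsilon> * (ennreal (1 / \<epsilon>) * Lp_norm_distr 2 T') \<le> ennreal \<epsilon> * Lp_norm_distr 2 T"
    by (rule mult_left_mono) simp
  then show ?thesis using e(2) by (simp flip: mult.assoc ennreal_mult)
qed

text \<open>
  The fat window leaves the block unchanged, so on the block the evolution is a multiplier supported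
  away from the origin, where \<open>exp(- t m)\<close> is small.
\<close>

lemma block_decay:
  assumes sol: "solves_linear u u0" and chi: "lp_cutoff chi" and t: "t \<ge> 0"
  shows "Lp_norm_distr 2 (lp_block chi k (u t))
    \<le> ennreal (exp (- decay_rate k * t)) * Lp_norm_distr 2 (lp_block chi k u0)"
proof (rule multiplier_Lp_norm_distr)
  let ?M = "\<lambda>\<xi>. complex_of_real (exp (- t * symbol \<xi>)) * complex_of_real (lp_fat_window chi k \<xi>)"
  show M: "?M \<in> schwartz" by (intro heat_multiplier lp_window_schwartz chi)
  show "norm (?M \<xi>) \<le> exp (- decay_rate k * t)" for \<xi>
  proof (cases "lp_fat_window chi k \<xi> = 0")
    case False
    have "decay_rate k \<le> symbol \<xi>"
      by (rule symbol_lower_bound[OF lp_fat_window_support[OF chi False]])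
    then have "exp (- t * symbol \<xi>) \<le> exp (- decay_rate k
      * t)" using t by (simp add: mult.commute mult_left_mono)
    then have "exp (- t * symbol \<xi>) * \<bar>lp_fat_window chi k \<xi>\<bar> \<le> exp (- decay_rate k * t) * 1"
      by (intro mult_mono lp_fat_window_bound chi) auto
    then show ?thesis unfolding norm_mult norm_of_real by simp
  qed simp
  fix \<psi> :: "'a \<Rightarrow> complex" assume \<psi>: "\<psi> \<in> schwartz"
  have S: "(\<lambda>\<xi>. ?M \<xi> * inv_fourier \<psi> \<xi>) \<in> schwartz"
    by (intro schwartz_mult_schwartz M schwartz_inv_fourier \<psi>)
  have h: "(\<lambda>\<xi>. complex_of_real (exp (- t * symbol \<xi>)) * inv_fourier \<psi> \<xi>) \<in> schwartz"
    by (intro heat_multiplier schwartz_inv_fourier \<psi>)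
  have "complex_of_real (lp_window chi k \<xi>) * (?M \<xi> * inv_fourier \<psi> \<xi>)
     = complex_of_real (lp_window chi k \<xi> * lp_fat_window chi k \<xi>) * (complex_of_real (exp (- t * symbol \<xi>)) * inv_fourier \<psi> \<xi>)" for \<xi>
    by (simp add: mult_ac)
  then have "lp_block chi k u0 (fourier (\<lambda>\<xi>. ?M \<xi> * inv_fourier \<psi> \<xi>))
    = lp_block chi k u0 (heat_test t \<psi>)"
    unfolding lp_block_eq heat_test_def inv_fourier_fourier[OF S] inv_fourier_fourier[OF h]
    by (simp only: lp_window_absorb[OF chi])
  then show "lp_block chi k (u t) \<psi> = lp_block chi k u0 (fourier (\<lambda>\<xi>. ?M \<xi> * inv_fourier \<psi> \<xi>))"
    by (simp only: lp_block_solution[OF sol chi \<psi> t])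
qed simp

section \<open>Summation over dyadic frequencies\<close>

lemma sum_geometric_int:
  fixes q :: real
  assumes q: "0 < q" "q < 1" and F: "finite F"
  shows "(\<Sum>n\<in>F. q ^ nat \<bar>n::int\<bar>) \<le> 2 / (1 - q)"
proof -
  have half: "(\<Sum>n\<in>G. q ^ nat \<bar>n\<bar>) \<le> 1 / (1 - q)" if G: "finite G" and inj: "inj_on (\<lambda>n::int. nat \<bar>n\<bar>) G" for G
  proof -
    have "(\<Sum>n\<in>G. q ^ nat \<bar>n\<bar>) = (\<Sum>m\<in>(\<lambda>n. nat \<bar>n\<bar>) ` G. q ^ m)"
      by (simp add: sum.reindex[OF inj])
    also have "\<dots> \<le> (\<Sum>m. q ^ m)"
      using q G by (intro sum_le_suminf summable_geometric) auto
    also have "\<dots> = 1 / (1 - q)" using q by (intro suminf_geometric) auto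
    finally show ?thesis .
  qed
  have "F = (F \<inter> {0..}) \<union> (F \<inter> {..<0})" by auto
  then have "(\<Sum>n\<in>F. q ^ nat \<bar>n\<bar>) = (\<Sum>n\<in>F \<inter> {0..}. q ^ nat \<bar>n\<bar>) + (\<Sum>n\<in>F \<inter> {..<0}. q ^ nat \<bar>n\<bar>)"
    using sum.union_disjoint[of "F \<inter> {0..}" "F \<inter> {..<0}" "\<lambda>n. q ^ nat \<bar>n\<bar>"] F by force
  also have "\<dots> \<le> 1 / (1 - q) + 1 / (1 - q)"
    using F by (intro add_mono half) (auto simp: inj_on_def)
  finally show ?thesis by simp
qed

text \<open>
  From \<open>ln y \<le> y - 1\<close> at \<open>y = x / (9 a)\<close>.
\<close>

lemma powr_exp_bound:
  fixes a x :: real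
  assumes "a > 0" "x > 0"
  shows "x powr a * exp (- x / 9) \<le> exp (a * ln (9 * a) - a)"
proof -
  have "ln (x / (9 * a)) \<le> x / (9 * a) - 1" using assms by (intro ln_le_minus_one) simp
  then have "a * ln (x / (9 * a)) \<le> a * (x / (9 * a) - 1)" using assms by (intro mult_left_mono) auto
  moreover have "ln (x / (9 * a)) = ln x - ln (9 * a)" using assms by (simp add: ln_div)
  moreover have "a * (x / (9 * a) - 1) = x / 9 - a" using assms by (simp add: field_simps)
  ultimately have "a * ln x - x / 9 \<le> a * ln (9 * a) - a" by (simp only: right_diff_distrib)
  then show ?thesis using assms by (simp add: powr_def flip: exp_add)
qed

text \<open>
  With \<open>\<tau> = 1 + t\<close> and \<open>x = 4^k \<tau>\<close> the term is at most a constant times \<open>\<tau>^(- a / 2)\<close> times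
  \<open>x^(a / 2) exp(- x / 9)\<close>.  The latter is bounded by \<open>x^(a / 2)\<close> and by a multiple of
  \<open>x^(- a / 2)\<close>, so it decays geometrically in the distance of \<open>k\<close> from the index \<open>- j\<close> at
  which \<open>x \<approx> 1\<close>, uniformly in \<open>t\<close>.
\<close>

lemma low_frequency_sum:
  fixes a :: real
  assumes a: "a > 0"
  shows "\<exists>D>0. \<forall>t\<ge>0. \<forall>F. finite F \<longrightarrow> F \<subseteq> {..<0} \<longrightarrow>
    (\<Sum>k\<in>F. 2 powr (of_int k * a) * exp (- decay_rate k * t)) \<le> D * (1 + t) powr (- a / 2)"
proof -
  define D1 where "D1 = max 1 (exp (a * ln (9 * a) - a))"
  define q :: real where "q = 2 powr (- a)"
  have q: "0 < q" "q < 1" using a by (auto simp: q_def powr_less_one)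
  define D where "D = exp 1 * (D1 * 2 powr a * (2 / (1 - q)))"
  have D1: "D1 \<ge> 1" by (simp add: D1_def)
  have D: "D > 0" using D1 q by (simp add: D_def)
  have "(\<Sum>k\<in>F. 2 powr (of_int k * a) * exp (- decay_rate k * t)) \<le> D * (1 + t) powr (- a / 2)"
    if t: "t \<ge> 0" and F: "finite F" "F \<subseteq> {..<0}" for t F
  proof -
    define \<tau> where "\<tau> = 1 + t"
    have \<tau>: "\<tau> \<ge> 1" using t by (simp add: \<tau>_def)
    \<comment> \<open>The power of four just below \<open>\<tau>\<close>, so that \<open>4^(k + j) \<le> x < 4^(k + j + 1)\<close> below.\<close>
    define j where "j = \<lfloor>log 4 \<tau>\<rfloor>"
    have j: "4 powr of_int j \<le> \<tau>" "\<tau> < 4 powr (of_int j + 1)"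
    proof -
      have "4 powr of_int j \<le> 4 powr (log 4 \<tau>)" by (intro powr_mono) (auto simp: j_def)
      then show "4 powr of_int j \<le> \<tau>" using \<tau> by simp
      have "4 powr (log 4 \<tau>) < 4 powr (of_int j + 1)" by (intro powr_less_mono) (auto simp: j_def)
      then show "\<tau> < 4 powr (of_int j + 1)" using \<tau> by simp
    qed
    have summand: "2 powr (of_int k * a) * exp (- decay_rate k * t)
        \<le> exp 1 * (D1 * 2 powr a) * \<tau> powr (- a / 2) * q ^ nat \<bar>k + j\<bar>" if k: "k \<in> F" for k
    proof -
      have k0: "k < 0" using k F by auto
      define x where "x = 4 powr of_int k * \<tau>"
      have x: "x > 0" using \<tau> by (simp add: x_def)
      have fk: "4 powr of_int k = (4 powi k :: real)" by (simp add: powr_real_of_int')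
      have fk1: "4 powr of_int k \<le> (1::real)" using powr_mono[of "of_int k" 0 "4::real"] k0 by simp
      have rate: "decay_rate k = 4 powr of_int k / 9" using fk fk1 by (simp add: decay_rate_def)
      \<comment> \<open>Passing from \<open>t\<close> to \<open>1 + t\<close> costs at most a factor \<open>exp 1\<close>, since \<open>4^k \<le> 1\<close>.\<close>
      have e: "exp (- decay_rate k * t) \<le> exp 1 * exp (- x / 9)"
      proof -
        have "- decay_rate k * t = 4 powr of_int k / 9
          + - x / 9" by (simp add: rate x_def \<tau>_def field_simps)
        also have "\<dots> \<le> 1 + - x / 9" using fk1 by simp
        finally show ?thesis by (simp flip: exp_add)
      qed
      have p: "2 powr (of_int k * a) = x powr (a / 2) * \<tau> powr (- a / 2)"
      proof -
        have "x powr (a / 2) * \<tau> powr (- a / 2) = (4 powr of_int k) powr (a / 2)"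
          using \<tau> by (simp add: x_def powr_mult powr_minus)
        also have "\<dots> = (2 powr 2) powr (of_int k * (a / 2))" by (simp add: powr_powr)
        also have "\<dots> = 2 powr (of_int k * a)" unfolding powr_powr by simp
        finally show ?thesis by simp
      qed
      have g: "x powr (a / 2) * exp (- x / 9) \<le> D1 * 2 powr a * q ^ nat \<bar>k + j\<bar>"
      proof (cases "k + j \<ge> 0")
        case True
        have "x powr (a / 2) * exp (- x / 9) = x powr (- a / 2) * (x powr a * exp (- x / 9))"
          by (simp add: mult.assoc[symmetric] flip: powr_add)
        also have "\<dots> \<le> x powr (- a / 2) * D1"
          using powr_exp_bound[OF a x] by (intro mult_left_mono) (auto simp: D1_def)
        also have "x powr (- a / 2) \<le> (4 powr (of_int (k + j))) powr (- a / 2)"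
        proof (rule powr_mono2')
          show "4 powr of_int (k + j) \<le> x" using j(1) by (simp add: x_def powr_add)
        qed (use a in auto)
        also have "(4 powr (of_int (k + j))) powr (- a / 2) = q ^ nat \<bar>k + j\<bar>"
        proof -
          have "q ^ nat \<bar>k + j\<bar> = q powr (of_int (k
            + j))" using True q by (simp add: powr_realpow[symmetric])
          also have "\<dots> = (2 powr 2) powr (of_int (k
            + j) * (- a / 2))" unfolding q_def powr_powr by (simp add: mult.commute)
          also have "\<dots> = (4 powr (of_int (k + j))) powr (- a / 2)" by (simp add: powr_powr)
          finally show ?thesis by simp
        qed
        finally have "x powr (a / 2) * exp (- x / 9) \<le> q ^ nat \<bar>k + j\<bar> * D1" using D1 by simp
        also have "\<dots> \<le> q ^ nat \<bar>k + j\<bar> * D1 * 2 powr a"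
          using mult_left_mono[of 1 "2 powr a" "q ^ nat \<bar>k
            + j\<bar> * D1"] D1 q a by (simp add: ge_one_powr_ge_zero)
        finally show ?thesis by (simp add: mult_ac)
      next
        case False
        have "x powr (a / 2) * exp (- x / 9) \<le> x powr (a / 2) * 1"
          using x by (intro mult_left_mono) auto
        also have "\<dots> \<le> (4 powr (of_int (k + j) + 1)) powr (a / 2)"
        proof -
          have "x \<le> 4 powr (of_int (k + j) + 1)"
          proof -
            have "x \<le> 4 powr of_int k * 4 powr (of_int j
              + 1)" unfolding x_def using j(2) by (intro mult_left_mono) auto
            then show ?thesis by (simp add: add.assoc flip: powr_add)
          qed
          then show ?thesis using a x by (simp add: powr_mono2)
        qed
        also have "\<dots> = q ^ nat \<bar>k + j\<bar> * 2 powr a"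
        proof -
          have "q ^ nat \<bar>k + j\<bar> = q powr (- of_int (k
            + j))" using False q by (simp add: powr_realpow[symmetric])
          then have "q ^ nat \<bar>k + j\<bar> * 2 powr a = 2 powr (a * of_int (k + j) + a)"
            unfolding q_def powr_powr powr_add by (simp add: algebra_simps)
          also have "a * of_int (k + j) + a
            = 2 * ((of_int (k + j) + 1) * (a / 2))" by (simp add: field_simps)
          also have "2 powr (2 * ((of_int (k + j) + 1) * (a / 2)))
            = (2 powr 2) powr ((of_int (k + j) + 1) * (a / 2))"
            by (simp only: powr_powr)
          also have "\<dots> = (4 powr (of_int (k + j) + 1)) powr (a / 2)" by (simp add: powr_powr)
          finally show ?thesis by simp
        qed
        also have "\<dots> \<le> D1 * (q ^ nat \<bar>k + j\<bar> * 2 powr a)"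
          using D1 q mult_right_mono[OF D1, of "q ^ nat \<bar>k + j\<bar> * 2 powr a"] by simp
        finally show ?thesis by (simp add: mult_ac)
      qed
      have "2 powr (of_int k * a) * exp (- decay_rate k * t)
        \<le> (x powr (a / 2) * \<tau> powr (- a / 2)) * (exp 1 * exp (- x / 9))"
        unfolding p using e by (intro mult_left_mono) auto
      also have "\<dots> = exp 1 * \<tau> powr (- a / 2) * (x powr (a / 2) * exp (- x / 9))" by (simp add: mult_ac)
      also have "\<dots> \<le> exp 1 * \<tau> powr (- a / 2) * (D1 * 2 powr a * q ^ nat \<bar>k + j\<bar>)"
        by (intro mult_left_mono g) auto
      finally show ?thesis by (simp add: mult_ac)
    qed
    have "(\<Sum>k\<in>F. 2 powr (of_int k * a) * exp (- decay_rate k * t))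
      \<le> (\<Sum>k\<in>F. exp 1 * (D1 * 2 powr a) * \<tau> powr (- a / 2) * q ^ nat \<bar>k + j\<bar>)"
      by (rule sum_mono[OF summand])
    also have "\<dots> = exp 1 * (D1 * 2 powr a) * \<tau> powr (- a / 2) * (\<Sum>n\<in>(\<lambda>k. k + j) ` F. q ^ nat \<bar>n\<bar>)"
      by (simp add: sum.reindex sum_distrib_left)
    also have "\<dots> \<le> exp 1 * (D1 * 2 powr a) * \<tau> powr (- a / 2) * (2 / (1 - q))"
      using D1 F by (intro mult_left_mono sum_geometric_int q) auto
    finally show ?thesis by (simp add: D_def \<tau>_def mult_ac)
  qed
  then show ?thesis using D by blast
qed

text \<open>
  Write each power as \<open>z z^(\<rho> - 1)\<close> and enlarge the base of the second factor to \<open>x + y\<close>.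
\<close>

lemma powr_superadditive:
  fixes x y \<rho> :: real
  assumes "0 \<le> x" "0 \<le> y" "1 \<le> \<rho>"
  shows "x powr \<rho> + y powr \<rho> \<le> (x + y) powr \<rho>"
proof -
  have split: "z powr \<rho> = z * z powr (\<rho> - 1)" if "0 \<le> z" for z :: real
    using that by (cases "z = 0") (auto simp: powr_diff)
  have "x * x powr (\<rho> - 1) \<le> x * (x + y) powr (\<rho> - 1)" "y * y powr (\<rho> - 1) \<le> y * (x + y) powr (\<rho> - 1)"
    using assms by (intro mult_left_mono powr_mono2; simp)+
  then show ?thesis using assms by (simp add: split ring_distribs)
qed

lemma ennpowr_superadditive:
  assumes "1 \<le> \<rho>"
  shows "ennpowr x \<rho> + ennpowr y \<rho> \<le> ennpowr (x + y) \<rho>"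
proof (cases "x = \<infinity> \<or> y = \<infinity>")
  case True
  then show ?thesis by (auto simp: ennpowr_def)
next
  case False
  then obtain a b where "x = ennreal a" "0 \<le> a" "y = ennreal b" "0 \<le> b" by (cases x; cases y) auto
  then show ?thesis using powr_superadditive[of a b \<rho>] assms
    by (simp add: ennpowr_def ennreal_leI flip: ennreal_plus)
qed

lemma sum_ennpowr_le:
  assumes "1 \<le> \<rho>"
  shows "(\<Sum>k\<in>F. ennpowr (x k) \<rho>) \<le> ennpowr (\<Sum>k\<in>F. x k) \<rho>"
proof (induction F rule: infinite_finite_induct)
  case (insert k F)
  then have "(\<Sum>k\<in>insert k F. ennpowr (x k) \<rho>) \<le> ennpowr (x k) \<rho> + ennpowr (\<Sum>k\<in>F. x k) \<rho>"
    by (simp add: add_left_mono)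
  also have "\<dots> \<le> ennpowr (\<Sum>k\<in>insert k F. x k) \<rho>"
    using insert by (simp add: ennpowr_superadditive assms)
  finally show ?case .
qed (auto simp: ennpowr_def)

lemma ennpowr_ennpowr: "a > 0 \<Longrightarrow> b > 0 \<Longrightarrow> ennpowr (ennpowr x a) b = ennpowr x (a * b)"
  by (auto simp: ennpowr_def powr_powr)

lemma ennpowr_one: "ennpowr x 1 = x"
  by (auto simp: ennpowr_def less_top)

definition besov_term :: "('a::euclidean_space \<Rightarrow> real) \<Rightarrow> real \<Rightarrow> 'a functional \<Rightarrow> int \<Rightarrow> ennreal" where
  "besov_term chi s T k = ennreal (2 powr (of_int k * s)) * Lp_norm_distr 2 (lp_block chi k T)"

lemma besov_norm_infinity: "besov_norm chi s 2 \<infinity> T = (SUP k. besov_term chi s T k)"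
  by (simp add: besov_norm_def besov_term_def)

lemma besov_norm_finite:
  "r \<noteq> \<infinity> \<Longrightarrow> besov_norm chi s 2 r T = ennpowr (\<Sum>\<^sub>\<infinity>k. ennpowr (besov_term chi s T k) (enn2real r)) (1 / enn2real r)"
  by (simp add: besov_norm_def besov_term_def)

lemma besov_term_le_norm: "besov_term chi s T k \<le> besov_norm chi s 2 \<infinity> T"
  unfolding besov_norm_infinity by (rule SUP_upper) simp

text \<open>
  Superadditivity of the power \<open>\<rho>\<close> serves twice: it bounds the norm of the low part by its plain sum
  \<open>A\<close>, and it puts the low and the high part together.
\<close>

lemma besov_sum_two_scales:
  fixes x y z :: "int \<Rightarrow> ennreal"
  assumes \<rho>: "1 \<le> \<rho>"
    and low: "\<And>k. k < 0 \<Longrightarrow> x k \<le> y k" and high: "\<And>k. k \<ge> 0 \<Longrightarrow> x k \<le> ennreal c * z k" and c: "c > 0"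
    and A: "\<And>F. finite F \<Longrightarrow> F \<subseteq> {..<0} \<Longrightarrow> (\<Sum>k\<in>F. y k) \<le> A"
  shows "ennpowr (\<Sum>\<^sub>\<infinity>k. ennpowr (x k) \<rho>) (1 / \<rho>)
    \<le> A + ennreal c * ennpowr (\<Sum>\<^sub>\<infinity>k. ennpowr (z k) \<rho>) (1 / \<rho>)"
proof -
  have \<rho>0: "\<rho> > 0" using \<rho> by simp
  let ?Z = "\<Sum>\<^sub>\<infinity>k. ennpowr (z k) \<rho>"
  let ?B = "ennreal c * ennpowr ?Z (1 / \<rho>)"
  have fin: "(\<Sum>k\<in>F. ennpowr (x k) \<rho>) \<le> ennpowr (A + ?B) \<rho>" if F: "finite F" for F
  proof -
    have "F = (F \<inter> {..<0}) \<union> (F \<inter> {0..})" by auto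
    then have "(\<Sum>k\<in>F. ennpowr (x k) \<rho>) = (\<Sum>k\<in>F \<inter> {..<0}. ennpowr (x k) \<rho>)
      + (\<Sum>k\<in>F \<inter> {0..}. ennpowr (x k) \<rho>)"
      using sum.union_disjoint[of "F \<inter> {..<0}" "F \<inter> {0..}" "\<lambda>k. ennpowr (x k) \<rho>"] F by force
    also have "(\<Sum>k\<in>F \<inter> {..<0}. ennpowr (x k) \<rho>) \<le> ennpowr A \<rho>"
    proof -
      have "(\<Sum>k\<in>F \<inter> {..<0}. ennpowr (x k) \<rho>)
        \<le> ennpowr (\<Sum>k\<in>F \<inter> {..<0}. x k) \<rho>" by (rule sum_ennpowr_le[OF \<rho>])
      also have "\<dots> \<le> ennpowr A \<rho>"
      proof (rule ennpowr_mono)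
        have "(\<Sum>k\<in>F \<inter> {..<0}. x k) \<le> (\<Sum>k\<in>F \<inter> {..<0}. y k)" by (intro sum_mono low) auto
        also have "\<dots> \<le> A" using F by (intro A) auto
        finally show "(\<Sum>k\<in>F \<inter> {..<0}. x k) \<le> A" .
      qed (use \<rho>0 in simp)
      finally show ?thesis .
    qed
    also have "(\<Sum>k\<in>F \<inter> {0..}. ennpowr (x k) \<rho>) \<le> ennpowr ?B \<rho>"
    proof -
      have "(\<Sum>k\<in>F \<inter> {0..}. ennpowr (x k) \<rho>) \<le> (\<Sum>k\<in>F \<inter> {0..}. ennpowr (ennreal c * z k) \<rho>)"
        using \<rho>0 by (intro sum_mono ennpowr_mono high) auto
      also have "\<dots> = ennreal (c powr \<rho>) * (\<Sum>k\<in>F \<inter> {0..}. ennpowr (z k) \<rho>)"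
        by (simp add: ennpowr_cmult[OF c \<rho>0] sum_distrib_left)
      also have "\<dots> \<le> ennreal (c powr \<rho>) * ?Z"
      proof (rule mult_left_mono)
        have "(\<Sum>k\<in>F \<inter> {0..}. ennpowr (z k) \<rho>) \<le> (SUP G\<in>{G. finite G \<and> G \<subseteq> UNIV}. \<Sum>k\<in>G. ennpowr (z k) \<rho>)"
          using F by (intro SUP_upper) auto
        then show "(\<Sum>k\<in>F \<inter> {0..}. ennpowr (z k) \<rho>) \<le> ?Z"
          by (subst nonneg_infsum_complete) auto
      qed simp
      also have "\<dots> = ennpowr ?B \<rho>"
        unfolding ennpowr_cmult[OF c \<rho>0] using \<rho>0 by (simp add: ennpowr_ennpowr ennpowr_one)
      finally show ?thesis .
    qed
    also have "ennpowr A \<rho> + ennpowr ?B \<rho> \<le> ennpowr (A + ?B) \<rho>" by (rule ennpowr_superadditive[OF \<rho>])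
    finally show ?thesis by (simp add: add_mono)
  qed
  have "(\<Sum>\<^sub>\<infinity>k. ennpowr (x k) \<rho>) \<le> ennpowr (A + ?B) \<rho>"
  proof (subst nonneg_infsum_complete)
    show "(SUP F\<in>{F. finite F \<and> F \<subseteq> UNIV}. \<Sum>k\<in>F. ennpowr (x k) \<rho>) \<le> ennpowr (A + ?B) \<rho>"
      using fin by (intro SUP_least) blast
  qed simp
  then have "ennpowr (\<Sum>\<^sub>\<infinity>k. ennpowr (x k) \<rho>) (1 / \<rho>) \<le> ennpowr (ennpowr (A + ?B) \<rho>) (1 / \<rho>)"
    using \<rho>0 by (intro ennpowr_mono) auto
  also have "ennpowr (ennpowr (A + ?B) \<rho>) (1 / \<rho>) = A + ?B"
    using \<rho>0 by (subst ennpowr_ennpowr) (simp_all add: ennpowr_one)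
  finally show ?thesis .
qed

lemma besov_term_decay:
  assumes sol: "solves_linear u u0" and chi: "lp_cutoff chi" and t: "t \<ge> 0"
  shows "besov_term chi \<sigma> (u t) k \<le> ennreal (exp (- decay_rate k * t)) * besov_term chi \<sigma> u0 k"
  unfolding besov_term_def
  using mult_left_mono[OF block_decay[OF sol chi t, of k], of "ennreal (2 powr (of_int k * \<sigma>))"]
  by (simp add: mult_ac)

lemma decay_rate_pos: "decay_rate k > 0"
  by (simp add: decay_rate_def)

lemma decay_rate_high: "k \<ge> 0 \<Longrightarrow> decay_rate k = 1 / 9"
  by (simp add: decay_rate_def one_le_power_int)

text \<open>
  No block grows.
\<close>

lemma besov_infinity_norm_nonincreasing:
  assumes sol: "solves_linear u u0" and chi: "lp_cutoff chi" and t: "t \<ge> 0"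
  shows "besov_norm chi s 2 \<infinity> (u t) \<le> besov_norm chi s 2 \<infinity> u0"
  unfolding besov_norm_infinity[of _ _ "u t"]
proof (rule SUP_least)
  fix k
  have "exp (- decay_rate k * t) \<le> 1" using decay_rate_pos[of k] t by simp
  then have "ennreal (exp (- decay_rate k * t)) * besov_term chi s u0 k \<le> 1 * besov_term chi s u0 k"
    by (intro mult_right_mono) (auto simp: ennreal_le_1)
  then show "besov_term chi s (u t) k \<le> besov_norm chi s 2 \<infinity> u0"
    using besov_term_decay[OF sol chi t, of s k] besov_term_le_norm[of chi s u0 k] by simp
qed

text \<open>
  High frequency blocks carry their own exponential factor.  A low frequency block is measured by the
  norm of index \<open>- s\<close> at the price of the factor \<open>2^(k (\<sigma> + s))\<close>.
\<close>

lemma besov_norm_decay: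
  assumes chi: "lp_cutoff chi" and r: "1 \<le> r" and pos: "\<sigma> + s > 0"
  shows "\<exists>D>0. \<forall>u0 u t. solves_linear u u0 \<longrightarrow> t \<ge> 0 \<longrightarrow>
    besov_norm chi \<sigma> 2 r (u t) \<le> ennreal (D * (1 + t) powr (- (\<sigma> + s) / 2)) * besov_norm chi (- s) 2 \<infinity> u0
      + ennreal (exp (- (1/9) * t)) * besov_norm chi \<sigma> 2 r u0"
proof -
  obtain D where D: "D > 0" and Dall: "\<forall>t\<ge>0. \<forall>F. finite F \<longrightarrow> F \<subseteq> {..<0} \<longrightarrow>
    (\<Sum>k\<in>F. 2 powr (of_int k * (\<sigma> + s)) * exp (- decay_rate k * t)) \<le> D * (1 + t) powr (- (\<sigma> + s) / 2)"
    using low_frequency_sum[OF pos] by (elim exE conjE)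
  note Dsum = Dall[rule_format]
  have "besov_norm chi \<sigma> 2 r (u t) \<le> ennreal (D * (1 + t) powr (- (\<sigma>
    + s) / 2)) * besov_norm chi (- s) 2 \<infinity> u0
      + ennreal (exp (- (1/9) * t)) * besov_norm chi \<sigma> 2 r u0"
    if sol: "solves_linear u u0" and t: "t \<ge> 0" for u0 u t
  proof -
    let ?U = "besov_norm chi (- s) 2 \<infinity> u0" and ?c = "exp (- (1/9) * t)"
    let ?A = "ennreal (D * (1 + t) powr (- (\<sigma> + s) / 2)) * ?U"
    define w where "w k = 2 powr (of_int k * (\<sigma> + s)) * exp (- decay_rate k * t)" for k
    have w0: "0 \<le> w k" for k by (simp add: w_def)
    have low: "besov_term chi \<sigma> (u t) k \<le> ennreal (w k) * ?U" for k
    proof -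
      have "besov_term chi \<sigma> (u t) k \<le> ennreal (exp (- decay_rate k * t)) * besov_term chi \<sigma> u0 k"
        by (rule besov_term_decay[OF sol chi t])
      also have "besov_term chi \<sigma> u0 k = ennreal (2 powr (of_int k * (\<sigma>
        + s))) * besov_term chi (- s) u0 k"
        unfolding besov_term_def mult.assoc[symmetric]
        by (simp flip: ennreal_mult powr_add add: algebra_simps)
      also have "ennreal (exp (- decay_rate k * t)) * (ennreal (2 powr (of_int k * (\<sigma>
        + s))) * besov_term chi (- s) u0 k)
          = ennreal (w k) * besov_term chi (- s) u0 k"
        by (simp add: w_def ennreal_mult mult_ac)
      also have "\<dots> \<le> ennreal (w k) * ?U" by (intro mult_left_mono besov_term_le_norm) simp
      finally show ?thesis .
    qed
    have high: "besov_term chi \<sigma> (u t) k \<le> ennreal ?c * besov_term chi \<sigma> u0 k" if "k \<ge> 0" for k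
      using besov_term_decay[OF sol chi t, of \<sigma> k] by (simp add: decay_rate_high[OF that])
    have A: "(\<Sum>k\<in>F. ennreal (w k) * ?U) \<le> ?A" if "finite F" "F \<subseteq> {..<0}" for F
    proof -
      have "(\<Sum>k\<in>F. ennreal (w k) * ?U) = ennreal (\<Sum>k\<in>F. w k) * ?U"
        by (simp add: sum_distrib_right[symmetric] w0)
      also have "\<dots> \<le> ?A"
        using Dsum[OF t that] by (intro mult_right_mono ennreal_leI) (simp_all add: w_def)
      finally show ?thesis .
    qed
    show ?thesis
    proof (cases "r = \<infinity>")
      case True
      show ?thesis unfolding True besov_norm_infinity[of _ \<sigma>]
      proof (rule SUP_least)
        fix k
        show "besov_term chi \<sigma> (u t) k \<le> ?A + ennreal ?c * (SUP k. besov_term chi \<sigma> u0 k)"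
        proof (cases "k < 0")
          case True
          have "besov_term chi \<sigma> (u t) k \<le> (\<Sum>k\<in>{k}. ennreal (w k) * ?U)" using low[of k] by simp
          also have "\<dots> \<le> ?A" using True by (intro A) auto
          finally show ?thesis by (simp add: add_increasing2)
        next
          case False
          then have "besov_term chi \<sigma> (u t) k \<le> ennreal ?c * besov_term chi \<sigma> u0 k" by (intro high) simp
          also have "\<dots> \<le> ennreal ?c * (SUP k. besov_term chi \<sigma> u0 k)"
            by (intro mult_left_mono SUP_upper) auto
          finally show ?thesis by (simp add: add_increasing)
        qed
      qed
    next
      case False
      then have "enn2real 1 \<le> enn2real r" using r by (intro enn2real_mono) (auto simp: less_top)
      then have \<rho>: "1 \<le> enn2real r" by simp
      show ?thesis unfolding besov_norm_finite[OF False]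
        by (rule besov_sum_two_scales[OF \<rho>, where y="\<lambda>k. ennreal (w k) * ?U"]) (use low high A in auto)
    qed
  qed
  then show ?thesis using D by blast
qed

theorem theorem3p1:
  fixes chi :: "'a::euclidean_space \<Rightarrow> real" and r :: ennreal and \<sigma> s :: real
  assumes "lp_cutoff chi" and "1 \<le> r" and "\<sigma> + s > 0"
  shows
    "(\<forall>u0 \<in> besov_space chi (- s) 2 \<infinity> \<inter> besov_space chi \<sigma> 2 r. \<forall>u. solves_linear u u0 \<longrightarrow>
        (\<exists>C0::real. \<forall>t\<ge>0. u t \<in> besov_space chi (- s) 2 \<infinity> \<and>
           besov_norm chi (- s) 2 \<infinity> (u t) \<le> ennreal C0)) \<and>
     (\<exists>lam>0. \<exists>C>0.
        \<forall>u0 \<in> besov_space chi (- s) 2 \<infinity> \<inter> besov_space chi \<sigma> 2 r. \<forall>u. solves_linear u u0 \<longrightarrow>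
        (\<forall>t\<ge>0. u t \<in> besov_space chi \<sigma> 2 r \<and>
           besov_norm chi \<sigma> 2 r (u t)
             \<le> ennreal (C * (1 + t) powr (- (\<sigma> + s) / 2)) * besov_norm chi (- s) 2 \<infinity> u0
               + ennreal (C * exp (- lam * t)) * besov_norm chi \<sigma> 2 r u0))"
proof (intro conjI ballI allI impI)
  fix u0 u
  assume u0: "u0 \<in> besov_space chi (- s) 2 \<infinity> \<inter> besov_space chi \<sigma> 2 r" and sol: "solves_linear u u0"
  have fin: "besov_norm chi (- s) 2 \<infinity> u0 < \<infinity>" and S: "u0 \<in> S_h chi"
    using u0 by (auto simp: besov_space_def)
  have "u t \<in> besov_space chi (- s) 2 \<infinity> \<and> besov_norm chi (- s) 2 \<infinity> (u t)
    \<le> ennreal (enn2real (besov_norm chi (- s) 2 \<infinity> u0))"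
    if "t \<ge> 0" for t
    using besov_infinity_norm_nonincreasing[OF sol assms(1) that, of "- s"] solution_S_h[OF sol assms(1) S that] fin
    by (auto simp: besov_space_def intro: order_le_less_trans)
  then show "\<exists>C0::real. \<forall>t\<ge>0. u t \<in> besov_space chi (- s) 2 \<infinity> \<and> besov_norm chi (- s) 2 \<infinity> (u t)
    \<le> ennreal C0"
    by blast
next
  obtain D where D: "D > 0" and Dall: "\<forall>u0 u t. solves_linear u u0 \<longrightarrow> t \<ge> 0 \<longrightarrow>
    besov_norm chi \<sigma> 2 r (u t) \<le> ennreal (D * (1 + t) powr (- (\<sigma> + s) / 2)) * besov_norm chi (- s) 2 \<infinity> u0
      + ennreal (exp (- (1/9) * t)) * besov_norm chi \<sigma> 2 r u0"
    using besov_norm_decay[OF assms] by (elim exE conjE)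
  note bound = Dall[rule_format]
  \<comment> \<open>One constant has to serve for both terms, and the exponential term needs at least 1.\<close>
  let ?C = "max D 1"
  have "u t \<in> besov_space chi \<sigma> 2 r \<and> besov_norm chi \<sigma> 2 r (u t)
             \<le> ennreal (?C * (1 + t) powr (- (\<sigma> + s) / 2)) * besov_norm chi (- s) 2 \<infinity> u0
               + ennreal (?C * exp (- (1/9) * t)) * besov_norm chi \<sigma> 2 r u0"
    if u0: "u0 \<in> besov_space chi (- s) 2 \<infinity> \<inter> besov_space chi \<sigma> 2 r" and sol: "solves_linear u u0" and t: "t \<ge> 0" for u0 u t
  proof
    have fin: "besov_norm chi (- s) 2 \<infinity> u0 < \<infinity>" "besov_norm chi \<sigma> 2 r u0 < \<infinity>" and S: "u0 \<in> S_h chi"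
      using u0 by (auto simp: besov_space_def)
    have "besov_norm chi \<sigma> 2 r (u t) \<le> ennreal (D * (1 + t) powr (- (\<sigma>
      + s) / 2)) * besov_norm chi (- s) 2 \<infinity> u0
      + ennreal (exp (- (1/9) * t)) * besov_norm chi \<sigma> 2 r u0" by (rule bound[OF sol t])
    also have "\<dots> \<le> ennreal (?C * (1 + t) powr (- (\<sigma> + s) / 2)) * besov_norm chi (- s) 2 \<infinity> u0
               + ennreal (?C * exp (- (1/9) * t)) * besov_norm chi \<sigma> 2 r u0"
      using mult_right_mono[of 1 ?C "exp (- (1/9) * t)"]
      by (intro add_mono mult_right_mono ennreal_leI) auto
    finally show le: "besov_norm chi \<sigma> 2 r (u t)
      \<le> ennreal (?C * (1 + t) powr (- (\<sigma> + s) / 2)) * besov_norm chi (- s) 2 \<infinity> u0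
               + ennreal (?C * exp (- (1/9) * t)) * besov_norm chi \<sigma> 2 r u0" .
    also have "\<dots> < \<infinity>" using fin by (auto simp: ennreal_mult_less_top)
    finally show "u t \<in> besov_space chi \<sigma> 2 r"
      using solution_S_h[OF sol assms(1) S t] by (simp add: besov_space_def)
  qed
  then show "\<exists>lam>0. \<exists>C>0.
        \<forall>u0 \<in> besov_space chi (- s) 2 \<infinity> \<inter> besov_space chi \<sigma> 2 r. \<forall>u. solves_linear u u0 \<longrightarrow>
        (\<forall>t\<ge>0. u t \<in> besov_space chi \<sigma> 2 r \<and>
           besov_norm chi \<sigma> 2 r (u t)
             \<le> ennreal (C * (1 + t) powr (- (\<sigma> + s) / 2)) * besov_norm chi (- s) 2 \<infinity> u0
               + ennreal (C * exp (- lam * t)) * besov_norm chi \<sigma> 2 r u0)"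
    using D by (intro exI[of _ "1/9"] exI[of _ ?C] conjI) auto
qed

end
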